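(* Let $1\le q\le\alpha\le p\le\infty$. If $\alpha\in\{q,p\}$ then $(L^q,L^p)^\alpha(\mu)=L^\alpha(\mu)$.
   Context: Fix a real number $\kappa>-1/2$. Let $\mu$ be the measure on $\mathbb R$ given by $d\mu(x)=\left(2^{\kappa+1}\Gamma(\kappa+1)\right)^{-1}|x|^{2\kappa+1}dx$; $L^p(\mu)$ ($1\le p\le\infty$) is the corresponding Lebesgue space with norm $\|\cdot\|_p$, and $L^0(\mu)$ is the space of $\mu$-a.e. equivalence classes of complex-valued $\mu$-measurable functions on $\mathbb R$. Convention: $1/\infty=0$. Dunkl translation. Let $j_\kappa(z)=\Gamma(\kappa+1)\sum_{n\ge0}\frac{(-1)^nz^{2n}}{n!\,2^{2n}\Gamma(n+\kappa+1)}$ and let $\mathfrak E(z)=j_\kappa(iz)+\frac{z}{2(\kappa+1)}j_{\kappa+1}(iz)$, $z\in\mathbb C$ (the Dunkl kernel). The Dunkl transform is $\mathcal F f(\lambda)=\int_{\mathbb R}\mathfrak E(-i\lambda x)f(x)\,d\mu(x)$ for $f\in L^1(\mu)$, and it extends uniquely to an isometric isomorphism of $L^2(\mu)$. For $y\in\mathbb R$ the generalized (Dunkl) translation $\tau_y$ is defined on $L^2(\mu)$ by $\mathcal F(\tau_yf)(x)=\mathfrak E(ixy)\mathcal F(f)(x)$, and it extends to a bounded operator on every $L^p(\mu)$, $p\ge1$. Balls. $B_r=B(0,r)=(-r,r)$, and for $x\ne0$, $B(x,r)=\{y\in\mathbb R:\max\{0,|x|-r\}<|y|<|x|+r\}$.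 The function $\tau_x\chi_{B_r}$ satisfies $0\le\tau_x\chi_{B_r}\le1$ and is supported in $B(x,r)$. For a nonnegative measurable $g$, the integral $\int_{\mathbb R}(\tau_yg)\chi_{B_r}\,d\mu$ is understood as $\int_{\mathbb R}g(x)\,\tau_{-y}\chi_{B_r}(x)\,d\mu(x)\in[0,\infty]$. Spaces. For $1\le q,p\le\infty$, $r>0$ and $f\in L^0(\mu)$, with the $L^p(\mu)$-norm taken in the variable $y$, put $${}_r\|f\|_{q,p}=\Big\|\Big[\int_{\mathbb R}(\tau_y|f|^q)(x)\chi_{B_r}(x)\,d\mu(x)\Big]^{1/q}\Big\|_p\ (q<\infty),\qquad {}_r\|f\|_{\infty,p}=\big\|\,\|f\chi_{B(y,r)}\|_\infty\big\|_p .$$ For $1\le q\le\alpha\le p\le\infty$ put $\|f\|_{q,p,\alpha}=\sup_{r>0}\mu(B_r)^{\frac1\alpha-\frac1q-\frac1p}\ {}_r\|f\|_{q,p}$ and $(L^q,L^p)^\alpha(\mu)=\{f\in L^0(\mu):\|f\|_{q,p,\alpha}<\infty\}$. *)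

theory Defs
  imports "HOL-Probability.Essential_Supremum"
begin

text \<open>
  Exponents \<open>1 \<le> p \<le> \<infinity>\<close> have type \<^typ>\<open>ennreal\<close>, so that \<open>1 / \<infinity> = 0\<close> holds by definition of
  division. Spaces of a.e. equivalence classes are rendered as the sets of all measurable
  representatives; every (semi)norm below depends only on the a.e. class of its argument, so equality
  of these sets is equality of the spaces of classes.
\<close>

text \<open>Power \<open>x\<^sup>a\<close> on \<open>[0,\<infinity>]\<close>; only used for real \<open>a > 0\<close>.\<close>

definition ennpowr :: "ennreal \<Rightarrow> real \<Rightarrow> ennreal" where
  "ennpowr x a = (if x = \<infinity> then \<infinity> else ennreal (enn2real x powr a))"

definition Lp_norm :: "'a measure \<Rightarrow> ennreal \<Rightarrow> ('a \<Rightarrow> ennreal) \<Rightarrow> ennreal" where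
  "Lp_norm M p g =
     (if p = \<infinity> then esssup M g
      else ennpowr (\<integral>\<^sup>+ x. ennpowr (g x) (enn2real p) \<partial>M) (enn2real (1 / p)))"

definition Lp_space :: "'a measure \<Rightarrow> ennreal \<Rightarrow> ('a \<Rightarrow> complex) set" where
  "Lp_space M p = {f \<in> borel_measurable M. Lp_norm M p (\<lambda>x. ennreal (cmod (f x))) < \<infinity>}"

text \<open>
  The measure lives on the Borel sets. Every class of functions measurable with respect to its
  completion has a Borel representative, so this gives the same \<open>L\<^sup>0\<close> and \<open>L\<^sup>p\<close>.
\<close>

definition dunkl_measure :: "real \<Rightarrow> real measure" where
  "dunkl_measure \<kappa> =
     density lborel (\<lambda>x. ennreal (\<bar>x\<bar> powr (2 * \<kappa> + 1) / (2 powr (\<kappa> + 1) * Gamma (\<kappa> + 1))))"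


section \<open>Dunkl transform and translation\<close>

definition bessel_j :: "real \<Rightarrow> complex \<Rightarrow> complex" where
  "bessel_j \<kappa> z = of_real (Gamma (\<kappa> + 1)) *
     (\<Sum>n. (- 1) ^ n * z ^ (2 * n) / of_real (fact n * 2 ^ (2 * n) * Gamma (real n + \<kappa> + 1)))"

definition dunkl_kernel :: "real \<Rightarrow> complex \<Rightarrow> complex" where
  "dunkl_kernel \<kappa> z =
     bessel_j \<kappa> (\<i> * z) + z / of_real (2 * (\<kappa> + 1)) * bessel_j (\<kappa> + 1) (\<i> * z)"

definition dunkl_transform_L1 :: "real \<Rightarrow> (real \<Rightarrow> complex) \<Rightarrow> real \<Rightarrow> complex" where
  "dunkl_transform_L1 \<kappa> f l =
     (LINT x|dunkl_measure \<kappa>. dunkl_kernel \<kappa> (- \<i> * of_real l * of_real x) * f x)"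

definition L2_tendsto :: "real \<Rightarrow> (nat \<Rightarrow> real \<Rightarrow> complex) \<Rightarrow> (real \<Rightarrow> complex) \<Rightarrow> bool" where
  "L2_tendsto \<kappa> u f \<longleftrightarrow>
     (\<lambda>n. Lp_norm (dunkl_measure \<kappa>) 2 (\<lambda>x. ennreal (cmod (u n x - f x)))) \<longlonglongrightarrow> 0"

text \<open>
  Extension by continuity from \<open>L\<^sup>1 \<inter> L\<^sup>2\<close> to \<open>L\<^sup>2\<close>; the choice only fixes a representative of an
  a.e. class.
\<close>

definition dunkl_transform_L2 :: "real \<Rightarrow> (real \<Rightarrow> complex) \<Rightarrow> real \<Rightarrow> complex" where
  "dunkl_transform_L2 \<kappa> f =
     (SOME g. g \<in> Lp_space (dunkl_measure \<kappa>) 2 \<and>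
        (\<exists>u. (\<forall>n. u n \<in> Lp_space (dunkl_measure \<kappa>) 1 \<inter> Lp_space (dunkl_measure \<kappa>) 2) \<and>
             L2_tendsto \<kappa> u f \<and>
             L2_tendsto \<kappa> (\<lambda>n. dunkl_transform_L1 \<kappa> (u n)) g))"

text \<open>\<open>\<tau>\<^sub>y f\<close> for \<open>f \<in> L\<^sup>2\<close>, again up to the choice of a representative.\<close>

definition dunkl_translation :: "real \<Rightarrow> real \<Rightarrow> (real \<Rightarrow> complex) \<Rightarrow> real \<Rightarrow> complex" where
  "dunkl_translation \<kappa> y f =
     (SOME h. h \<in> Lp_space (dunkl_measure \<kappa>) 2 \<and>
        (AE x in dunkl_measure \<kappa>. dunkl_transform_L2 \<kappa> h x =
           dunkl_kernel \<kappa> (\<i> * of_real x * of_real y) * dunkl_transform_L2 \<kappa> f x))"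


section \<open>Balls and the spaces \<open>(L\<^sup>q, L\<^sup>p)\<^sup>\<alpha>\<close>\<close>

definition dunkl_ball :: "real \<Rightarrow> real \<Rightarrow> real set" where
  "dunkl_ball x r =
     (if x = 0 then {- r <..< r} else {y. max 0 (\<bar>x\<bar> - r) < \<bar>y\<bar> \<and> \<bar>y\<bar> < \<bar>x\<bar> + r})"

text \<open>
  \<open>\<integral> (\<tau>\<^sub>y g) \<chi>\<^bsub>B\<^sub>r\<^esub> d\<mu>\<close>, understood as \<open>\<integral> g(x) \<tau>\<^bsub>-y\<^esub>\<chi>\<^bsub>B\<^sub>r\<^esub>(x) d\<mu>(x)\<close>. The translate of an indicator
  has values in \<open>[0,1]\<close> a.e., so passing to the real part and to \<^typ>\<open>ennreal\<close> loses nothing.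
\<close>

definition dunkl_average :: "real \<Rightarrow> real \<Rightarrow> (real \<Rightarrow> ennreal) \<Rightarrow> real \<Rightarrow> ennreal" where
  "dunkl_average \<kappa> r g y =
     (\<integral>\<^sup>+ x. g x * ennreal (Re (dunkl_translation \<kappa> (- y) (indicator (dunkl_ball 0 r)) x))
        \<partial>dunkl_measure \<kappa>)"

definition amalgam_norm_r ::
    "real \<Rightarrow> real \<Rightarrow> ennreal \<Rightarrow> ennreal \<Rightarrow> (real \<Rightarrow> complex) \<Rightarrow> ennreal" where
  "amalgam_norm_r \<kappa> r q p f =
     Lp_norm (dunkl_measure \<kappa>) p
       (\<lambda>y. if q = \<infinity>
            then Lp_norm (dunkl_measure \<kappa>) \<infinity>
                   (\<lambda>x. ennreal (cmod (f x * indicator (dunkl_ball y r) x)))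
            else ennpowr
                   (dunkl_average \<kappa> r (\<lambda>x. ennreal (cmod (f x) powr enn2real q)) y)
                   (enn2real (1 / q)))"

definition amalgam_norm ::
    "real \<Rightarrow> ennreal \<Rightarrow> ennreal \<Rightarrow> ennreal \<Rightarrow> (real \<Rightarrow> complex) \<Rightarrow> ennreal" where
  "amalgam_norm \<kappa> q p \<alpha> f =
     (SUP r\<in>{0<..}.
        ennreal (measure (dunkl_measure \<kappa>) (dunkl_ball 0 r)
                   powr (enn2real (1 / \<alpha>) - enn2real (1 / q) - enn2real (1 / p)))
        * amalgam_norm_r \<kappa> r q p f)"

definition amalgam_space ::
    "real \<Rightarrow> ennreal \<Rightarrow> ennreal \<Rightarrow> ennreal \<Rightarrow> (real \<Rightarrow> complex) set" where
  "amalgam_space \<kappa> q p \<alpha> =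
     {f \<in> borel_measurable (dunkl_measure \<kappa>). amalgam_norm \<kappa> q p \<alpha> f < \<infinity>}"

end

theory Submission
  imports Defs "HOL-Probability.Probability" "HOL-Real_Asymp.Real_Asymp"
begin

text \<open>
  The Dunkl kernel has the positive integral representation
  \<open>E(z) = \<integral> exp (z t) d\<beta>(t)\<close> with the probability density proportional to
  \<open>(1 + t) (1 - t\<^sup>2) powr (\<kappa> - 1/2)\<close> on \<open>(-1, 1)\<close>. Comparing coefficients gives Weber's integral
  \<open>\<integral> exp (- x\<^sup>2 / (2 s)) E(a x) E(b x) d\<mu>(x) = s powr (\<kappa> + 1) exp (s (a\<^sup>2 + b\<^sup>2) / 2) E(s a b)\<close>,
  and two facts follow from it. The Gaussian regularisation of \<open>\<integral> \<bar>D f\<bar>\<^sup>2 d\<mu>\<close> is \<open>\<parallel>f\<parallel>\<^sup>2\<close> minus half a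
  Dirichlet form of the heat kernel; the form tends to 0, which proves Plancherel's theorem, so the
  transform is injective on \<open>L\<^sup>2\<close>. Moreover the product formula holds for Gaussians, and by
  approximation with polynomials in \<open>exp (- u)\<close> it carries over to indicators: the translate of the
  indicator of \<open>(-r, r)\<close> is \<open>K r x y = \<beta> {t. x\<^sup>2 + y\<^sup>2 - 2 x y t < r\<^sup>2}\<close>.

  This kernel is symmetric with values in \<open>[0, 1]\<close> and total mass \<open>\<mu> (-r, r)\<close>, it equals 1 for
  \<open>\<bar>x\<bar> + \<bar>y\<bar> < r\<close>, and it vanishes for \<open>\<bar>\<bar>x\<bar> - \<bar>y\<bar>\<bar> \<ge> r\<close>. If \<open>\<alpha> = q\<close>, Fubini bounds the norm from
  above and \<open>r \<rightarrow> \<infinity>\<close> from below; if \<open>\<alpha> = p\<close>, Jensen bounds it from above, and from below one lets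
  \<open>r \<rightarrow> 0\<close>, where the averages form an approximate identity on even functions.
\<close>

section \<open>The Dunkl kernel as a power series\<close>

text \<open>The translation is given only implicitly: a \<open>SOME\<close> applied to an identity
  between transforms that are themselves picked by \<open>SOME\<close>. To attach a formula to it,
  the transform on L2 has to exist and to be injective; Plancherel's theorem is there for that
  purpose. Weber's integral is proved on power series coefficients, where the Dunkl operator becomes
  multiplication by \<open>dth\<close> and integration by parts becomes the recursion of the
  Gaussian moments. Two kernels have to act as approximate identities, the heat kernel near x = y
  and the ball kernel near |x| = |y|, and one locale with a coordinate \<open>T\<close> covers both.
  The theorem compares sets, so finiteness of norms is all that is tracked and crude constants are
  harmless. When \<alpha> = p a function of the amalgam space is not known to be integrable in
  advance; the lower estimate is therefore made for bounded, compactly supported cutoffs, uniformly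
  in the cutoff. If q is infinite, so are all exponents, and the norm is built from the sets
  \<open>dunkl_ball\<close> instead of translations; this case has its own proof.\<close>

locale dunkl =
  fixes \<kappa> :: real
  assumes kappa: "\<kappa> > - 1 / 2"
begin

abbreviation \<mu> :: "real measure" where "\<mu> \<equiv> dunkl_measure \<kappa>"

abbreviation E :: "complex \<Rightarrow> complex" where "E \<equiv> dunkl_kernel \<kappa>"

text \<open>The generalised factorial of Dunkl theory: the Dunkl operator sends x^n to
  \<open>dfact n / dfact (n - 1)\<close> times x^(n-1), so its exponential is the series of z^n /
  \<open>dfact n\<close>. The extra \<open>2 * \<kappa> + 1\<close> comes from the reflection part,
  which sees only odd powers.\<close>

primrec dfact :: "nat \<Rightarrow> real" where
  "dfact 0 = 1"
| "dfact (Suc n) = (real (Suc n) + (if even n then 2 * \<kappa> + 1 else 0)) * dfact n"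

text \<open>Each factor dominates that of \<open>fact\<close> because
  \<open>2 * \<kappa> + 1\<close> is positive; convergence of the kernel series thereby becomes a
  comparison with the exponential series.\<close>

lemma dfact_ge_fact: "fact n \<le> dfact n"
proof (induction n)
  case (Suc n)
  have "real (Suc n) * fact n \<le> (real (Suc n) + (if even n then 2 * \<kappa> + 1 else 0)) * dfact n"
    using Suc kappa by (intro mult_mono) auto
  then show ?case by simp
qed simp

lemma dfact_pos [simp]: "0 < dfact n"
  using dfact_ge_fact[of n] by (smt (verit) fact_gt_zero)

lemma dfact_nonzero [simp]: "dfact n \<noteq> 0"
  using dfact_pos[of n] by linarith

text \<open>The even values carry the coefficients of the Bessel function of order \<kappa>, the odd
  values those of order \<kappa> + 1; this is how the two series merge into one.\<close>

lemma dfact_even: "dfact (2 * n) = 4 ^ n * fact n * Gamma (n + \<kappa> + 1) / Gamma (\<kappa> + 1)"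
proof (induction n)
  case 0
  have "Gamma (\<kappa> + 1) > 0" using kappa by (intro Gamma_real_pos) auto
  then show ?case by simp
next
  case (Suc n)
  have "Gamma (real n + \<kappa> + 1 + 1) = (real n + \<kappa> + 1) * Gamma (real n + \<kappa> + 1)"
    using kappa by (intro Gamma_plus1) (auto elim!: nonpos_Ints_cases)
  then show ?case using Suc by (simp add: algebra_simps)
qed

lemma dfact_odd: "dfact (2 * n + 1) = 2 * 4 ^ n * fact n * Gamma (n + \<kappa> + 2) / Gamma (\<kappa> + 1)"
proof -
  have "Gamma (real n + \<kappa> + 1 + 1) = (real n + \<kappa> + 1) * Gamma (real n + \<kappa> + 1)"
    using kappa by (intro Gamma_plus1) (auto elim!: nonpos_Ints_cases)
  moreover have "dfact (2 * n + 1) = (2 * (real n + \<kappa> + 1)) * dfact (2 * n)"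
    by (simp add: algebra_simps)
  ultimately show ?thesis
    unfolding dfact_even by (simp add: add.assoc)
qed

lemma dkernel_summable: "summable (\<lambda>n. norm (z ^ n /\<^sub>R dfact n))" for z :: complex
proof (rule summable_comparison_test)
  show "\<exists>N. \<forall>n\<ge>N. norm (norm (z ^ n /\<^sub>R dfact n)) \<le> norm z ^ n /\<^sub>R fact n"
    using dfact_ge_fact less_imp_le[OF dfact_pos]
    by (intro exI[of _ 0]) (auto simp: norm_power abs_mult intro!: mult_right_mono le_imp_inverse_le)
  show "summable (\<lambda>n. norm z ^ n /\<^sub>R fact n)"
    by (rule summable_exp_generic)
qed

lemma sums_interleave:
  fixes f :: "nat \<Rightarrow> 'a :: banach"
  assumes "summable f"
  shows "suminf f = (\<Sum>n. f (2 * n) + f (2 * n + 1))"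
proof -
  have "(\<lambda>n. sum f {n * 2..<n * 2 + 2}) sums suminf f"
    using assms by (intro sums_group summable_sums) auto
  moreover have "sum f {n * 2..<n * 2 + 2} = f (2 * n) + f (2 * n + 1)" for n
    by (simp add: mult.commute)
  ultimately show ?thesis by (simp add: sums_iff)
qed

text \<open>The series is split by parity: its even half is the first Bessel term of the definition
  and its odd half the second.\<close>

lemma dkernel_sums: "(\<lambda>n. z ^ n /\<^sub>R dfact n) sums E z"
proof -
  let ?c = "\<lambda>n. z ^ n /\<^sub>R dfact n"
  have G: "Gamma (\<kappa> + 1) > 0" using kappa by (intro Gamma_real_pos) auto
  have G2: "Gamma (\<kappa> + 2) = (\<kappa> + 1) * Gamma (\<kappa> + 1)"
    using Gamma_plus1[of "\<kappa> + 1"] kappa nonpos_Ints_nonpos[of "\<kappa> + 1"]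
    by (force simp: add.assoc)
  have s: "summable ?c" by (rule summable_norm_cancel[OF dkernel_summable])
  have se: "summable (\<lambda>n. ?c (2 * n))"
    by (rule summable_norm_cancel, rule summable_reindex[OF dkernel_summable, of "\<lambda>n. 2 * n", unfolded o_def])
       (auto simp: inj_on_def)
  have so: "summable (\<lambda>n. ?c (2 * n + 1))"
    by (rule summable_norm_cancel, rule summable_reindex[OF dkernel_summable, of "\<lambda>n. 2 * n + 1", unfolded o_def])
       (auto simp: inj_on_def)
  \<comment> \<open>Here \<open>a\<close> stands for \<open>\<kappa> + 1\<close> and
    \<open>g\<close> for \<open>Gamma (\<kappa> + 1)\<close>; the prefactor
    \<open>Gamma (\<kappa> + 2)\<close> of the second Bessel function is their product.\<close>
  have cancel: "x = of_real (a * g) * (S * of_real (2 / g)) \<Longrightarrow> a \<noteq> 0 \<Longrightarrow> g \<noteq> 0 \<Longrightarrow> x / of_real (2 * a) = S"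
    for x S :: complex and a g :: real
    by (simp add: field_simps)
  have pw: "(- 1) ^ n * (\<i> * z) ^ (2 * n) = z ^ (2 * n)" for n
    by (simp add: power_mult power_mult_distrib[of \<i>] flip: power_mult_distrib)
  have e: "(- 1) ^ n * (\<i> * z) ^ (2 * n) / of_real (fact n * 2 ^ (2 * n) * Gamma (real n + \<kappa> + 1))
      = ?c (2 * n) / of_real (Gamma (\<kappa> + 1))" for n
    unfolding pw dfact_even using G by (simp add: scaleR_conv_of_real power_mult divide_simps)
  have o: "(- 1) ^ n * (\<i> * z) ^ (2 * n) / of_real (fact n * 2 ^ (2 * n) * Gamma (real n + (\<kappa> + 1) + 1)) * z
      = ?c (2 * n + 1) * of_real (2 / Gamma (\<kappa> + 1))" for n
    unfolding pw dfact_odd using G by (simp add: scaleR_conv_of_real power_mult divide_simps add.assoc)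
  have 1: "bessel_j \<kappa> (\<i> * z) = (\<Sum>n. ?c (2 * n))"
    unfolding bessel_j_def e using G by (subst suminf_divide[OF se]) simp
  have "bessel_j (\<kappa> + 1) (\<i> * z) * z = of_real (Gamma (\<kappa> + 2)) * ((\<Sum>n. ?c (2 * n + 1)) * of_real (2 / Gamma (\<kappa> + 1)))"
  proof (cases "z = 0")
    \<comment> \<open>Summability of the Bessel series itself is obtained from the odd half by
      dividing by \<open>z\<close>.\<close>
    case False
    have "summable (\<lambda>n. (- 1) ^ n * (\<i> * z) ^ (2 * n) / of_real (fact n * 2 ^ (2 * n) * Gamma (real n + (\<kappa> + 1) + 1)) * z)"
      unfolding o by (intro summable_mult2 so)
    from summable_mult2[OF this, of "inverse z"] have "summable (\<lambda>n. (- 1) ^ n * (\<i> * z) ^ (2 * n) / of_real (fact n * 2 ^ (2 * n) * Gamma (real n + (\<kappa> + 1) + 1)))"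
      unfolding mult.assoc[of _ z] right_inverse[OF False] by (simp only: mult_1_right)
    then show ?thesis
      unfolding bessel_j_def mult.assoc[of _ _ z]
      by (subst suminf_mult2, assumption, unfold o, subst suminf_mult2[OF so, symmetric])
         (simp only: add.assoc one_add_one)
  qed simp
  then have "bessel_j (\<kappa> + 1) (\<i> * z) * z / of_real (2 * (\<kappa> + 1)) = (\<Sum>n. ?c (2 * n + 1))"
    unfolding G2 by (rule cancel) (use G kappa in linarith)+
  then have 2: "z / of_real (2 * (\<kappa> + 1)) * bessel_j (\<kappa> + 1) (\<i> * z) = (\<Sum>n. ?c (2 * n + 1))"
    by (simp only: mult.commute times_divide_eq_right)
  have "E z = suminf ?c"
    unfolding dunkl_kernel_def 1 2 sums_interleave[OF s] using se so by (rule suminf_add)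
  then show ?thesis using s by (simp add: summable_sums)
qed

lemma dkernel_0 [simp]: "E 0 = 1"
  using dkernel_sums[of 0] sums_unique2[OF _ powser_sums_zero[of "\<lambda>n. of_real (inverse (dfact n))"]]
  by (fastforce simp: scaleR_conv_of_real)

lemma continuous_dkernel: "continuous_on A E"
proof -
  have "isCont (\<lambda>z. \<Sum>n. of_real (inverse (dfact n)) * z ^ n) z" for z :: complex
  proof (rule isCont_powser)
    show "summable (\<lambda>n. of_real (inverse (dfact n)) * (of_real (norm z + 1) :: complex) ^ n)"
      using summable_norm_cancel[OF dkernel_summable[of "of_real (norm z + 1)"]]
      by (simp add: scaleR_conv_of_real)
    show "norm z < norm (complex_of_real (norm z + 1))" by (simp del: of_real_add)
  qed
  moreover have "(\<lambda>z. \<Sum>n. of_real (inverse (dfact n)) * z ^ n) = E"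
    using dkernel_sums by (auto simp: fun_eq_iff sums_iff scaleR_conv_of_real)
  ultimately show ?thesis by (simp add: continuous_at_imp_continuous_on)
qed

lemma measurable_dkernel [measurable]: "E \<in> borel_measurable borel"
  by (intro borel_measurable_continuous_onI continuous_dkernel)

end

section \<open>The integral representation of the kernel\<close>

context dunkl begin

section \<open>The Gegenbauer weight and its moments\<close>

definition jweight :: "real \<Rightarrow> real" where
  "jweight t = indicator {-1<..<1} t * (1 - t\<^sup>2) powr (\<kappa> - 1 / 2)"

lemma measurable_jweight [measurable]: "jweight \<in> borel_measurable borel"
  unfolding jweight_def by measurable

lemma jweight_nonneg [simp]: "0 \<le> jweight t"
  by (simp add: jweight_def)

text \<open>Under t = 2 u - 1 one has 1 - t^2 = 4 u (1 - u), so the weight becomes a Beta integrand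
  with both parameters \<open>\<kappa> + 1 / 2\<close>, which is positive.\<close>

lemma integrable_jweight: "integrable lborel jweight"
proof -
  have "set_integrable lborel {0..1} (\<lambda>t. t powr (\<kappa> + 1 / 2 - 1) * (1 - t) powr (\<kappa> + 1 / 2 - 1))"
    using kappa by (intro integrable_Beta) auto
  then have "integrable lborel (\<lambda>t. indicator {0..1} t * (t powr (\<kappa> - 1 / 2) * (1 - t) powr (\<kappa> - 1 / 2)))"
    by (simp add: set_integrable_def)
  from lborel_integrable_real_affine[OF this, of "1 / 2" "1 / 2"]
  have *: "integrable lborel (\<lambda>t. 4 powr (\<kappa> - 1 / 2) * (indicator {0..1} (1 / 2 + 1 / 2 * t) *
     ((1 / 2 + 1 / 2 * t) powr (\<kappa> - 1 / 2) * (1 - (1 / 2 + 1 / 2 * t)) powr (\<kappa> - 1 / 2))))"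
    by (intro integrable_mult_right) simp
  show ?thesis
  proof (rule Bochner_Integration.integrable_bound[OF *], simp, intro AE_I2)
    fix t :: real
    have "(1 - t\<^sup>2) powr (\<kappa> - 1 / 2) =
      4 powr (\<kappa> - 1 / 2) * ((1 / 2 + 1 / 2 * t) powr (\<kappa> - 1 / 2) * (1 - (1 / 2 + 1 / 2 * t)) powr (\<kappa> - 1 / 2))"
      if "-1 < t" "t < 1"
    proof -
      have "1 - t\<^sup>2 = 4 * ((1 / 2 + 1 / 2 * t) * (1 - (1 / 2 + 1 / 2 * t)))"
        by (simp add: field_simps power2_eq_square)
      then show ?thesis using that by (simp add: powr_mult)
    qed
    then show "norm (jweight t) \<le> norm (4 powr (\<kappa> - 1 / 2) * (indicator {0..1} (1 / 2 + 1 / 2 * t) *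
     ((1 / 2 + 1 / 2 * t) powr (\<kappa> - 1 / 2) * (1 - (1 / 2 + 1 / 2 * t)) powr (\<kappa> - 1 / 2))))"
      by (auto simp: jweight_def split: split_indicator)
  qed
qed

lemma integrable_jweight_mult:
  fixes f :: "real \<Rightarrow> 'b :: {banach, second_countable_topology}"
  assumes [measurable]: "f \<in> borel_measurable borel" and "\<And>t. -1 < t \<Longrightarrow> t < 1 \<Longrightarrow> norm (f t) \<le> B"
  shows "integrable lborel (\<lambda>t. jweight t *\<^sub>R f t)"
proof (rule Bochner_Integration.integrable_bound[OF integrable_mult_left[OF integrable_jweight, of B]])
  show "AE t in lborel. norm (jweight t *\<^sub>R f t) \<le> norm (jweight t * B)"
  proof (intro AE_I2)
    fix t
    show "norm (jweight t *\<^sub>R f t) \<le> norm (jweight t * B)"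
      using assms(2)[of t] by (auto simp: jweight_def abs_mult split: split_indicator
         intro!: mult_left_mono order_trans[OF assms(2) abs_ge_self])
  qed
qed simp

definition jmoment :: "nat \<Rightarrow> real" where
  "jmoment n = (LINT t|lborel. jweight t * t ^ n)"

lemma integrable_jmoment: "integrable lborel (\<lambda>t. jweight t * t ^ n)"
proof -
  have "norm (t ^ n) \<le> 1" if "-1 < t" "t < 1" for t :: real
    using that by (simp add: power_abs abs_le_iff power_le_one)
  from integrable_jweight_mult[OF _ this] show ?thesis by simp
qed

text \<open>Obtained by integrating the derivative of \<open>F\<close>, which vanishes at both end
  points because \<open>\<kappa> + 1 / 2\<close> is positive. The instance \<open>n = 0\<close> says
  that the first moment is zero.\<close>

lemma jmoment_recursion:
  "real n * (jmoment (n - 1) - jmoment (n + 1)) = (2 * \<kappa> + 1) * jmoment (n + 1)"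
proof -
  define F where "F t = t ^ n * (1 - t\<^sup>2) powr (\<kappa> + 1 / 2)" for t :: real
  define F' where "F' t = (real n * (t ^ (n - 1) - t ^ (n + 1)) - (2 * \<kappa> + 1) * t ^ (n + 1)) * (1 - t\<^sup>2) powr (\<kappa> - 1 / 2)" for t :: real
  have "(F' has_integral (F 1 - F (- 1))) {-1..1}"
  \<comment> \<open>Differentiability is asked for in the interior only: \<open>F'\<close> is
    unbounded at the end points when \<open>\<kappa> < 1 / 2\<close>.\<close>
  proof (rule fundamental_theorem_of_calculus_interior)
    show "continuous_on {- 1..1} F"
    proof -
      have nn: "0 \<le> 1 - x\<^sup>2" if "x \<in> {- 1..1}" for x :: real
      proof -
        have "\<bar>x\<bar> \<le> 1" using that by auto
        then show ?thesis using abs_square_le_1[of x] by linarith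
      qed
      have "continuous_on {- 1..1} (\<lambda>t::real. (1 - t\<^sup>2) powr (\<kappa> + 1 / 2))"
      proof (rule continuous_on_powr')
        show "\<forall>t\<in>{- 1..1::real}. 0 \<le> 1 - t\<^sup>2 \<and> (1 - t\<^sup>2 = 0 \<longrightarrow> \<kappa> + 1 / 2 > 0)"
          using kappa by (intro ballI conjI impI nn) linarith+
        show "continuous_on {- 1..1} (\<lambda>t::real. 1 - t\<^sup>2)" by (intro continuous_intros)
      qed (rule continuous_on_const)
      from continuous_on_mult[OF continuous_on_power[OF continuous_on_id] this, of n] show ?thesis unfolding F_def .
    qed
    fix t :: real assume t: "t \<in> {-1<..<1}"
    then have "\<bar>t\<bar> < 1" by auto
    then have pos: "0 < 1 - t\<^sup>2" using abs_square_less_1[of t] by linarith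
    have eq: "(1 - t\<^sup>2) powr (\<kappa> + 1 / 2) = (1 - t\<^sup>2) * (1 - t\<^sup>2) powr (\<kappa> - 1 / 2)"
      using pos powr_add[of "1 - t\<^sup>2" 1 "\<kappa> - 1 / 2"] by (simp add: add.commute)
    have "(F has_real_derivative (real n * t ^ (n - 1) * (1 - t\<^sup>2) powr (\<kappa> + 1 / 2)
        + t ^ n * ((\<kappa> + 1 / 2) * (1 - t\<^sup>2) powr (\<kappa> + 1 / 2 - 1) * (- 2 * t)))) (at t)"
      unfolding F_def using pos by (auto intro!: derivative_eq_intros)
    also have "real n * t ^ (n - 1) * (1 - t\<^sup>2) powr (\<kappa> + 1 / 2)
        + t ^ n * ((\<kappa> + 1 / 2) * (1 - t\<^sup>2) powr (\<kappa> + 1 / 2 - 1) * (- 2 * t)) = F' t"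
    proof -
      have "real n * t ^ (n - 1) * ((1 - t\<^sup>2) * P) + t ^ n * ((\<kappa> + 1 / 2) * P * (- 2 * t)) =
        (real n * (t ^ (n - 1) - t ^ (n + 1)) - (2 * \<kappa> + 1) * t ^ (n + 1)) * P" for P
        by (cases n) (simp_all add: algebra_simps power2_eq_square)
      moreover have "\<kappa> + 1 / 2 - 1 = \<kappa> - 1 / 2" by simp
      ultimately show ?thesis unfolding F'_def eq by metis
    qed
    finally show "(F has_vector_derivative F' t) (at t)"
      by (simp add: has_real_derivative_iff_has_vector_derivative)
  qed simp
  then have "(F' has_integral 0) {-1<..<1}"
    by (simp add: F_def has_integral_Icc_iff_Ioo)
  then have "((\<lambda>t. if t \<in> {-1<..<1} then F' t else 0) has_integral 0) UNIV"
    by (simp only: has_integral_restrict_UNIV)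
  moreover have "(\<lambda>t. if t \<in> {-1<..<1} then F' t else 0) =
    (\<lambda>t. real n * (jweight t * t ^ (n - 1) - jweight t * t ^ (n + 1)) - (2 * \<kappa> + 1) * (jweight t * t ^ (n + 1)))"
    by (auto simp: F'_def jweight_def fun_eq_iff algebra_simps)
  moreover have i: "integrable lborel (\<lambda>t. real n * (jweight t * t ^ (n - 1) - jweight t * t ^ (n + 1)) - (2 * \<kappa> + 1) * (jweight t * t ^ (n + 1)))"
    by (intro integrable_mult_right Bochner_Integration.integrable_diff integrable_jmoment)
  ultimately have "(LINT t|lborel. real n * (jweight t * t ^ (n - 1) - jweight t * t ^ (n + 1)) - (2 * \<kappa> + 1) * (jweight t * t ^ (n + 1))) = 0"
    using has_integral_unique[OF has_integral_integral_lborel[OF i]] by metis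
  then show ?thesis
    by (simp add: jmoment_def integrable_jmoment del: power_Suc)
qed

text \<open>The recursion ties each odd moment to the one two below it, with a positive coefficient
  on the higher one; the descent ends at its instance \<open>n = 0\<close>.\<close>

lemma jmoment_odd: "odd n \<Longrightarrow> jmoment n = 0"
proof (induction n rule: less_induct)
  case (less n)
  then obtain m where n: "n = m + 1" and "even m" by (auto elim!: oddE)
  then have "m = 0 \<or> jmoment (m - 1) = 0" using less by (auto intro!: less.IH)
  with jmoment_recursion[of m] have "(2 * \<kappa> + 1 + real m) * jmoment n = 0"
    by (auto simp: n algebra_simps split: if_splits)
  then show ?case using kappa by (auto simp: add_eq_0_iff)
qed

lemma jmoment_0_pos: "jmoment 0 > 0"
proof (rule ccontr)
  assume "\<not> jmoment 0 > 0"
  moreover have "jmoment 0 \<ge> 0" unfolding jmoment_def by (intro integral_nonneg_AE) auto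
  ultimately have "jmoment 0 = 0" by linarith
  then have "(LINT t|lborel. jweight t) = 0" by (simp add: jmoment_def)
  then have "AE t in lborel. jweight t = 0"
    using integrable_jweight by (subst (asm) integral_nonneg_eq_0_iff_AE) auto
  then have "AE t in lborel. t \<notin> {-1<..<1::real}"
    by eventually_elim (auto simp: jweight_def abs_square_eq_1)
  then have "emeasure lborel {-1<..<1::real} = 0"
    by (subst (asm) AE_iff_measurable[of "{-1<..<1}"]) auto
  then show False by simp
qed

section \<open>The representing probability measure\<close>

definition dbeta :: "real measure" where
  "dbeta = density lborel (\<lambda>t. ennreal (jweight t * (1 + t) / jmoment 0))"

lemma sets_dbeta [simp, measurable_cong]: "sets dbeta = sets borel"
  by (simp add: dbeta_def)

lemma space_dbeta [simp]: "space dbeta = UNIV"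
  by (simp add: dbeta_def)

lemma jweight_density_nonneg: "0 \<le> jweight t * (1 + t) / jmoment 0"
  using jmoment_0_pos by (auto simp: jweight_def split: split_indicator)

lemma integral_dbeta:
  fixes f :: "real \<Rightarrow> 'b :: {banach, second_countable_topology}"
  assumes [measurable]: "f \<in> borel_measurable borel"
  shows "(LINT t|dbeta. f t) = (LINT t|lborel. (jweight t * (1 + t) / jmoment 0) *\<^sub>R f t)"
  unfolding dbeta_def using jweight_density_nonneg by (intro integral_density) auto

text \<open>The factor 1 + t couples neighbouring moments of the weight, one of which vanishes by
  parity. From odd \<open>n\<close> to \<open>n + 1\<close> the moment does not change, from even
  \<open>n\<close> it gains the factor (n + 1) / (n + 2 \<kappa> + 2); these are the successive
  quotients of \<open>fact n / dfact n\<close>.\<close>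

lemma dbeta_moment: "(LINT t|dbeta. t ^ n) = fact n / dfact n"
proof -
  have 1: "(LINT t|dbeta. t ^ n) = (jmoment n + jmoment (Suc n)) / jmoment 0" for n
  proof -
    have "(LINT t|dbeta. t ^ n) = (LINT t|lborel. (jweight t * t ^ n + jweight t * t ^ Suc n) / jmoment 0)"
      by (subst integral_dbeta) (auto simp: algebra_simps add_divide_distrib intro!: Bochner_Integration.integral_cong)
    also have "\<dots> = (jmoment n + jmoment (Suc n)) / jmoment 0"
      unfolding jmoment_def by (simp add: integrable_jmoment del: power_Suc)
    finally show ?thesis .
  qed
  have "(jmoment n + jmoment (Suc n)) / jmoment 0 = fact n / dfact n"
  proof (induction n)
    case 0
    then show ?case using jmoment_0_pos by (simp add: jmoment_odd)
  next
    case (Suc n)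
    show ?case
    proof (cases "even n")
      case True
      have "(2 * \<kappa> + 1 + Suc n) * jmoment (Suc (Suc n)) = Suc n * jmoment n"
        using jmoment_recursion[of "Suc n"] by (simp add: algebra_simps)
      then have "jmoment (Suc (Suc n)) = Suc n / (2 * \<kappa> + 1 + Suc n) * jmoment n"
        using kappa by (simp add: field_simps)
      then have "(jmoment (Suc n) + jmoment (Suc (Suc n))) / jmoment 0 = Suc n / (2 * \<kappa> + 1 + Suc n) * ((jmoment n + jmoment (Suc n)) / jmoment 0)"
        using True by (simp add: jmoment_odd)
      also have "\<dots> = fact (Suc n) / dfact (Suc n)"
        unfolding Suc using True by (simp add: add.commute)
      finally show ?thesis .
    next
      case False
      then have "fact (Suc n) / dfact (Suc n) = fact n / dfact n" by (simp add: divide_simps)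
      then show ?thesis using False Suc by (simp add: jmoment_odd)
    qed
  qed
  then show ?thesis unfolding 1 .
qed

sublocale dbeta: prob_space dbeta
proof
  have "integrable lborel (\<lambda>t. jweight t * (1 + t) / jmoment 0)"
    using integrable_jweight_mult[of "\<lambda>t. 1 + t" 2] by auto
  then have "emeasure dbeta UNIV = ennreal (LINT t|lborel. jweight t * (1 + t) / jmoment 0)"
    using jweight_density_nonneg unfolding dbeta_def
    by (subst emeasure_density) (simp, simp, simp only: indicator_UNIV mult_1_right, intro nn_integral_eq_integral AE_I2)
  also have "(LINT t|lborel. jweight t * (1 + t) / jmoment 0) = (LINT t|dbeta. t ^ 0)"
    by (subst integral_dbeta) auto
  finally show "emeasure dbeta (space dbeta) = 1"
    unfolding dbeta_moment by simp
qed

lemma prob_dbeta_UNIV [simp]: "measure dbeta UNIV = 1"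
  using dbeta.prob_space by simp

lemma AE_dbeta: "AE t in dbeta. \<bar>t\<bar> < 1"
  unfolding dbeta_def by (subst AE_density) (auto simp: jweight_def split: split_indicator)

lemma integrable_dbeta:
  fixes f :: "real \<Rightarrow> 'b :: {banach, second_countable_topology}"
  assumes "f \<in> borel_measurable borel" and "\<And>t. \<bar>t\<bar> < 1 \<Longrightarrow> norm (f t) \<le> B"
  shows "integrable dbeta f"
  using assms AE_dbeta by (intro dbeta.integrable_const_bound[of _ B]) auto

text \<open>When the exponential is expanded, each moment replaces a \<open>fact n\<close> by
  \<open>dfact n\<close>. The norm bounds below and the positivity of \<open>Er\<close> rest on this
  representation.\<close>

lemma dkernel_integral: "E z = (LINT t|dbeta. exp (z * of_real t))"
proof -
  have ex: "exp (z * complex_of_real t) = (\<Sum>n. (z * of_real t) ^ n /\<^sub>R fact n)" for t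
    by (simp add: exp_def)
  have i: "integrable dbeta (\<lambda>t. (z * of_real t) ^ n /\<^sub>R fact n)" for n
    by (rule integrable_dbeta[where B = "norm z ^ n / fact n"])
       (auto simp: norm_mult norm_power power_mult_distrib divide_inverse mult.commute[of "inverse _"] power_abs
         intro!: mult_right_mono mult_left_le power_le_one)
  have mom: "(LINT t|dbeta. (z * of_real t) ^ n /\<^sub>R fact n) = z ^ n /\<^sub>R dfact n" for n
  proof -
    have "(LINT t|dbeta. (z * of_real t) ^ n /\<^sub>R fact n) = (LINT t|dbeta. (z ^ n /\<^sub>R fact n) * complex_of_real (t ^ n))"
      by (simp add: power_mult_distrib)
    also have "\<dots> = (z ^ n /\<^sub>R fact n) * complex_of_real (fact n / dfact n)"
      by (subst integral_mult_right_zero) (simp only: integral_complex_of_real dbeta_moment)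
    finally show ?thesis by (simp add: scaleR_conv_of_real field_simps)
  qed
  have "(LINT t|dbeta. (\<Sum>n. (z * of_real t) ^ n /\<^sub>R fact n)) = (\<Sum>n. (LINT t|dbeta. (z * of_real t) ^ n /\<^sub>R fact n))"
  proof (rule integral_suminf[OF i])
    show "AE t in dbeta. summable (\<lambda>n. norm ((z * complex_of_real t) ^ n /\<^sub>R fact n))"
      by (intro AE_I2 summable_norm_exp)
    show "summable (\<lambda>n. LINT t|dbeta. norm ((z * complex_of_real t) ^ n /\<^sub>R fact n))"
    proof (rule summable_comparison_test[OF _ summable_norm_exp[of z]], intro exI[of _ 0] allI impI)
      fix n
      have "(LINT t|dbeta. norm ((z * complex_of_real t) ^ n /\<^sub>R fact n)) \<le> (LINT t|dbeta. norm (z ^ n /\<^sub>R fact n))"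
        using AE_dbeta
        by (intro integral_mono_AE integrable_norm i)
           (auto elim!: eventually_mono simp: norm_mult norm_power power_mult_distrib intro!: mult_left_le power_le_one)
      then show "norm (LINT t|dbeta. norm ((z * complex_of_real t) ^ n /\<^sub>R fact n)) \<le> norm (z ^ n /\<^sub>R fact n)"
        by (simp add: integral_nonneg_AE dbeta.prob_space)
    qed
  qed
  also have "\<dots> = (\<Sum>n. z ^ n /\<^sub>R dfact n)" by (simp only: mom)
  also have "(\<Sum>n. z ^ n /\<^sub>R dfact n) = E z"
    using dkernel_sums by (simp add: sums_iff)
  finally show ?thesis unfolding ex by (rule sym)
qed

lemma norm_dkernel_imag: "Re z = 0 \<Longrightarrow> norm (E z) \<le> 1"
proof -
  assume "Re z = 0"
  then have "(LINT t|dbeta. norm (exp (z * complex_of_real t))) \<le> 1"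
    by (simp add: norm_exp_eq_Re)
  then show ?thesis
    unfolding dkernel_integral by (rule order_trans[OF integral_norm_bound])
qed

definition Er :: "real \<Rightarrow> real" where "Er x = (LINT t|dbeta. exp (x * t))"

lemma Er_dkernel: "E (of_real x) = of_real (Er x)"
  unfolding dkernel_integral Er_def
  by (simp flip: exp_of_real integral_complex_of_real)

lemma Er_nonneg [simp]: "0 \<le> Er x"
  unfolding Er_def by (intro integral_nonneg_AE) auto

lemma measurable_Er [measurable]: "Er \<in> borel_measurable borel"
proof -
  have "Er = (\<lambda>x. Re (E (of_real x)))" by (simp add: Er_dkernel)
  then show ?thesis by simp
qed

lemma norm_dkernel_le: "norm (E z) \<le> exp (norm z)"
  unfolding dkernel_integral
proof (rule order_trans[OF integral_norm_bound])
  have b: "norm (exp (z * complex_of_real t)) \<le> exp (norm z)" if "\<bar>t\<bar> < 1" for t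
  proof -
    have "norm (z * complex_of_real t) \<le> norm z"
      using that by (simp add: norm_mult mult_left_le)
    then show ?thesis by (meson exp_le_cancel_iff norm_exp order_trans)
  qed
  have "(LINT t|dbeta. norm (exp (z * of_real t))) \<le> (LINT t|dbeta. exp (norm z))"
  proof (rule integral_mono_AE)
    show "integrable dbeta (\<lambda>t. norm (exp (z * complex_of_real t)))"
      using b by (intro integrable_dbeta[where B = "exp (norm z)"]) auto
    show "AE t in dbeta. norm (exp (z * of_real t)) \<le> exp (norm z)"
      using AE_dbeta by eventually_elim (rule b)
  qed simp
  then show "(LINT t|dbeta. norm (exp (z * of_real t))) \<le> exp (norm z)"
    by (simp add: dbeta.prob_space)
qed

lemma dkernel_cnj: "E (cnj z) = cnj (E z)"
proof -
  have "exp (cnj z * complex_of_real t) = cnj (exp (z * of_real t))" for t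
    by (simp add: exp_cnj)
  then show ?thesis unfolding dkernel_integral by simp
qed

end

section \<open>The measure and its Gaussian moments\<close>

context dunkl begin

section \<open>Density, reflection and scaling\<close>

definition dens :: "real \<Rightarrow> real" where
  "dens x = \<bar>x\<bar> powr (2 * \<kappa> + 1) / (2 powr (\<kappa> + 1) * Gamma (\<kappa> + 1))"

lemma Gamma_kappa_pos [simp]: "0 < Gamma (\<kappa> + 1)"
  using kappa by (intro Gamma_real_pos) auto

lemma dens_nonneg [simp]: "0 \<le> dens x"
  using less_imp_le[OF Gamma_kappa_pos] by (simp add: dens_def)

lemma dens_pos: "x \<noteq> 0 \<Longrightarrow> 0 < dens x"
  by (simp add: dens_def)

lemma dens_minus [simp]: "dens (- x) = dens x"
  by (simp add: dens_def)

lemma measurable_dens [measurable]: "dens \<in> borel_measurable borel"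
  unfolding dens_def by measurable

lemma mu_dens: "\<mu> = density lborel (\<lambda>x. ennreal (dens x))"
  by (simp add: dunkl_measure_def dens_def)

lemma sets_mu [simp, measurable_cong]: "sets \<mu> = sets borel"
  by (simp add: mu_dens)

lemma space_mu [simp]: "space \<mu> = UNIV"
  by (simp add: mu_dens)

lemma borel_measurable_mu [simp]: "borel_measurable \<mu> = borel_measurable borel"
  by (rule measurable_cong_sets) simp_all

sublocale mu: sigma_finite_measure \<mu>
  unfolding mu_dens by (subst sigma_finite_measure.sigma_finite_iff_density_finite[OF sigma_finite_lborel]) auto

sublocale mu2: pair_sigma_finite \<mu> \<mu> ..

lemma nn_integral_mu:
  "f \<in> borel_measurable borel \<Longrightarrow> (\<integral>\<^sup>+x. f x \<partial>\<mu>) = (\<integral>\<^sup>+x. ennreal (dens x) * f x \<partial>lborel)"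
  unfolding mu_dens by (rule nn_integral_density) auto

text \<open>The density is positive off the origin, which is a Lebesgue null set.\<close>

lemma AE_mu_iff: "Measurable.pred borel P \<Longrightarrow> (AE x in \<mu>. P x) \<longleftrightarrow> (AE x in lborel. P x)"
proof -
  assume [measurable]: "Measurable.pred borel P"
  have "(AE x in \<mu>. P x) \<longleftrightarrow> (AE x in lborel. 0 < ennreal (dens x) \<longrightarrow> P x)"
    unfolding mu_dens by (intro AE_density) simp
  also have "\<dots> \<longleftrightarrow> (AE x in lborel. P x)"
  proof (rule eventually_cong)
    show "AE x in lborel. x \<noteq> (0::real)" by (rule AE_lborel_singleton)
  qed (use dens_pos in auto)
  finally show ?thesis .
qed

lemma AE_mu_nonzero: "AE x in \<mu>. x \<noteq> 0"
  by (subst AE_mu_iff) (auto intro: AE_lborel_singleton)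

lemma nn_integral_mu_minus:
  assumes [measurable]: "f \<in> borel_measurable borel"
  shows "(\<integral>\<^sup>+x. f (- x) \<partial>\<mu>) = (\<integral>\<^sup>+x. f x \<partial>\<mu>)"
proof -
  have "(\<integral>\<^sup>+x. f x \<partial>\<mu>) = (\<integral>\<^sup>+x. ennreal (dens x) * f x \<partial>lborel)"
    by (rule nn_integral_mu) simp
  also have "\<dots> = (\<integral>\<^sup>+x. ennreal (dens x) * f (- x) \<partial>lborel)"
    by (subst nn_integral_real_affine[where c = "-1" and t = 0]) auto
  also have "\<dots> = (\<integral>\<^sup>+x. f (- x) \<partial>\<mu>)"
    by (rule nn_integral_mu[symmetric]) simp
  finally show ?thesis by simp
qed

text \<open>The density is homogeneous of degree \<open>2 * \<kappa> + 1\<close> and the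
  substitution contributes one more factor \<open>c\<close>. With \<open>c = 1 / 2\<close> this
  becomes the doubling constant \<open>V_half\<close>.\<close>

lemma emeasure_mu_ball_scale:
  assumes "c > 0"
  shows "emeasure \<mu> {- (c * r)<..<c * r} = ennreal (c powr (2 * \<kappa> + 2)) * emeasure \<mu> {- r<..<r}"
proof -
  have em: "emeasure \<mu> {- s<..<s} = (\<integral>\<^sup>+x. ennreal (dens x) * indicator {- s<..<s} x \<partial>lborel)" for s
    by (subst nn_integral_mu[symmetric]) (auto simp: mu_dens[symmetric])
  have "(\<integral>\<^sup>+x. ennreal (dens x) * indicator {- (c * r)<..<c * r} x \<partial>lborel)
      = ennreal c * (\<integral>\<^sup>+x. ennreal (dens (c * x)) * indicator {- (c * r)<..<c * r} (c * x) \<partial>lborel)"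
    using assms by (subst nn_integral_real_affine[where c = c and t = 0]) auto
  also have "(\<lambda>x. ennreal (dens (c * x)) * indicator {- (c * r)<..<c * r} (c * x)) =
      (\<lambda>x. ennreal (c powr (2 * \<kappa> + 1)) * (ennreal (dens x) * indicator {- r<..<r} x))"
  proof
    fix x
    have "dens (c * x) = c powr (2 * \<kappa> + 1) * dens x"
      using assms by (simp add: dens_def abs_mult powr_mult)
    moreover have "c * x \<in> {- (c * r)<..<c * r} \<longleftrightarrow> x \<in> {- r<..<r}"
      using assms mult_less_cancel_left_pos[of c "- r" x] by auto
    ultimately show "ennreal (dens (c * x)) * indicator {- (c * r)<..<c * r} (c * x) =
       ennreal (c powr (2 * \<kappa> + 1)) * (ennreal (dens x) * indicator {- r<..<r} x)"
      by (simp add: indicator_def ennreal_mult mult.assoc)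
  qed
  also have "ennreal c * (\<integral>\<^sup>+x. ennreal (c powr (2 * \<kappa> + 1)) * (ennreal (dens x) * indicator {- r<..<r} x) \<partial>lborel)
      = ennreal (c * c powr (2 * \<kappa> + 1)) * emeasure \<mu> {- r<..<r}"
    unfolding em using assms by (subst nn_integral_cmult) (auto simp: ennreal_mult mult.assoc)
  also have "c * c powr (2 * \<kappa> + 1) = c powr (2 * \<kappa> + 2)"
    using assms powr_add[of c 1 "2 * \<kappa> + 1"] by (simp add: add.commute add.left_commute)
  finally show ?thesis unfolding em .
qed

lemma emeasure_mu_bounded: "emeasure \<mu> {a..b} < \<infinity>"
proof -
  define M where "M = max \<bar>a\<bar> \<bar>b\<bar> powr (2 * \<kappa> + 1) / (2 powr (\<kappa> + 1) * Gamma (\<kappa> + 1))"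
  have "dens x \<le> M" if "x \<in> {a..b}" for x
    using that kappa unfolding dens_def M_def
    by (intro divide_right_mono powr_mono2) auto
  then have "(\<integral>\<^sup>+x. ennreal (dens x) * indicator {a..b} x \<partial>lborel) \<le> (\<integral>\<^sup>+x. ennreal M * indicator {a..b} x \<partial>lborel)"
    by (intro nn_integral_mono) (auto simp: indicator_def intro!: ennreal_leI)
  also have "\<dots> < \<infinity>"
    by (subst nn_integral_cmult) (auto simp: ennreal_mult_less_top emeasure_lborel_Icc_eq)
  finally show ?thesis
    by (subst (asm) nn_integral_mu[symmetric]) (auto simp: mu_dens[symmetric])
qed

lemma emeasure_mu_pos:
  assumes "a < b"
  shows "0 < emeasure \<mu> {a<..<b}"
proof (rule ccontr)
  assume "\<not> ?thesis"
  then have "{a<..<b} \<in> null_sets \<mu>" by (auto intro: null_setsI)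
  then have "AE x in \<mu>. x \<notin> {a<..<b}" by (rule AE_not_in)
  then have "AE x in lborel. x \<notin> {a<..<b}" by (subst (asm) AE_mu_iff) auto
  then have "emeasure lborel {a<..<b} = 0"
    by (subst (asm) AE_iff_measurable[of "{a<..<b}"]) auto
  then show False using assms by simp
qed

section \<open>Gaussian moments\<close>

definition gauss :: "real \<Rightarrow> real \<Rightarrow> real" where
  "gauss s x = exp (- (x\<^sup>2 / (2 * s)))"

lemma measurable_gauss [measurable]: "gauss s \<in> borel_measurable borel"
  unfolding gauss_def by measurable

lemma gauss_pos [simp]: "0 < gauss s x" and gauss_nonneg [simp]: "0 \<le> gauss s x"
  by (simp_all add: gauss_def)

lemma has_bochner_integral_mu:
  fixes f :: "real \<Rightarrow> real"
  shows "f \<in> borel_measurable borel \<Longrightarrow> has_bochner_integral \<mu> f v \<longleftrightarrow> has_bochner_integral lborel (\<lambda>x. dens x * f x) v"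
  unfolding has_bochner_integral_iff mu_dens
  by (auto simp: integrable_real_density integral_real_density)

text \<open>The substitution u = x^2 / (2 s) turns half of the integral into
  \<open>Gamma (n + \<kappa> + 1)\<close>; evenness doubles it, and \<open>dfact_even\<close>
  absorbs the quotient of Gamma values.\<close>

lemma gauss_moment_even:
  assumes s: "s > 0"
  shows "has_bochner_integral \<mu> (\<lambda>x. x ^ (2 * n) * gauss s x) (s powr (\<kappa> + 1) * s ^ n * dfact (2 * n) / (2 ^ n * fact n))"
proof -
  define a where "a = real n + \<kappa> + 1"
  have a: "a > 0" using kappa by (simp add: a_def)
  define c where "c = 1 / (2 * s)"
  have c: "c > 0" using s by (simp add: c_def)
  define f where "f t = t powr (a - 1) / exp t" for t :: real
  have "f absolutely_integrable_on {0..}"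
    using Gamma_integral_real[OF a] unfolding f_def
    by (intro nonnegative_absolutely_integrable_1) auto
  then have "f absolutely_integrable_on {0<..}"
    by (rule set_integrable_subset) auto
  moreover have "integral {0<..} f = Gamma a"
  proof -
    have "integral {0<..} f = integral {0..} f"
      by (rule integral_spike_set) (rule negligible_subset[of "{0}"], auto)+
    also have "\<dots> = Gamma a"
      using integral_unique[OF Gamma_integral_real[OF a]] unfolding f_def .
    finally show ?thesis .
  qed
  moreover have "(\<lambda>x. c * x\<^sup>2) ` {0<..} = {0<..}"
  proof (safe, goal_cases)
    case (2 y)
    then show ?case using c by (intro image_eqI[of _ _ "sqrt (y / c)"]) auto
  qed (use c in auto)
  moreover have "inj_on (\<lambda>x. c * x\<^sup>2) {0<..}"
    using c by (auto simp: inj_on_def power2_eq_iff)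
  ultimately have *: "(\<lambda>x. \<bar>2 * c * x\<bar> * f (c * x\<^sup>2)) absolutely_integrable_on {0<..} \<and>
      integral {0<..} (\<lambda>x. \<bar>2 * c * x\<bar> * f (c * x\<^sup>2)) = Gamma a"
    by (subst has_absolute_integral_change_of_variables_1'[where g = "\<lambda>x. c * x\<^sup>2"])
       (auto intro!: derivative_eq_intros)
  have meas: "(\<lambda>x. indicator {0<..} x *\<^sub>R (\<bar>2 * c * x\<bar> * f (c * x\<^sup>2))) \<in> borel_measurable lborel"
    unfolding f_def by measurable
  from * have "integrable lborel (\<lambda>x. indicator {0<..} x *\<^sub>R (\<bar>2 * c * x\<bar> * f (c * x\<^sup>2)))"
    using meas unfolding set_integrable_def by (subst (asm) integrable_completion) auto
  moreover have "(LINT x|lborel. indicator {0<..} x *\<^sub>R (\<bar>2 * c * x\<bar> * f (c * x\<^sup>2))) = Gamma a"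
    using * integral_completion[OF meas]
      set_lebesgue_integral_eq_integral(2)[of "{0<..}" "\<lambda>x. \<bar>2 * c * x\<bar> * f (c * x\<^sup>2)"]
    unfolding set_lebesgue_integral_def by simp
  ultimately have "has_bochner_integral lborel (\<lambda>x. indicator {0<..} x *\<^sub>R (\<bar>2 * c * x\<bar> * f (c * x\<^sup>2))) (Gamma a)"
    by (simp add: has_bochner_integral_iff)
  \<comment> \<open>Dividing by \<open>2 * c powr a\<close> cancels the Jacobian together with the
    powers of \<open>c\<close>; the remaining constants are the normalisation of
    \<open>dens\<close>.\<close>
  then have 1: "has_bochner_integral lborel (\<lambda>x. (indicator {0<..} x *\<^sub>R (\<bar>2 * c * x\<bar> * f (c * x\<^sup>2))) * (1 / (2 * c powr a * 2 powr (\<kappa> + 1) * Gamma (\<kappa> + 1))))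
      (Gamma a * (1 / (2 * c powr a * 2 powr (\<kappa> + 1) * Gamma (\<kappa> + 1))))"
    by (rule has_bochner_integral_mult_left)
  \<comment> \<open>The even-function rule asks for the closed half-line. At the origin both sides
    vanish, since \<open>dens 0 = 0\<close>.\<close>
  have eq: "(indicator {0<..} x *\<^sub>R (\<bar>2 * c * x\<bar> * f (c * x\<^sup>2))) * (1 / (2 * c powr a * 2 powr (\<kappa> + 1) * Gamma (\<kappa> + 1)))
       = indicator {0..} x *\<^sub>R (dens x * (x ^ (2 * n) * gauss s x))" for x
  proof (cases "x > 0")
    case True
    have "c * x * (c * x\<^sup>2) powr (a - 1) = c powr a * (x powr (2 * \<kappa> + 1) * x ^ (2 * n))"
    proof -
      have "(c * x\<^sup>2) powr (a - 1) = c powr (a - 1) * x powr (2 * (a - 1))"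
        using True c by (simp add: powr_mult powr_powr flip: powr_numeral)
      moreover have "c * c powr (a - 1) = c powr a"
        using c powr_add[of c 1 "a - 1"] by simp
      moreover have "x * x powr (2 * (a - 1)) = x powr (2 * \<kappa> + 1) * x ^ (2 * n)"
      proof -
        have "x * x powr (2 * (a - 1)) = x powr (1 + 2 * (a - 1))"
          using True by (simp only: powr_add) simp
        also have "1 + 2 * (a - 1) = (2 * \<kappa> + 1) + real (2 * n)" by (simp add: a_def)
        also have "x powr \<dots> = x powr (2 * \<kappa> + 1) * x ^ (2 * n)"
          using True by (simp only: powr_add powr_realpow)
        finally show ?thesis .
      qed
      ultimately show ?thesis by (metis (no_types, lifting) mult.assoc mult.left_commute)
    qed
    moreover have gs: "gauss s x = 1 / exp (c * x\<^sup>2)"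
      by (simp add: gauss_def c_def exp_minus inverse_eq_divide)
    ultimately show ?thesis
      using True c unfolding gs by (simp add: f_def dens_def field_simps)
  next
    case False
    then show ?thesis using kappa by (cases "x = 0") (auto simp: dens_def)
  qed
  have 2: "has_bochner_integral lborel (\<lambda>x. indicator {0..} x *\<^sub>R (dens x * (x ^ (2 * n) * gauss s x)))
      (Gamma a * (1 / (2 * c powr a * 2 powr (\<kappa> + 1) * Gamma (\<kappa> + 1))))"
    using 1 unfolding eq .
  have "has_bochner_integral lborel (\<lambda>x. dens x * (x ^ (2 * n) * gauss s x))
      (2 * (Gamma a * (1 / (2 * c powr a * 2 powr (\<kappa> + 1) * Gamma (\<kappa> + 1)))))"
    using has_bochner_integral_even_function[OF 2] by (simp add: gauss_def)
  moreover have "2 * (Gamma a * (1 / (2 * c powr a * 2 powr (\<kappa> + 1) * Gamma (\<kappa> + 1)))) =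
      s powr (\<kappa> + 1) * s ^ n * dfact (2 * n) / (2 ^ n * fact n)"
  proof -
    have "1 / c powr a = (2 * s) powr (real n + (\<kappa> + 1))"
      using s by (simp add: c_def a_def powr_divide add.assoc)
    also have "\<dots> = 2 ^ n * s ^ n * (2 powr (\<kappa> + 1) * s powr (\<kappa> + 1))"
      using s by (simp add: powr_add powr_realpow powr_mult power_mult_distrib)
    finally have A: "1 / c powr a = 2 ^ n * s ^ n * (2 powr (\<kappa> + 1) * s powr (\<kappa> + 1))" .
    have "2 * (Gamma a * (1 / (2 * c powr a * 2 powr (\<kappa> + 1) * Gamma (\<kappa> + 1)))) =
        (1 / c powr a) * Gamma a / (2 powr (\<kappa> + 1) * Gamma (\<kappa> + 1))"
      by simp
    also have "\<dots> = s powr (\<kappa> + 1) * s ^ n * 2 ^ n * Gamma a / Gamma (\<kappa> + 1)"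
      unfolding A by simp
    also have "(4::real) ^ n = 2 ^ n * 2 ^ n" by (simp flip: power_mult_distrib)
    then have "s powr (\<kappa> + 1) * s ^ n * 2 ^ n * Gamma a / Gamma (\<kappa> + 1) =
        s powr (\<kappa> + 1) * s ^ n * dfact (2 * n) / (2 ^ n * fact n)"
      unfolding dfact_even a_def by simp
    finally show ?thesis .
  qed
  ultimately show ?thesis
    by (subst has_bochner_integral_mu) auto
qed

lemma integrable_gauss_even: "s > 0 \<Longrightarrow> integrable \<mu> (\<lambda>x. x ^ (2 * n) * gauss s x)"
  using gauss_moment_even has_bochner_integral_iff by blast

lemma integrable_gauss: "s > 0 \<Longrightarrow> integrable \<mu> (gauss s)"
  using integrable_gauss_even[of s 0] by simp

definition gmom :: "real \<Rightarrow> nat \<Rightarrow> real" where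
  "gmom s n = (LINT x|\<mu>. x ^ n * gauss s x)"

lemma gmom_odd: "odd n \<Longrightarrow> gmom s n = 0"
proof -
  assume n: "odd n"
  have "gmom s n = (LINT x|lborel. dens x * (x ^ n * gauss s x))"
    unfolding gmom_def mu_dens by (subst integral_real_density) auto
  also have "\<dots> = (LINT x|lborel. dens (- x) * ((- x) ^ n * gauss s (- x)))"
    using lborel_integral_real_affine[of "-1" "\<lambda>x. dens x * (x ^ n * gauss s x)" 0] by simp
  also have "\<dots> = - gmom s n"
    unfolding gmom_def mu_dens using n by (subst integral_real_density) (auto simp: gauss_def)
  finally show ?thesis by simp
qed

lemma gmom_even: "s > 0 \<Longrightarrow> gmom s (2 * n) = s powr (\<kappa> + 1) * s ^ n * dfact (2 * n) / (2 ^ n * fact n)"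
  using gauss_moment_even[of s n] by (simp add: gmom_def has_bochner_integral_iff)

lemma gmom_rec:
  assumes "s > 0" "even n"
  shows "gmom s (n + 2) = s * (real n + 2 * \<kappa> + 2) * gmom s n"
proof -
  obtain m where m: "n = 2 * m" using assms by (auto elim!: evenE)
  have "gmom s (2 * (m + 1)) = s * (real (2 * m) + 2 * \<kappa> + 2) * gmom s (2 * m)"
    using assms unfolding gmom_even[OF assms(1)] by (simp add: divide_simps)
  then show ?thesis by (simp add: m)
qed

text \<open>Completing the square: half of the Gaussian decay pays for the exponential growth,
  whence the doubled parameter on the right.\<close>

lemma exp_abs_gauss_le: "s > 0 \<Longrightarrow> exp (B * \<bar>x\<bar>) * gauss s x \<le> exp (s * B\<^sup>2) * gauss (2 * s) x"
proof -
  assume s: "s > 0"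
  have "0 \<le> (\<bar>x\<bar> - 2 * s * B)\<^sup>2" by simp
  then have "4 * s * B * \<bar>x\<bar> \<le> x\<^sup>2 + 4 * s\<^sup>2 * B\<^sup>2" by (simp add: power2_eq_square algebra_simps)
  then have "B * \<bar>x\<bar> \<le> (x\<^sup>2 + 4 * s\<^sup>2 * B\<^sup>2) / (4 * s)"
    using s by (subst pos_le_divide_eq) (auto simp: ac_simps)
  also have "\<dots> = x\<^sup>2 / (2 * s) - x\<^sup>2 / (2 * (2 * s)) + s * B\<^sup>2"
    using s by (simp add: field_simps power2_eq_square)
  finally have "B * \<bar>x\<bar> - x\<^sup>2 / (2 * s) \<le> s * B\<^sup>2 - x\<^sup>2 / (2 * (2 * s))"
    by simp
  then show ?thesis by (simp add: gauss_def flip: exp_add)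
qed

lemma integrable_gauss_exp_bound:
  fixes g :: "real \<Rightarrow> 'b :: {banach, second_countable_topology}"
  assumes "s > 0" and [measurable]: "g \<in> borel_measurable borel" and b: "\<And>x. norm (g x) \<le> C * exp (B * \<bar>x\<bar>)"
  shows "integrable \<mu> (\<lambda>x. gauss s x *\<^sub>R g x)"
proof (rule Bochner_Integration.integrable_bound)
  show "integrable \<mu> (\<lambda>x. C * exp (s * B\<^sup>2) * gauss (2 * s) x)"
    using assms(1) by (intro integrable_mult_right integrable_gauss) auto
  show "AE x in \<mu>. norm (gauss s x *\<^sub>R g x) \<le> norm (C * exp (s * B\<^sup>2) * gauss (2 * s) x)"
  proof (intro AE_I2)
    fix x
    have C: "C \<ge> 0" using order_trans[OF norm_ge_zero b[of 0]] by simp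
    have "norm (gauss s x *\<^sub>R g x) \<le> gauss s x * (C * exp (B * \<bar>x\<bar>))"
      by (simp add: b mult_left_mono)
    also have "\<dots> \<le> C * (exp (s * B\<^sup>2) * gauss (2 * s) x)"
      using mult_left_mono[OF exp_abs_gauss_le[OF assms(1)] C, of B x] by (simp add: ac_simps)
    finally show "norm (gauss s x *\<^sub>R g x) \<le> norm (C * exp (s * B\<^sup>2) * gauss (2 * s) x)"
      using C by (simp add: mult.assoc abs_mult)
  qed
qed simp

end

section \<open>Gaussian integrals of products of kernels\<close>

context dunkl begin

text \<open>The factor by which the Dunkl operator multiplies when it lowers x^n to x^(n-1). Its
  value 0 at 0 makes the truncated subtraction \<open>k - 1\<close> harmless in the
  recursions.\<close>

definition dth :: "nat \<Rightarrow> real" where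
  "dth n = real n + (if odd n then 2 * \<kappa> + 1 else 0)"

lemma dfact_Suc_dth: "dfact (Suc n) = dth (Suc n) * dfact n"
  by (simp add: dth_def)

lemma dth_pos: "n > 0 \<Longrightarrow> dth n > 0"
  using kappa by (simp add: dth_def)

lemma dth_0 [simp]: "dth 0 = 0" and dth_1: "dth 1 = 2 * \<kappa> + 2"
  by (simp_all add: dth_def)

section \<open>Majorants for termwise integration\<close>

lemma dkernel_partial_norm: "norm (\<Sum>k<n. z ^ k /\<^sub>R dfact k) \<le> exp (norm z)" for z :: complex
proof -
  have "norm (\<Sum>k<n. z ^ k /\<^sub>R dfact k) \<le> (\<Sum>k<n. norm z ^ k /\<^sub>R fact k)"
    using dfact_ge_fact less_imp_le[OF dfact_pos]
    by (intro order_trans[OF norm_sum] sum_mono)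
       (auto simp: norm_power intro!: mult_right_mono le_imp_inverse_le)
  also have "\<dots> \<le> (\<Sum>k. norm z ^ k /\<^sub>R fact k)"
    by (intro sum_le_suminf summable_exp_generic) auto
  finally show ?thesis by (simp add: exp_def)
qed

lemma power_abs_le_exp: "\<bar>x\<bar> ^ k \<le> fact k * exp \<bar>x\<bar>" for x :: real
proof -
  have "(\<Sum>n\<in>{k}. \<bar>x\<bar> ^ n /\<^sub>R fact n) \<le> (\<Sum>n. \<bar>x\<bar> ^ n /\<^sub>R fact n)"
    by (rule sum_le_suminf[OF summable_exp_generic]) auto
  then show ?thesis by (simp add: exp_def field_simps)
qed

text \<open>Divided by \<open>dfact k\<close>, these are the coefficients of a^k in Weber's integral
  with parameters a and b.\<close>

definition dgm :: "real \<Rightarrow> complex \<Rightarrow> nat \<Rightarrow> complex" where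
  "dgm s b k = (LINT x|\<mu>. gauss s x *\<^sub>R (of_real x ^ k * E (b * of_real x)))"

lemma integrable_dgm: "s > 0 \<Longrightarrow> integrable \<mu> (\<lambda>x. gauss s x *\<^sub>R (of_real x ^ k * E (b * of_real x)))"
proof (rule integrable_gauss_exp_bound[where C = "fact k" and B = "1 + norm b"])
  fix x :: real
  have "norm (of_real x ^ k * E (b * of_real x)) \<le> (fact k * exp \<bar>x\<bar>) * exp (norm b * \<bar>x\<bar>)"
    using norm_dkernel_le[of "b * of_real x"] power_abs_le_exp[of x k]
    by (auto simp: norm_mult norm_power intro!: mult_mono)
  then show "norm (of_real x ^ k * E (b * of_real x)) \<le> fact k * exp ((1 + norm b) * \<bar>x\<bar>)"
    by (simp add: distrib_right exp_add mult.assoc)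
qed auto

text \<open>The partial sums of the kernel stay below \<open>exp (norm a * \<bar>x\<bar>)\<close>,
  so together with the Gaussian they have an integrable majorant and the series may be integrated
  term by term.\<close>

lemma gauss_series:
  assumes s: "s > 0" and [measurable]: "g \<in> borel_measurable borel"
    and b: "\<And>x. norm (g x) \<le> C * exp (B * \<bar>x\<bar>)"
  shows "(\<lambda>k. (a ^ k /\<^sub>R dfact k) * (LINT x|\<mu>. gauss s x *\<^sub>R (of_real x ^ k * g x))) sums
    (LINT x|\<mu>. gauss s x *\<^sub>R (E (a * of_real x) * g x))"
  unfolding sums_def
proof -
  have C: "C \<ge> 0" using order_trans[OF norm_ge_zero b[of 0]] by simp
  have i: "integrable \<mu> (\<lambda>x. gauss s x *\<^sub>R (of_real x ^ k * g x))" for k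
  proof (rule integrable_gauss_exp_bound[OF s, where C = "fact k * C" and B = "1 + B"])
    fix x :: real
    have "norm (of_real x ^ k * g x) \<le> (fact k * exp \<bar>x\<bar>) * (C * exp (B * \<bar>x\<bar>))"
      using power_abs_le_exp[of x k] b[of x]
      by (auto simp: norm_mult norm_power intro!: mult_mono)
    moreover have "exp ((1 + B) * \<bar>x\<bar>) = exp \<bar>x\<bar> * exp (B * \<bar>x\<bar>)"
      by (simp add: distrib_right exp_add)
    ultimately show "norm (of_real x ^ k * g x) \<le> fact k * C * exp ((1 + B) * \<bar>x\<bar>)"
      by (simp only: mult_ac)
  qed measurable
  define S where "S n x = (\<Sum>k<n. (a * of_real x) ^ k /\<^sub>R dfact k)" for n x
  have eq: "(\<Sum>k<n. (a ^ k /\<^sub>R dfact k) * (LINT x|\<mu>. gauss s x *\<^sub>R (of_real x ^ k * g x))) =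
    (LINT x|\<mu>. gauss s x *\<^sub>R (S n x * g x))" for n
  proof -
    have "(LINT x|\<mu>. gauss s x *\<^sub>R (S n x * g x)) =
      (LINT x|\<mu>. (\<Sum>k<n. (a ^ k /\<^sub>R dfact k) * (gauss s x *\<^sub>R (of_real x ^ k * g x))))"
      by (intro Bochner_Integration.integral_cong refl)
         (simp add: S_def sum_distrib_left sum_distrib_right power_mult_distrib scaleR_conv_of_real ac_simps)
    also have "\<dots> = (\<Sum>k<n. (a ^ k /\<^sub>R dfact k) * (LINT x|\<mu>. gauss s x *\<^sub>R (of_real x ^ k * g x)))"
      by (subst Bochner_Integration.integral_sum) (intro integrable_mult_right i, simp only: integral_mult_right_zero)
    finally show ?thesis by simp
  qed
  show "(\<lambda>n. \<Sum>k<n. (a ^ k /\<^sub>R dfact k) * (LINT x|\<mu>. gauss s x *\<^sub>R (of_real x ^ k * g x))) \<longlonglongrightarrow>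
    (LINT x|\<mu>. gauss s x *\<^sub>R (E (a * of_real x) * g x))"
    unfolding eq
  proof (rule integral_dominated_convergence)
    show "integrable \<mu> (\<lambda>x. gauss s x *\<^sub>R (C * exp ((norm a + B) * \<bar>x\<bar>)))"
      using C by (intro integrable_gauss_exp_bound[OF s, where C = C and B = "norm a + B"]) auto
    show "AE x in \<mu>. (\<lambda>n. gauss s x *\<^sub>R (S n x * g x)) \<longlonglongrightarrow> gauss s x *\<^sub>R (E (a * of_real x) * g x)"
      unfolding S_def using dkernel_sums by (intro AE_I2 tendsto_intros) (simp add: sums_def)
    show "AE x in \<mu>. norm (gauss s x *\<^sub>R (S n x * g x)) \<le> gauss s x *\<^sub>R (C * exp ((norm a + B) * \<bar>x\<bar>))" for n
    proof (intro AE_I2)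
      fix x
      have "norm (S n x * g x) \<le> exp (norm (a * of_real x)) * (C * exp (B * \<bar>x\<bar>))"
        unfolding norm_mult[of "S n x"] using b C unfolding S_def by (intro mult_mono dkernel_partial_norm) auto
      moreover have "exp ((norm a + B) * \<bar>x\<bar>) = exp (norm (a * of_real x)) * exp (B * \<bar>x\<bar>)"
        by (simp add: distrib_right exp_add norm_mult)
      ultimately have "norm (S n x * g x) \<le> C * exp ((norm a + B) * \<bar>x\<bar>)"
        by (simp only: mult_ac)
      then show "norm (gauss s x *\<^sub>R (S n x * g x)) \<le> gauss s x *\<^sub>R (C * exp ((norm a + B) * \<bar>x\<bar>))"
        by (simp add: mult_left_mono)
    qed
  qed (auto simp: S_def)
qed

lemma dgm_sums:
  assumes s: "s > 0"
  shows "(\<lambda>m. (b ^ m /\<^sub>R dfact m) * of_real (gmom s (k + m))) sums dgm s b k"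
proof -
  have "norm (complex_of_real x ^ k) \<le> fact k * exp (1 * \<bar>x\<bar>)" for x
    using power_abs_le_exp[of x k] by (simp add: norm_power)
  from gauss_series[OF s _ this, of b]
  have "(\<lambda>m. (b ^ m /\<^sub>R dfact m) * (LINT x|\<mu>. gauss s x *\<^sub>R (of_real x ^ m * of_real x ^ k))) sums
      (LINT x|\<mu>. gauss s x *\<^sub>R (E (b * of_real x) * of_real x ^ k))"
    by auto
  moreover have "(LINT x|\<mu>. gauss s x *\<^sub>R (of_real x ^ m * of_real x ^ k)) = complex_of_real (gmom s (k + m))" for m
  proof -
    have "(LINT x|\<mu>. gauss s x *\<^sub>R (complex_of_real x ^ m * of_real x ^ k)) = (LINT x|\<mu>. complex_of_real (x ^ (k + m) * gauss s x))"
      by (intro Bochner_Integration.integral_cong refl) (simp add: scaleR_conv_of_real power_add ac_simps)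
    then show ?thesis unfolding gmom_def by (simp only: integral_complex_of_real)
  qed
  ultimately show ?thesis unfolding dgm_def by (simp add: mult.commute)
qed

text \<open>Odd Gaussian moments vanish, and the even ones carry a factor
  \<open>dfact (2 * n)\<close> that cancels the denominator; what is left is the exponential
  series.\<close>

lemma dgm_0:
  assumes s: "s > 0"
  shows "dgm s b 0 = of_real (s powr (\<kappa> + 1)) * exp (of_real s * b\<^sup>2 / 2)"
proof -
  let ?f = "\<lambda>m. (b ^ m /\<^sub>R dfact m) * of_real (gmom s m)"
  have "?f sums dgm s b 0" using dgm_sums[OF s, of b 0] by simp
  then have "(\<lambda>n. sum ?f {n * 2..<n * 2 + 2}) sums dgm s b 0"
    by (rule sums_group) simp
  also have eq: "(\<lambda>n. sum ?f {n * 2..<n * 2 + 2}) = (\<lambda>n. of_real (s powr (\<kappa> + 1)) * ((of_real s * b\<^sup>2 / 2) ^ n /\<^sub>R fact n))"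
  proof
    fix n
    show "sum ?f {n * 2..<n * 2 + 2} = of_real (s powr (\<kappa> + 1)) * ((of_real s * b\<^sup>2 / 2) ^ n /\<^sub>R fact n)"
  proof -
    have "{n * 2..<n * 2 + 2} = {2 * n, Suc (2 * n)}" by auto
    then have "sum ?f {n * 2..<n * 2 + 2} = ?f (2 * n)"
      by (simp add: gmom_odd del: dfact.simps)
    also have "\<dots> = of_real (s powr (\<kappa> + 1)) * ((of_real s * b\<^sup>2 / 2) ^ n /\<^sub>R fact n)"
    proof -
      have "(B /\<^sub>R g) * of_real (S * p * g / (q * f)) = of_real S * ((of_real p * B / of_real q) /\<^sub>R f)"
        if "g \<noteq> 0" for B :: complex and g S p q f :: real
        using that by (simp add: scaleR_conv_of_real field_simps)
      moreover have "(of_real s * b\<^sup>2 / 2) ^ n = of_real (s ^ n) * b ^ (2 * n) / complex_of_real (2 ^ n)"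
        by (simp add: power_mult_distrib power_divide power_mult)
      ultimately show ?thesis
        unfolding gmom_even[OF s] by (simp only: dfact_nonzero not_False_eq_True)
    qed
    finally show ?thesis .
  qed
  qed
  finally have "(\<lambda>n. of_real (s powr (\<kappa> + 1)) * ((of_real s * b\<^sup>2 / 2) ^ n /\<^sub>R fact n)) sums dgm s b 0" .
  moreover have "(\<lambda>n. of_real (s powr (\<kappa> + 1)) * ((of_real s * b\<^sup>2 / 2) ^ n /\<^sub>R fact n)) sums
     (of_real (s powr (\<kappa> + 1)) * exp (of_real s * b\<^sup>2 / 2))"
    by (intro sums_mult exp_converges)
  ultimately show ?thesis by (rule sums_unique2)
qed

text \<open>If k + m is odd, exactly one of the two indices is odd, so \<open>dth k + dth m\<close>
  is k + m + 2 \<kappa> + 1, the factor of \<open>gmom_rec\<close>. If k + m is even, both moments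
  have odd order and vanish.\<close>

lemma gmom_step:
  assumes s: "s > 0" and "k + m > 0"
  shows "gmom s (Suc (k + m)) = s * (dth k + dth m) * gmom s (k + m - 1)"
proof (cases "odd (k + m)")
  case True
  then have "gmom s (k + m - 1 + 2) = s * (real (k + m - 1) + 2 * \<kappa> + 2) * gmom s (k + m - 1)"
    using s by (intro gmom_rec) auto
  moreover have "real (k + m - 1) + 2 * \<kappa> + 2 = dth k + dth m"
    using True assms(2) by (auto simp: dth_def of_nat_diff)
  moreover have "k + m - 1 + 2 = Suc (k + m)" using assms(2) by simp
  ultimately show ?thesis by metis
next
  case False
  then have "odd (k + m - 1)" "odd (Suc (k + m))" using assms(2) by auto
  then show ?thesis by (simp add: gmom_odd)
qed

text \<open>Integration by parts for the Dunkl operator against the Gaussian. The sum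
  \<open>dth k + dth m\<close> splits the series: the first part is the moment of order
  \<open>k - 1\<close>, while in the second \<open>dth m\<close> cancels against
  \<open>dfact m\<close>, which shifts the index and brings out the factor \<open>b\<close>.\<close>

lemma dgm_Suc:
  assumes s: "s > 0"
  shows "dgm s b (Suc k) = of_real s * (of_real (dth k) * dgm s b (k - 1) + b * dgm s b k)"
proof -
  let ?c = "\<lambda>m. b ^ m /\<^sub>R dfact m"
  \<comment> \<open>The series of \<open>b * dgm s b k\<close> moved up by one index, with a zero in
    front, so that it can be added term by term.\<close>
  define u where "u m = (if m = 0 then 0 else b * (?c (m - 1) * complex_of_real (gmom s (k + (m - 1)))))" for m
  have u: "u sums (b * dgm s b k)"
  proof -
    have "(\<lambda>m. b * (?c m * complex_of_real (gmom s (k + m)))) sums (b * dgm s b k)"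
      by (intro sums_mult dgm_sums s)
    then have "(\<lambda>m. u (Suc m)) sums (b * dgm s b k)" by (simp add: u_def)
    then show ?thesis by (subst (asm) sums_Suc_iff) (simp add: u_def)
  qed
  have v: "(\<lambda>m. of_real (dth k) * (?c m * of_real (gmom s (k - 1 + m)))) sums (of_real (dth k) * dgm s b (k - 1))"
    by (intro sums_mult dgm_sums s)
  have "(\<lambda>m. of_real s * (of_real (dth k) * (?c m * of_real (gmom s (k - 1 + m))) + u m)) sums
    (of_real s * (of_real (dth k) * dgm s b (k - 1) + b * dgm s b k))"
    by (intro sums_mult sums_add u v)
  moreover have "of_real s * (of_real (dth k) * (?c m * of_real (gmom s (k - 1 + m))) + u m) =
     ?c m * of_real (gmom s (Suc k + m))" for m
  proof (cases "k + m = 0")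
    case True
    then show ?thesis by (simp add: u_def gmom_odd)
  next
    case False
    have 1: "of_real (dth k) * (?c m * of_real (gmom s (k - 1 + m))) = of_real (dth k) * ?c m * complex_of_real (gmom s (k + m - 1))"
      using False by (cases "k = 0") auto
    have 2: "u m = of_real (dth m) * ?c m * complex_of_real (gmom s (k + m - 1))"
    proof (cases m)
      case (Suc j)
      have "dth (Suc j) \<noteq> 0" using dth_pos[of "Suc j"] by simp
      then show ?thesis
        unfolding u_def Suc dfact_Suc_dth by (simp add: scaleR_conv_of_real field_simps del: dfact.simps)
    qed (simp add: u_def)
    have "gmom s (Suc k + m) = s * (dth k + dth m) * gmom s (k + m - 1)"
      using gmom_step[OF s, of k m] False by simp
    then show ?thesis unfolding 1 2 by (simp add: algebra_simps)
  qed
  ultimately have "(\<lambda>m. ?c m * of_real (gmom s (Suc k + m))) sums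
    (of_real s * (of_real (dth k) * dgm s b (k - 1) + b * dgm s b k))"
    by simp
  with dgm_sums[OF s, of b "Suc k"] show ?thesis by (rule sums_unique2)
qed

text \<open>The terms in a of exp (s a^2 / 2), padded with zeros at odd indices so that a Cauchy
  product with the kernel series can be formed.\<close>

definition egc :: "real \<Rightarrow> complex \<Rightarrow> nat \<Rightarrow> complex" where
  "egc s a i = (if even i then (of_real s * a\<^sup>2 / 2) ^ (i div 2) /\<^sub>R fact (i div 2) else 0)"

lemma egc_sums: "egc s a sums exp (of_real s * a\<^sup>2 / 2)"
  and egc_summable: "summable (\<lambda>i. norm (egc s a i))"
proof -
  have inj: "strict_mono (\<lambda>n::nat. 2 * n)" by (auto simp: strict_mono_def)
  have 1: "egc s a n = 0" if "n \<notin> range (\<lambda>n. 2 * n)" for n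
    using that by (auto simp: egc_def elim!: evenE)
  have 2: "(\<lambda>n. egc s a (2 * n)) = (\<lambda>n. (of_real s * a\<^sup>2 / 2) ^ n /\<^sub>R fact n)"
    by (auto simp: egc_def)
  have "(\<lambda>n. egc s a (2 * n)) sums exp (of_real s * a\<^sup>2 / 2)"
    unfolding 2 by (rule exp_converges)
  then show "egc s a sums exp (of_real s * a\<^sup>2 / 2)"
    by (subst (asm) sums_mono_reindex[OF inj 1]) auto
  have "summable (\<lambda>n. norm (egc s a (2 * n)))"
    unfolding 2[THEN fun_cong] by (rule summable_norm_exp)
  then show "summable (\<lambda>i. norm (egc s a i))"
    by (subst (asm) summable_mono_reindex[OF inj, of "\<lambda>n. norm (egc s a n)"]) (auto simp: 1)
qed

lemma egc_step: "of_nat (Suc (Suc i)) * egc s 1 (Suc (Suc i)) = of_real s * egc s 1 i"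
proof (cases "even i")
  case True
  then obtain j where i: "i = 2 * j" by (auto elim!: evenE)
  have *: "2 * n * (s / 2 * p / (n * f)) = s * (p / f)" if "n \<noteq> 0" for n p f s :: complex
    using that by simp
  have "egc s 1 (Suc (Suc i)) = of_real s / 2 * (of_real s / 2) ^ j / (of_nat (Suc j) * fact j)"
    by (simp add: i egc_def scaleR_conv_of_real inverse_eq_divide del: of_nat_Suc)
  moreover have "egc s 1 i = (of_real s / 2) ^ j / fact j"
    by (simp add: i egc_def scaleR_conv_of_real inverse_eq_divide)
  moreover have "complex_of_nat (Suc (Suc i)) = 2 * of_nat (Suc j)"
    by (simp add: i)
  ultimately show ?thesis
    by (simp only: *[OF of_nat_neq_0])
qed (simp add: egc_def)

text \<open>
  Regarded as power series in \<open>a\<close>, both sides of Weber's formula have coefficients \<open>c\<^sub>k\<close> with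
  \<open>dth (k + 1) c\<^bsub>k+1\<^esub> = s (c\<^bsub>k-1\<^esub> + b c\<^sub>k)\<close>; this is how the equation \<open>T u = s (a + b) u\<close> for the Dunkl
  operator \<open>T\<close> in the variable \<open>a\<close> reads on coefficients.
\<close>

definition gco :: "real \<Rightarrow> complex \<Rightarrow> nat \<Rightarrow> complex" where
  "gco s b k = (\<Sum>i\<le>k. egc s 1 i * ((of_real s * b) ^ (k - i) /\<^sub>R dfact (k - i)))"

lemma gco_Suc:
  "of_real (dth (Suc k)) * gco s b (Suc k) =
     of_real s * ((if k = 0 then 0 else gco s b (k - 1)) + b * gco s b k)"
proof -
  define d where "d l = (of_real s * b) ^ l /\<^sub>R dfact l" for l
  have dstep: "of_real (dth (Suc l)) * d (Suc l) = of_real s * b * d l" for l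
    using dth_pos[of "Suc l"] unfolding d_def dfact_Suc_dth
    by (simp add: scaleR_conv_of_real field_simps del: dfact.simps)
  have "of_real (dth (Suc k)) * gco s b (Suc k) =
      (\<Sum>i\<le>Suc k. of_nat i * egc s 1 i * d (Suc k - i)) + (\<Sum>i\<le>Suc k. egc s 1 i * (of_real (dth (Suc k - i)) * d (Suc k - i)))"
    unfolding gco_def d_def[symmetric] sum_distrib_left sum.distrib[symmetric]
  proof (intro sum.cong refl)
    fix i assume "i \<in> {..Suc k}"
    then show "of_real (dth (Suc k)) * (egc s 1 i * d (Suc k - i)) =
       of_nat i * egc s 1 i * d (Suc k - i) + egc s 1 i * (of_real (dth (Suc k - i)) * d (Suc k - i))"
    proof (cases "even i")
      case True
      \<comment> \<open>Only even \<open>i\<close> contribute, and taking away an even number keeps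
        the parity, so \<open>dth\<close> is additive here. This is the Leibniz rule, which the
        Dunkl operator obeys when one factor is even.\<close>
      then have "dth (Suc k) = real i + dth (Suc k - i)"
        using \<open>i \<in> {..Suc k}\<close> by (auto simp: dth_def of_nat_diff)
      then show ?thesis by (simp add: algebra_simps)
    qed (simp add: egc_def)
  qed
  also have "(\<Sum>i\<le>Suc k. of_nat i * egc s 1 i * d (Suc k - i)) = of_real s * (if k = 0 then 0 else gco s b (k - 1))"
  proof (cases k)
    case 0
    then show ?thesis by (simp add: egc_def)
  next
    case (Suc j)
    \<comment> \<open>The terms \<open>i = 0\<close> and \<open>i = 1\<close> vanish, and
      \<open>egc_step\<close> lowers the others by two.\<close>
    have "(\<Sum>i\<le>Suc (Suc j). of_nat i * egc s 1 i * d (Suc k - i)) =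
        (\<Sum>i\<le>j. of_nat (Suc (Suc i)) * egc s 1 (Suc (Suc i)) * d (Suc k - Suc (Suc i)))"
      by (subst sum.atMost_Suc_shift, subst sum.atMost_Suc_shift) (simp add: egc_def del: of_nat_Suc sum.atMost_Suc)
    also have "\<dots> = of_real s * gco s b j"
      unfolding egc_step gco_def sum_distrib_left Suc d_def by (intro sum.cong refl) simp
    finally show ?thesis by (simp add: Suc)
  qed
  also have "(\<Sum>i\<le>Suc k. egc s 1 i * (of_real (dth (Suc k - i)) * d (Suc k - i))) = of_real s * b * gco s b k"
  proof -
    have "(\<Sum>i\<le>Suc k. egc s 1 i * (of_real (dth (Suc k - i)) * d (Suc k - i))) =
        (\<Sum>i\<le>k. egc s 1 i * (of_real (dth (Suc k - i)) * d (Suc k - i)))"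
      by simp
    also have "\<dots> = (\<Sum>i\<le>k. of_real s * b * (egc s 1 i * d (k - i)))"
      by (intro sum.cong refl) (simp add: Suc_diff_le dstep)
    finally show ?thesis by (simp add: gco_def d_def sum_distrib_left)
  qed
  finally show ?thesis by (simp add: algebra_simps)
qed

text \<open>\<open>dfact k * gco s b k\<close> obeys the recursion of \<open>dgm_Suc\<close>,
  because \<open>dth (Suc j) * dfact j = dfact (Suc j)\<close>. The induction is strong since the
  recursion reaches back two steps.\<close>

lemma dgm_eq_gco:
  assumes s: "s > 0"
  shows "dgm s b k = of_real (dfact k) * (dgm s b 0 * gco s b k)"
proof (induction k rule: less_induct)
  case (less k)
  show ?case
  proof (cases k)
    case 0
    then show ?thesis by (simp add: gco_def egc_def)
  next
    case (Suc j)
    have "dgm s b (Suc j) = of_real s * (of_real (dth j) * dgm s b (j - 1) + b * dgm s b j)"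
      by (rule dgm_Suc[OF s])
    also have "of_real (dth j) * dgm s b (j - 1) = of_real (dfact j) * dgm s b 0 * (if j = 0 then 0 else gco s b (j - 1))"
    proof (cases j)
      case (Suc i)
      then show ?thesis using less.IH[of i] \<open>k = Suc j\<close> by (simp add: dfact_Suc_dth del: dfact.simps)
    qed simp
    also have "dgm s b j = of_real (dfact j) * (dgm s b 0 * gco s b j)"
      by (rule less.IH) (simp add: Suc)
    also have "of_real s * (of_real (dfact j) * dgm s b 0 * (if j = 0 then 0 else gco s b (j - 1)) +
        b * (of_real (dfact j) * (dgm s b 0 * gco s b j))) =
      of_real (dfact j) * dgm s b 0 * (of_real s * ((if j = 0 then 0 else gco s b (j - 1)) + b * gco s b j))"
      by (simp add: algebra_simps)
    also have "\<dots> = of_real (dfact (Suc j)) * (dgm s b 0 * gco s b (Suc j))"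
      unfolding gco_Suc[symmetric] dfact_Suc_dth by simp
    finally show ?thesis by (simp add: Suc)
  qed
qed

text \<open>Weber's formula: as a series in \<open>a\<close>, the right-hand side is the Cauchy
  product of \<open>egc\<close> with the kernel series. The parameters are complex because the
  spectral formula takes both imaginary and the product formula takes one of each kind.\<close>

lemma gauss_product_integral:
  assumes s: "s > 0"
  shows "(LINT x|\<mu>. gauss s x *\<^sub>R (E (a * of_real x) * E (b * of_real x))) =
     of_real (s powr (\<kappa> + 1)) * exp (of_real s * (a\<^sup>2 + b\<^sup>2) / 2) * E (of_real s * a * b)"
proof -
  have "(\<lambda>k. (a ^ k /\<^sub>R dfact k) * dgm s b k) sums (LINT x|\<mu>. gauss s x *\<^sub>R (E (a * of_real x) * E (b * of_real x)))"
  proof -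
    have "norm (E (b * of_real x)) \<le> 1 * exp (norm b * \<bar>x\<bar>)" for x
      using norm_dkernel_le[of "b * of_real x"] by (simp add: norm_mult)
    from gauss_series[OF s _ this] show ?thesis unfolding dgm_def by simp
  qed
  moreover have "(\<lambda>k. (a ^ k /\<^sub>R dfact k) * dgm s b k) sums (dgm s b 0 * (exp (of_real s * a\<^sup>2 / 2) * E (of_real s * a * b)))"
  proof -
    let ?d = "\<lambda>l. (of_real s * a * b) ^ l /\<^sub>R dfact l"
    have "(\<lambda>k. \<Sum>i\<le>k. egc s a i * ?d (k - i)) sums (suminf (egc s a) * suminf ?d)"
      by (rule Cauchy_product_sums[OF egc_summable dkernel_summable])
    moreover have "(\<Sum>i\<le>k. egc s a i * ?d (k - i)) = a ^ k * gco s b k" for k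
      unfolding gco_def sum_distrib_left
    proof (intro sum.cong refl)
      fix i assume i: "i \<in> {..k}"
      then have ak: "a ^ k = a ^ i * a ^ (k - i)" by (simp flip: power_add)
      have "egc s a i = a ^ i * egc s 1 i"
        by (auto simp: egc_def power_mult_distrib power_divide elim!: evenE simp flip: power_mult)
      then show "egc s a i * ?d (k - i) = a ^ k * (egc s 1 i * ((of_real s * b) ^ (k - i) /\<^sub>R dfact (k - i)))"
        unfolding ak by (simp add: power_mult_distrib)
    qed
    ultimately have "(\<lambda>k. a ^ k * gco s b k) sums (exp (of_real s * a\<^sup>2 / 2) * E (of_real s * a * b))"
      using sums_unique[OF egc_sums[of s a]] sums_unique[OF dkernel_sums[of "of_real s * a * b"]] by simp
    then have "(\<lambda>k. dgm s b 0 * (a ^ k * gco s b k)) sums (dgm s b 0 * (exp (of_real s * a\<^sup>2 / 2) * E (of_real s * a * b)))"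
      by (rule sums_mult)
    moreover have "dgm s b 0 * (a ^ k * gco s b k) = (a ^ k /\<^sub>R dfact k) * dgm s b k" for k
      unfolding dgm_eq_gco[OF s, of b k] by (simp add: scaleR_conv_of_real)
    ultimately show ?thesis by simp
  qed
  ultimately have "(LINT x|\<mu>. gauss s x *\<^sub>R (E (a * of_real x) * E (b * of_real x))) =
      dgm s b 0 * (exp (of_real s * a\<^sup>2 / 2) * E (of_real s * a * b))"
    by (rule sums_unique2)
  also have "\<dots> = of_real (s powr (\<kappa> + 1)) * exp (of_real s * (a\<^sup>2 + b\<^sup>2) / 2) * E (of_real s * a * b)"
    unfolding dgm_0[OF s] by (simp add: exp_add[symmetric] algebra_simps add_divide_distrib mult_exp_exp)
  finally show ?thesis .
qed

end

section \<open>Approximate identities\<close>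

lemma ennreal_halve:
  fixes e :: ennreal
  assumes "0 < e"
  obtains e' where "0 < e'" "e' + e' < e"
proof -
  obtain c where "0 < c" "c < e" using assms dense by blast
  then obtain r where r: "c = ennreal r" "r > 0" by (cases c) auto
  have "ennreal (r / 2) + ennreal (r / 2) = c"
    using r by (simp flip: ennreal_plus)
  then show ?thesis using that[of "ennreal (r / 2)"] r \<open>c < e\<close> by simp
qed

lemma tendsto_0_le_ennreal:
  fixes f g :: "nat \<Rightarrow> ennreal"
  assumes "g \<longlonglongrightarrow> 0" and "\<And>n. f n \<le> g n"
  shows "f \<longlonglongrightarrow> 0"
  by (rule tendsto_sandwich[OF _ _ tendsto_const assms(1)]) (use assms(2) in auto)

text \<open>\<open>T\<close> is the coordinate along which the kernel concentrates: the identity for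
  the heat kernel, the absolute value for ball averages. The 2 in \<open>T_bound\<close> is for the
  latter, which folds the line. Concentration is measured by a first moment, so that kernels of
  unbounded support are covered.\<close>

locale concentrating_kernel = dunkl +
  fixes T :: "real \<Rightarrow> real" and k :: "nat \<Rightarrow> real \<Rightarrow> real \<Rightarrow> ennreal" and \<epsilon> :: "nat \<Rightarrow> real"
  assumes T_measurable [measurable]: "T \<in> borel_measurable borel"
    and T_bound: "\<And>u. u \<in> borel_measurable borel \<Longrightarrow> (\<integral>\<^sup>+x. u (T x) \<partial>\<mu>) \<le> 2 * (\<integral>\<^sup>+x. u x \<partial>\<mu>)"
    and k_measurable: "\<And>n. (\<lambda>z. k n (fst z) (snd z)) \<in> borel_measurable (borel \<Otimes>\<^sub>M borel)"
    and k_sym: "\<And>n x y. k n x y = k n y x"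
    and k_mass: "\<And>n x. (\<integral>\<^sup>+y. k n x y \<partial>\<mu>) \<le> 1"
    and k_conc: "\<And>n x. (\<integral>\<^sup>+y. ennreal \<bar>T x - T y\<bar> * k n x y \<partial>\<mu>) \<le> ennreal (\<epsilon> n)"
    and eps: "\<epsilon> \<longlonglongrightarrow> 0" "\<And>n. \<epsilon> n \<ge> 0"
begin

lemma k_compose_measurable [measurable (raw)]:
  assumes "f \<in> borel_measurable M" "g \<in> borel_measurable M"
  shows "(\<lambda>x. k n (f x) (g x)) \<in> borel_measurable M"
  using measurable_compose[OF measurable_Pair[OF assms] k_measurable, of n] by simp

definition osc :: "nat \<Rightarrow> (real \<Rightarrow> 'b :: {banach, second_countable_topology}) \<Rightarrow> ennreal" where
  "osc n f = (\<integral>\<^sup>+x. (\<integral>\<^sup>+y. ennreal (norm (f (T x) - f (T y))) * k n x y \<partial>\<mu>) \<partial>\<mu>)"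

text \<open>Symmetry turns the mass bound into one for the other variable; each of the two summands
  then costs the 2 of \<open>T_bound\<close>.\<close>

lemma kernel_sum_le:
  fixes u :: "real \<Rightarrow> ennreal"
  assumes [measurable]: "u \<in> borel_measurable borel"
  shows "(\<integral>\<^sup>+x. (\<integral>\<^sup>+y. (u (T x) + u (T y)) * k n x y \<partial>\<mu>) \<partial>\<mu>) \<le> 4 * (\<integral>\<^sup>+x. u x \<partial>\<mu>)"
proof -
  have A: "(\<integral>\<^sup>+x. (\<integral>\<^sup>+y. u (T x) * k n x y \<partial>\<mu>) \<partial>\<mu>) \<le> 2 * (\<integral>\<^sup>+x. u x \<partial>\<mu>)"
  proof -
    have "(\<integral>\<^sup>+x. (\<integral>\<^sup>+y. u (T x) * k n x y \<partial>\<mu>) \<partial>\<mu>) = (\<integral>\<^sup>+x. u (T x) * (\<integral>\<^sup>+y. k n x y \<partial>\<mu>) \<partial>\<mu>)"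
      by (intro nn_integral_cong nn_integral_cmult) measurable
    also have "\<dots> \<le> (\<integral>\<^sup>+x. u (T x) * 1 \<partial>\<mu>)"
      by (intro nn_integral_mono mult_left_mono k_mass) auto
    also have "\<dots> \<le> 2 * (\<integral>\<^sup>+x. u x \<partial>\<mu>)" using T_bound[of u] by simp
    finally show ?thesis .
  qed
  have "(\<integral>\<^sup>+x. (\<integral>\<^sup>+y. u (T y) * k n x y \<partial>\<mu>) \<partial>\<mu>) = (\<integral>\<^sup>+y. (\<integral>\<^sup>+x. u (T y) * k n x y \<partial>\<mu>) \<partial>\<mu>)"
    by (rule mu2.Fubini') measurable
  also have "\<dots> = (\<integral>\<^sup>+x. (\<integral>\<^sup>+y. u (T x) * k n x y \<partial>\<mu>) \<partial>\<mu>)"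
    by (subst k_sym) simp
  finally have B: "(\<integral>\<^sup>+x. (\<integral>\<^sup>+y. u (T y) * k n x y \<partial>\<mu>) \<partial>\<mu>) \<le> 2 * (\<integral>\<^sup>+x. u x \<partial>\<mu>)"
    using A by simp
  have "(\<integral>\<^sup>+x. (\<integral>\<^sup>+y. (u (T x) + u (T y)) * k n x y \<partial>\<mu>) \<partial>\<mu>) =
    (\<integral>\<^sup>+x. (\<integral>\<^sup>+y. u (T x) * k n x y \<partial>\<mu>) \<partial>\<mu>) + (\<integral>\<^sup>+x. (\<integral>\<^sup>+y. u (T y) * k n x y \<partial>\<mu>) \<partial>\<mu>)"
    by (simp add: distrib_right nn_integral_add)
  also have "\<dots> \<le> 2 * (\<integral>\<^sup>+x. u x \<partial>\<mu>) + 2 * (\<integral>\<^sup>+x. u x \<partial>\<mu>)"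
    by (intro add_mono A B)
  also have "\<dots> = 4 * (\<integral>\<^sup>+x. u x \<partial>\<mu>)"
    by (simp flip: distrib_right)
  finally show ?thesis .
qed

lemma osc_add:
  fixes f g :: "real \<Rightarrow> 'b :: {banach, second_countable_topology}"
  assumes [measurable]: "f \<in> borel_measurable borel" "g \<in> borel_measurable borel"
  shows "osc n (\<lambda>x. f x + g x) \<le> osc n f + osc n g"
proof -
  have "osc n (\<lambda>x. f x + g x) \<le> (\<integral>\<^sup>+x. (\<integral>\<^sup>+y. ennreal (norm (f (T x) - f (T y))) * k n x y + ennreal (norm (g (T x) - g (T y))) * k n x y \<partial>\<mu>) \<partial>\<mu>)"
    unfolding osc_def
  proof (intro nn_integral_mono)
    fix x y
    have "norm (f (T x) + g (T x) - (f (T y) + g (T y))) \<le> norm (f (T x) - f (T y)) + norm (g (T x) - g (T y))"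
      by norm
    then have "ennreal (norm (f (T x) + g (T x) - (f (T y) + g (T y)))) \<le> ennreal (norm (f (T x) - f (T y))) + ennreal (norm (g (T x) - g (T y)))"
      by (simp flip: ennreal_plus)
    then show "ennreal (norm (f (T x) + g (T x) - (f (T y) + g (T y)))) * k n x y \<le>
      ennreal (norm (f (T x) - f (T y))) * k n x y + ennreal (norm (g (T x) - g (T y))) * k n x y"
      unfolding distrib_right[symmetric] by (rule mult_right_mono) simp
  qed
  also have "\<dots> = osc n f + osc n g"
    unfolding osc_def by (simp add: nn_integral_add)
  finally show ?thesis .
qed

lemma osc_le_L1:
  fixes f :: "real \<Rightarrow> 'b :: {banach, second_countable_topology}"
  assumes [measurable]: "f \<in> borel_measurable borel"
  shows "osc n f \<le> 4 * (\<integral>\<^sup>+x. ennreal (norm (f x)) \<partial>\<mu>)"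
proof -
  have "osc n f \<le> (\<integral>\<^sup>+x. (\<integral>\<^sup>+y. (ennreal (norm (f (T x))) + ennreal (norm (f (T y)))) * k n x y \<partial>\<mu>) \<partial>\<mu>)"
    unfolding osc_def
    by (intro nn_integral_mono mult_right_mono) (auto simp: norm_triangle_ineq4 simp flip: ennreal_plus)
  also have "\<dots> \<le> 4 * (\<integral>\<^sup>+x. ennreal (norm (f x)) \<partial>\<mu>)"
    by (rule kernel_sum_le) simp
  finally show ?thesis .
qed

text \<open>\<open>osc n\<close> is controlled by the L1 norm uniformly in \<open>n\<close>, so the
  functions of vanishing oscillation form a closed class in L1.\<close>

lemma osc_lim:
  fixes f :: "real \<Rightarrow> 'b :: {banach, second_countable_topology}"
  assumes [measurable]: "f \<in> borel_measurable borel" "\<And>i. g i \<in> borel_measurable borel"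
    and g: "\<And>i::nat. (\<lambda>n. osc n (g i)) \<longlonglongrightarrow> 0"
    and lim: "(\<lambda>i. \<integral>\<^sup>+x. ennreal (norm (f x - g i x)) \<partial>\<mu>) \<longlonglongrightarrow> 0"
  shows "(\<lambda>n. osc n f) \<longlonglongrightarrow> 0"
proof (rule order_tendstoI)
  fix e :: ennreal assume e: "0 < e"
  obtain e' where e': "e' > 0" "e' + e' < e" using ennreal_halve[OF e] by blast
  have "(\<lambda>i. 4 * (\<integral>\<^sup>+x. ennreal (norm (f x - g i x)) \<partial>\<mu>)) \<longlonglongrightarrow> 4 * 0"
    by (intro ennreal_tendsto_cmult lim) simp
  then have "\<forall>\<^sub>F i in sequentially. 4 * (\<integral>\<^sup>+x. ennreal (norm (f x - g i x)) \<partial>\<mu>) < e'"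
    using e' by (intro order_tendstoD) auto
  then obtain i where i: "4 * (\<integral>\<^sup>+x. ennreal (norm (f x - g i x)) \<partial>\<mu>) < e'"
    by (auto simp: eventually_sequentially)
  have "\<forall>\<^sub>F n in sequentially. osc n (g i) < e'"
    using g e' by (intro order_tendstoD(2)[OF g]) auto
  then show "\<forall>\<^sub>F n in sequentially. osc n f < e"
  proof eventually_elim
    fix n assume n: "osc n (g i) < e'"
    have "osc n f \<le> osc n (g i) + osc n (\<lambda>x. f x - g i x)"
      using osc_add[of "g i" "\<lambda>x. f x - g i x" n] by simp
    also have "\<dots> \<le> osc n (g i) + 4 * (\<integral>\<^sup>+x. ennreal (norm (f x - g i x)) \<partial>\<mu>)"
      by (intro add_left_mono osc_le_L1) simp
    also have "\<dots> \<le> e' + e'"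
      using n i by (intro add_mono) auto
    finally show "osc n f < e" using e' by simp
  qed
qed simp

text \<open>A difference can be nonzero only if \<open>T x\<close> or \<open>T y\<close> lies in the
  support, so the first moment is integrated over a set of finite measure. In the bound the inner 2
  is that of \<open>T_bound\<close>, the outer one counts the two points.\<close>

lemma osc_lipschitz:
  fixes g :: "real \<Rightarrow> 'b :: {banach, second_countable_topology}"
  assumes L: "\<And>x y. norm (g x - g y) \<le> L * \<bar>x - y\<bar>" and g: "\<And>x. x \<notin> {a..b} \<Longrightarrow> g x = 0"
  shows "(\<lambda>n. osc n g) \<longlonglongrightarrow> 0"
proof -
  let ?S = "{a..b}"
  have L0: "L \<ge> 0" using order_trans[OF norm_ge_zero L[of 1 0]] by simp
  have bound: "osc n g \<le> (ennreal L * (2 * (2 * emeasure \<mu> ?S))) * ennreal (\<epsilon> n)" for n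
  proof -
    let ?c = "\<lambda>x y. ennreal \<bar>T x - T y\<bar> * k n x y"
    have "osc n g \<le> (\<integral>\<^sup>+x. (\<integral>\<^sup>+y. ennreal L * (indicator ?S (T x) * ?c x y + indicator ?S (T y) * ?c x y) \<partial>\<mu>) \<partial>\<mu>)"
      unfolding osc_def
    proof (intro nn_integral_mono)
      fix x y
      have "ennreal (norm (g (T x) - g (T y))) \<le> ennreal L * (indicator ?S (T x) * ennreal \<bar>T x - T y\<bar> + indicator ?S (T y) * ennreal \<bar>T x - T y\<bar>)"
      proof (cases "T x \<in> ?S \<or> T y \<in> ?S")
        case True
        have "ennreal (norm (g (T x) - g (T y))) \<le> ennreal L * ennreal \<bar>T x - T y\<bar>"
          using L[of "T x" "T y"] L0 by (simp flip: ennreal_mult)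
        also have "\<dots> \<le> ennreal L * (indicator ?S (T x) * ennreal \<bar>T x - T y\<bar> + indicator ?S (T y) * ennreal \<bar>T x - T y\<bar>)"
          using True by (intro mult_left_mono) (auto simp: indicator_def)
        finally show ?thesis .
      next
        case False
        then have "g (T x) = 0" "g (T y) = 0" using g by auto
        then show ?thesis by simp
      qed
      from mult_right_mono[OF this, of "k n x y"]
      show "ennreal (norm (g (T x) - g (T y))) * k n x y \<le> ennreal L * (indicator ?S (T x) * ?c x y + indicator ?S (T y) * ?c x y)"
        by (simp add: distrib_right mult.assoc)
    qed
    also have "\<dots> = ennreal L * ((\<integral>\<^sup>+x. (\<integral>\<^sup>+y. indicator ?S (T x) * ?c x y \<partial>\<mu>) \<partial>\<mu>) + (\<integral>\<^sup>+x. (\<integral>\<^sup>+y. indicator ?S (T y) * ?c x y \<partial>\<mu>) \<partial>\<mu>))"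
      by (simp add: nn_integral_cmult nn_integral_add)
    finally have 1: "osc n g \<le> ennreal L * ((\<integral>\<^sup>+x. (\<integral>\<^sup>+y. indicator ?S (T x) * ?c x y \<partial>\<mu>) \<partial>\<mu>) + (\<integral>\<^sup>+x. (\<integral>\<^sup>+y. indicator ?S (T y) * ?c x y \<partial>\<mu>) \<partial>\<mu>))" .
    have "(\<integral>\<^sup>+x. (\<integral>\<^sup>+y. indicator ?S (T y) * ?c x y \<partial>\<mu>) \<partial>\<mu>) = (\<integral>\<^sup>+y. (\<integral>\<^sup>+x. indicator ?S (T y) * ?c x y \<partial>\<mu>) \<partial>\<mu>)"
      by (rule mu2.Fubini') measurable
    also have "\<dots> = (\<integral>\<^sup>+x. (\<integral>\<^sup>+y. indicator ?S (T x) * ?c x y \<partial>\<mu>) \<partial>\<mu>)"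
    proof -
      have "?c x y = ?c y x" for x y
        by (subst k_sym, subst abs_minus_commute) (rule refl)
      then show ?thesis by presburger
    qed
    finally have 2: "(\<integral>\<^sup>+x. (\<integral>\<^sup>+y. indicator ?S (T y) * ?c x y \<partial>\<mu>) \<partial>\<mu>) = (\<integral>\<^sup>+x. (\<integral>\<^sup>+y. indicator ?S (T x) * ?c x y \<partial>\<mu>) \<partial>\<mu>)" .
    have "(\<integral>\<^sup>+x. (\<integral>\<^sup>+y. indicator ?S (T x) * ?c x y \<partial>\<mu>) \<partial>\<mu>) = (\<integral>\<^sup>+x. indicator ?S (T x) * (\<integral>\<^sup>+y. ?c x y \<partial>\<mu>) \<partial>\<mu>)"
      by (intro nn_integral_cong nn_integral_cmult) measurable
    also have "\<dots> \<le> (\<integral>\<^sup>+x. indicator ?S (T x) * ennreal (\<epsilon> n) \<partial>\<mu>)"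
      by (intro nn_integral_mono mult_left_mono k_conc) simp
    also have "\<dots> = (\<integral>\<^sup>+x. indicator ?S (T x) \<partial>\<mu>) * ennreal (\<epsilon> n)"
      by (rule nn_integral_multc) measurable
    also have "\<dots> \<le> (2 * emeasure \<mu> ?S) * ennreal (\<epsilon> n)"
      using T_bound[of "indicator ?S"] by (intro mult_right_mono) auto
    finally have 3: "(\<integral>\<^sup>+x. (\<integral>\<^sup>+y. indicator ?S (T x) * ?c x y \<partial>\<mu>) \<partial>\<mu>) \<le> (2 * emeasure \<mu> ?S) * ennreal (\<epsilon> n)" .
    have "osc n g \<le> ennreal L * ((2 * emeasure \<mu> ?S) * ennreal (\<epsilon> n) + (2 * emeasure \<mu> ?S) * ennreal (\<epsilon> n))"
      using 1 unfolding 2 by (rule order_trans) (intro mult_left_mono add_mono 3, simp)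
    also have "\<dots> = (ennreal L * (2 * (2 * emeasure \<mu> ?S))) * ennreal (\<epsilon> n)"
      unfolding mult_2[symmetric] by (simp only: mult.assoc)
    finally show ?thesis .
  qed
  have "(\<lambda>n. (ennreal L * (2 * (2 * emeasure \<mu> ?S))) * ennreal (\<epsilon> n)) \<longlonglongrightarrow> (ennreal L * (2 * (2 * emeasure \<mu> ?S))) * ennreal 0"
    using emeasure_mu_bounded[of a b]
    by (intro ennreal_tendsto_cmult tendsto_ennrealI eps(1)) (auto simp: ennreal_mult_less_top)
  then show ?thesis
    by (intro tendsto_0_le_ennreal[OF _ bound]) simp
qed

lemma osc_compact:
  fixes c :: "'b :: {banach, second_countable_topology}"
  assumes "compact K"
  shows "(\<lambda>n. osc n (\<lambda>x. indicator K x *\<^sub>R c)) \<longlonglongrightarrow> 0"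
proof (cases "K = {}")
  case True
  then show ?thesis by (simp add: osc_def)
next
  case False
  have [measurable]: "K \<in> sets borel" using assms by (simp add: borel_compact)
  obtain M where M: "\<And>x. x \<in> K \<Longrightarrow> \<bar>x\<bar> \<le> M"
    using compact_imp_bounded[OF assms] by (auto simp: bounded_iff)
  \<comment> \<open>Lipschitz tents: 1 on \<open>K\<close>, zero beyond distance 1 from it, and
    decreasing to its indicator.\<close>
  define \<phi> where "\<phi> m x = max 0 (1 - real (Suc m) * infdist x K)" for m x
  have [measurable]: "\<phi> m \<in> borel_measurable borel" for m
    unfolding \<phi>_def by (intro borel_measurable_continuous_onI continuous_intros)
  have supp: "\<phi> m x = 0" if "x \<notin> {-(M+1)..M+1}" for m x
  proof -
    obtain z where z: "z \<in> K" "infdist x K = dist x z"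
      using infdist_attains_inf[of K x] False compact_imp_closed[OF assms] by auto
    then have "infdist x K \<ge> 1" using that M[OF z(1)] by (auto simp: dist_real_def)
    then have "real (Suc m) * infdist x K \<ge> 1"
      using mult_mono[of 1 "real (Suc m)" 1 "infdist x K"] by simp
    then show ?thesis by (simp add: \<phi>_def)
  qed
  have le1: "0 \<le> \<phi> m x" "\<phi> m x \<le> 1" for m x by (auto simp: \<phi>_def infdist_nonneg)
  have lip: "\<bar>\<phi> m x - \<phi> m y\<bar> \<le> real (Suc m) * \<bar>x - y\<bar>" for m x y
  proof -
    have "\<bar>\<phi> m x - \<phi> m y\<bar> \<le> \<bar>real (Suc m) * infdist x K - real (Suc m) * infdist y K\<bar>"
      by (auto simp: \<phi>_def max_def)
    also have "\<dots> = real (Suc m) * \<bar>infdist x K - infdist y K\<bar>"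
      by (simp add: abs_mult flip: right_diff_distrib)
    also have "\<dots> \<le> real (Suc m) * \<bar>x - y\<bar>"
      using infdist_triangle_abs[of x K y] by (intro mult_left_mono) (auto simp: dist_real_def)
    finally show ?thesis .
  qed
  show ?thesis
  proof (rule osc_lim[where g = "\<lambda>m x. \<phi> m x *\<^sub>R c"])
    show "(\<lambda>n. osc n (\<lambda>x. \<phi> m x *\<^sub>R c)) \<longlonglongrightarrow> 0" for m
    proof (rule osc_lipschitz)
      show "norm (\<phi> m x *\<^sub>R c - \<phi> m y *\<^sub>R c) \<le> (real (Suc m) * norm c) * \<bar>x - y\<bar>" for x y
        using mult_right_mono[OF lip[of m x y], of "norm c"]
        by (simp add: ac_simps flip: scaleR_diff_left)
      show "x \<notin> {-(M+1)..M+1} \<Longrightarrow> \<phi> m x *\<^sub>R c = 0" for x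
        using supp by simp
    qed
    show "(\<lambda>i. \<integral>\<^sup>+x. ennreal (norm (indicator K x *\<^sub>R c - \<phi> i x *\<^sub>R c)) \<partial>\<mu>) \<longlonglongrightarrow> 0"
    proof (rule nn_integral_dominated_convergence_norm[where w = "\<lambda>x. indicator {-(M+1)..M+1} x * norm c"])
      show "AE x in \<mu>. norm (\<phi> j x *\<^sub>R c) \<le> indicator {-(M+1)..M+1} x * norm c" for j
        using supp le1 by (intro AE_I2) (auto simp: indicator_def mult_right_le_one_le mult_left_le_one_le)
      show "(\<integral>\<^sup>+x. ennreal (indicator {-(M+1)..M+1} x * norm c) \<partial>\<mu>) < \<infinity>"
        using emeasure_mu_bounded[of "-(M+1)" "M+1"]
        by (simp add: ennreal_mult nn_integral_multc ennreal_indicator ennreal_mult_less_top)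
      show "AE x in \<mu>. (\<lambda>i. \<phi> i x *\<^sub>R c) \<longlonglongrightarrow> indicator K x *\<^sub>R c"
      proof (intro AE_I2 tendsto_intros)
        fix x
        show "(\<lambda>i. \<phi> i x) \<longlonglongrightarrow> indicator K x"
        proof (cases "x \<in> K")
          case True
          then show ?thesis by (simp add: \<phi>_def)
        next
          case False
          then have "infdist x K > 0"
            using infdist_pos_not_in_closed[of K x] \<open>K \<noteq> {}\<close> compact_imp_closed[OF assms] by simp
          then obtain N :: nat where N: "1 < real N * infdist x K"
            using reals_Archimedean3 by blast
          have "\<phi> i x = 0" if "i \<ge> N" for i
          proof -
            have "real N * infdist x K \<le> real (Suc i) * infdist x K"
              using that by (intro mult_right_mono infdist_nonneg) auto
            then show ?thesis using N by (simp add: \<phi>_def)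
          qed
          then have "\<forall>\<^sub>F i in sequentially. \<phi> i x = 0" by (auto simp: eventually_sequentially)
          then show ?thesis using False by (simp add: tendsto_eventually)
        qed
      qed
    qed simp_all
  qed auto
qed

text \<open>A density argument along \<open>integrable_induct\<close>: inner regularity leads from
  compact sets to all sets of finite measure, and \<open>osc_lim\<close> and additivity do the
  rest.\<close>

theorem osc_tendsto_0:
  fixes f :: "real \<Rightarrow> 'b :: {banach, second_countable_topology}"
  assumes "integrable \<mu> f"
  shows "(\<lambda>n. osc n f) \<longlonglongrightarrow> 0"
  using assms
proof (induction rule: integrable_induct)
  case (base A c)
  then have [measurable]: "A \<in> sets borel" by simp
  \<comment> \<open>The total mass of \<open>\<mu>\<close> is infinite; its restriction to
    \<open>A\<close> is the finite measure that inner regularity requires.\<close>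
  define M where "M = density \<mu> (indicator A)"
  have M: "emeasure M B = emeasure \<mu> (A \<inter> B)" if "B \<in> sets borel" for B
    unfolding M_def using that by (subst emeasure_density) (auto simp: nn_integral_set_ennreal indicator_inter_arith[symmetric])
  have "emeasure M A = (SUP K \<in> {K. K \<subseteq> A \<and> compact K}. emeasure M K)"
    using base by (intro inner_regular) (auto simp: M_def[THEN arg_cong[where f = sets]] M[of UNIV] M_def[THEN arg_cong[where f = space]])
  then have sup: "emeasure \<mu> A = (SUP K \<in> {K. K \<subseteq> A \<and> compact K}. emeasure M K)"
    by (simp add: M)
  have "\<exists>K. K \<subseteq> A \<and> compact K \<and> emeasure \<mu> (A - K) \<le> ennreal (1 / Suc i)" for i
  proof -
    have "\<exists>K\<in>{K. K \<subseteq> A \<and> compact K}. emeasure \<mu> A < emeasure M K + ennreal (1 / Suc i)"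
    proof (rule ccontr)
      assume "\<not> ?thesis"
      then have "emeasure M K + ennreal (1 / Suc i) \<le> emeasure \<mu> A" if "K \<in> {K. K \<subseteq> A \<and> compact K}" for K
        using that by (auto simp: not_less)
      then have "(SUP K \<in> {K. K \<subseteq> A \<and> compact K}. emeasure M K + ennreal (1 / Suc i)) \<le> emeasure \<mu> A"
        by (rule SUP_least)
      moreover have "(SUP K \<in> {K. K \<subseteq> A \<and> compact K}. emeasure M K + ennreal (1 / Suc i)) = emeasure \<mu> A + ennreal (1 / Suc i)"
        unfolding sup by (rule ennreal_SUP_add_left) auto
      ultimately have "emeasure \<mu> A + ennreal (1 / Suc i) \<le> emeasure \<mu> A" by simp
      moreover obtain r where "emeasure \<mu> A = ennreal r" "r \<ge> 0"
        using base by (cases "emeasure \<mu> A") auto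
      ultimately have "ennreal (r + 1 / Suc i) \<le> ennreal r" by (simp add: ennreal_plus)
      then show False using \<open>r \<ge> 0\<close> by (simp add: ennreal_le_iff)
    qed
    then obtain K where K: "K \<subseteq> A" "compact K" "emeasure \<mu> A < emeasure M K + ennreal (1 / Suc i)" by auto
    then have [measurable]: "K \<in> sets borel" by (simp add: borel_compact)
    have MK: "emeasure M K = emeasure \<mu> K" using K by (simp add: M Int_absorb1)
    have fin: "emeasure \<mu> K < \<infinity>"
      using base emeasure_mono[of K A \<mu>] K by (auto simp: less_top intro: le_less_trans)
    have "emeasure \<mu> (A - K) = emeasure \<mu> A - emeasure \<mu> K"
      using K fin by (intro emeasure_Diff) auto
    also have "\<dots> \<le> ennreal (1 / Suc i)"
      using K(3) fin unfolding MK by (intro ennreal_minus_le_iff[THEN iffD2]) (auto simp: less_imp_le)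
    finally show ?thesis using K by blast
  qed
  then obtain K where K: "\<And>i. K i \<subseteq> A" "\<And>i. compact (K i)" "\<And>i. emeasure \<mu> (A - K i) \<le> ennreal (1 / Suc i)"
    by metis
  then have [measurable]: "K i \<in> sets borel" for i by (simp add: borel_compact)
  show ?case
  proof (rule osc_lim[where g = "\<lambda>i x. indicator (K i) x *\<^sub>R c"])
    show "(\<lambda>n. osc n (\<lambda>x. indicator (K i) x *\<^sub>R c)) \<longlonglongrightarrow> 0" for i
      by (rule osc_compact[OF K(2)])
    have "(\<integral>\<^sup>+x. ennreal (norm (indicator A x *\<^sub>R c - indicator (K i) x *\<^sub>R c)) \<partial>\<mu>) \<le> ennreal (norm c) * ennreal (1 / Suc i)" for i
    proof -
      have "ennreal (norm (indicator A x *\<^sub>R c - indicator (K i) x *\<^sub>R c)) = indicator (A - K i) x * ennreal (norm c)" for x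
        using K(1)[of i] by (auto simp: indicator_def)
      then have "(\<integral>\<^sup>+x. ennreal (norm (indicator A x *\<^sub>R c - indicator (K i) x *\<^sub>R c)) \<partial>\<mu>) = emeasure \<mu> (A - K i) * ennreal (norm c)"
        by (simp add: nn_integral_multc)
      then show ?thesis using K(3)[of i] by (simp add: mult_left_mono mult.commute)
    qed
    moreover have "(\<lambda>i. ennreal (norm c) * ennreal (1 / Suc i)) \<longlonglongrightarrow> ennreal (norm c) * ennreal 0"
      by (rule ennreal_tendsto_cmult, simp, rule tendsto_ennrealI, rule LIMSEQ_Suc[OF lim_1_over_n])
    ultimately show "(\<lambda>i. \<integral>\<^sup>+x. ennreal (norm (indicator A x *\<^sub>R c - indicator (K i) x *\<^sub>R c)) \<partial>\<mu>) \<longlonglongrightarrow> 0"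
      by (auto intro: tendsto_0_le_ennreal)
  qed auto
next
  case (add f g)
  have [measurable]: "f \<in> borel_measurable borel" "g \<in> borel_measurable borel"
    using add.hyps[THEN borel_measurable_integrable] by simp_all
  have "(\<lambda>n. osc n f + osc n g) \<longlonglongrightarrow> 0 + 0"
    using add by (intro tendsto_add) auto
  then show ?case
    by (intro tendsto_0_le_ennreal[OF _ osc_add]) simp_all
next
  case (lim f s)
  have [measurable]: "f \<in> borel_measurable borel" "s i \<in> borel_measurable borel" for i
    using \<open>integrable \<mu> f\<close>[THEN borel_measurable_integrable] lim.hyps(1)[THEN borel_measurable_integrable, of i]
    by simp_all
  show ?case
  proof (rule osc_lim[where g = s])
    show "(\<lambda>i. \<integral>\<^sup>+x. ennreal (norm (f x - s i x)) \<partial>\<mu>) \<longlonglongrightarrow> 0"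
      using lim by (intro nn_integral_dominated_convergence_norm[where w = "\<lambda>x. 2 * norm (f x)"])
        (auto simp: integrable_iff_bounded ennreal_mult nn_integral_cmult ennreal_mult_less_top)
  qed (use lim in auto)
qed

end

section \<open>The heat kernel\<close>

context concentrating_kernel begin

text \<open>\<open>f\<close> is split at height M. The bounded part oscillates by at most 2 M, which
  reduces its square to the L1 oscillation; the rest is small in L2, uniformly in
  \<open>n\<close>.\<close>

lemma osc_sq_tendsto_0:
  fixes f :: "real \<Rightarrow> 'b :: {banach, second_countable_topology}"
  assumes "integrable \<mu> f" and fin: "(\<integral>\<^sup>+x. ennreal ((norm (f x))\<^sup>2) \<partial>\<mu>) < \<infinity>"
  shows "(\<lambda>n. \<integral>\<^sup>+x. (\<integral>\<^sup>+y. ennreal ((norm (f (T x) - f (T y)))\<^sup>2) * k n x y \<partial>\<mu>) \<partial>\<mu>) \<longlonglongrightarrow> 0"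
proof (rule order_tendstoI)
  fix e :: ennreal assume e: "0 < e"
  have [measurable]: "f \<in> borel_measurable borel"
    using assms(1)[THEN borel_measurable_integrable] by simp
  obtain e' where e': "e' > 0" "e' + e' < e" using ennreal_halve[OF e] by blast
  define g where "g M x = indicator {x. norm (f x) \<le> M} x *\<^sub>R f x" for M x
  have [measurable]: "g M \<in> borel_measurable borel" for M unfolding g_def by measurable
  define h where "h M x = f x - g M x" for M x
  have [measurable]: "h M \<in> borel_measurable borel" for M unfolding h_def by measurable
  have "(\<lambda>M::nat. \<integral>\<^sup>+x. ennreal ((norm (h (real M) x))\<^sup>2) \<partial>\<mu>) \<longlonglongrightarrow> (\<integral>\<^sup>+x. 0 \<partial>\<mu>)"
  proof (rule nn_integral_dominated_convergence[where w = "\<lambda>x. ennreal ((norm (f x))\<^sup>2)"])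
    show "AE x in \<mu>. ennreal ((norm (h (real M) x))\<^sup>2) \<le> ennreal ((norm (f x))\<^sup>2)" for M
      by (intro AE_I2) (auto simp: h_def g_def indicator_def)
    show "AE x in \<mu>. (\<lambda>M. ennreal ((norm (h (real M) x))\<^sup>2)) \<longlonglongrightarrow> 0"
    proof (intro AE_I2 tendsto_eventually)
      fix x
      obtain N :: nat where "norm (f x) \<le> real N" using real_arch_simple by blast
      then have "h (real M) x = 0" if "M \<ge> N" for M
        using that by (auto simp: h_def g_def indicator_def)
      then show "\<forall>\<^sub>F M in sequentially. ennreal ((norm (h (real M) x))\<^sup>2) = 0"
        by (intro eventually_sequentiallyI[of N]) simp
    qed
  qed (use fin in auto)
  then have "(\<lambda>M::nat. 16 * (\<integral>\<^sup>+x. ennreal ((norm (h (real M) x))\<^sup>2) \<partial>\<mu>)) \<longlonglongrightarrow> 16 * 0"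
    by (intro ennreal_tendsto_cmult) simp_all
  then have "\<forall>\<^sub>F M::nat in sequentially. 16 * (\<integral>\<^sup>+x. ennreal ((norm (h (real M) x))\<^sup>2) \<partial>\<mu>) < e'"
    using e' by (intro order_tendstoD) auto
  then obtain M :: nat where M: "16 * (\<integral>\<^sup>+x. ennreal ((norm (h (real M) x))\<^sup>2) \<partial>\<mu>) < e'"
    by (auto simp: eventually_sequentially)
  let ?M = "real M"
  have "integrable \<mu> (g ?M)"
    by (rule Bochner_Integration.integrable_bound[OF assms(1)]) (auto simp: g_def indicator_def)
  then have "(\<lambda>n. osc n (g ?M)) \<longlonglongrightarrow> 0" by (rule osc_tendsto_0)
  then have "(\<lambda>n. ennreal (4 * ?M) * osc n (g ?M)) \<longlonglongrightarrow> ennreal (4 * ?M) * 0"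
    by (intro ennreal_tendsto_cmult) simp_all
  then have "\<forall>\<^sub>F n in sequentially. ennreal (4 * ?M) * osc n (g ?M) < e'"
    using e' by (intro order_tendstoD) auto
  then show "\<forall>\<^sub>F n in sequentially. (\<integral>\<^sup>+x. (\<integral>\<^sup>+y. ennreal ((norm (f (T x) - f (T y)))\<^sup>2) * k n x y \<partial>\<mu>) \<partial>\<mu>) < e"
  proof eventually_elim
    fix n assume n: "ennreal (4 * ?M) * osc n (g ?M) < e'"
    let ?u = "\<lambda>x. ennreal ((norm (h ?M x))\<^sup>2)"
    \<comment> \<open>From (G + A + B)^2 <= 2 G^2 + 4 (A^2 + B^2) and G <= 2 M. The 16 in the choice
      of M is this 4 times the 4 of \<open>kernel_sum_le\<close>.\<close>
    have ptw: "(norm (f a - f b))\<^sup>2 \<le> 4 * ?M * norm (g ?M a - g ?M b) + 4 * ((norm (h ?M a))\<^sup>2 + (norm (h ?M b))\<^sup>2)" for a b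
    proof -
      let ?G = "norm (g ?M a - g ?M b)" and ?A = "norm (h ?M a)" and ?B = "norm (h ?M b)"
      have "f a - f b = (g ?M a - g ?M b) + (h ?M a - h ?M b)" by (simp add: h_def)
      then have "norm (f a - f b) \<le> ?G + norm (h ?M a - h ?M b)"
        using norm_triangle_ineq[of "g ?M a - g ?M b" "h ?M a - h ?M b"] by simp
      then have "norm (f a - f b) \<le> ?G + (?A + ?B)"
        using norm_triangle_ineq4[of "h ?M a" "h ?M b"] by linarith
      then have "(norm (f a - f b))\<^sup>2 \<le> (?G + (?A + ?B))\<^sup>2" by (intro power_mono) auto
      also have "\<dots> \<le> 2 * ?G\<^sup>2 + 2 * (?A + ?B)\<^sup>2"
        using sum_squares_bound[of ?G "?A + ?B"] by (simp add: power2_sum)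
      also have "(?A + ?B)\<^sup>2 \<le> 2 * ?A\<^sup>2 + 2 * ?B\<^sup>2"
        using sum_squares_bound[of ?A ?B] by (simp add: power2_sum)
      also have "?G\<^sup>2 \<le> 2 * ?M * ?G"
      proof -
        have "norm (g ?M a) \<le> ?M" "norm (g ?M b) \<le> ?M" by (auto simp: g_def indicator_def)
        then have "?G \<le> 2 * ?M" using norm_triangle_ineq4[of "g ?M a" "g ?M b"] by linarith
        then show ?thesis by (simp add: power2_eq_square mult_right_mono)
      qed
      finally show ?thesis by simp
    qed
    have "(\<integral>\<^sup>+x. (\<integral>\<^sup>+y. ennreal ((norm (f (T x) - f (T y)))\<^sup>2) * k n x y \<partial>\<mu>) \<partial>\<mu>) \<le>
      (\<integral>\<^sup>+x. (\<integral>\<^sup>+y. ennreal (4 * ?M) * (ennreal (norm (g ?M (T x) - g ?M (T y))) * k n x y) + 4 * ((?u (T x) + ?u (T y)) * k n x y) \<partial>\<mu>) \<partial>\<mu>)"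
    proof (intro nn_integral_mono)
      fix x y
      have "ennreal ((norm (f (T x) - f (T y)))\<^sup>2) \<le> ennreal (4 * ?M * norm (g ?M (T x) - g ?M (T y)) + 4 * ((norm (h ?M (T x)))\<^sup>2 + (norm (h ?M (T y)))\<^sup>2))"
        by (intro ennreal_leI ptw)
      also have "\<dots> = ennreal (4 * ?M) * ennreal (norm (g ?M (T x) - g ?M (T y))) + 4 * (?u (T x) + ?u (T y))"
        by (simp add: ennreal_plus ennreal_mult)
      finally show "ennreal ((norm (f (T x) - f (T y)))\<^sup>2) * k n x y \<le>
        ennreal (4 * ?M) * (ennreal (norm (g ?M (T x) - g ?M (T y))) * k n x y) + 4 * ((?u (T x) + ?u (T y)) * k n x y)"
        unfolding mult.assoc[symmetric] distrib_right[symmetric] by (rule mult_right_mono) simp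
    qed
    also have "\<dots> = ennreal (4 * ?M) * osc n (g ?M) + 4 * (\<integral>\<^sup>+x. (\<integral>\<^sup>+y. (?u (T x) + ?u (T y)) * k n x y \<partial>\<mu>) \<partial>\<mu>)"
      unfolding osc_def by (simp add: nn_integral_add nn_integral_cmult)
    also have "\<dots> \<le> ennreal (4 * ?M) * osc n (g ?M) + 4 * (4 * (\<integral>\<^sup>+x. ?u x \<partial>\<mu>))"
      by (intro add_left_mono mult_left_mono kernel_sum_le) auto
    also have "\<dots> = ennreal (4 * ?M) * osc n (g ?M) + 16 * (\<integral>\<^sup>+x. ?u x \<partial>\<mu>)"
      by (simp flip: mult.assoc)
    also have "\<dots> \<le> e' + e'" using M n by (intro add_mono) auto
    also have "\<dots> < e" by (rule e')
    finally show "(\<integral>\<^sup>+x. (\<integral>\<^sup>+y. ennreal ((norm (f (T x) - f (T y)))\<^sup>2) * k n x y \<partial>\<mu>) \<partial>\<mu>) < e" .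
  qed
qed simp

end

section \<open>Moments and concentration of the heat kernel\<close>

context dunkl begin

text \<open>The Dunkl heat kernel at time 1 / (2 s), taken with respect to \<open>\<mu>\<close>; it
  concentrates as \<open>s\<close> grows.\<close>

definition heat :: "real \<Rightarrow> real \<Rightarrow> real \<Rightarrow> real" where
  "heat s x y = s powr (\<kappa> + 1) * exp (- (s * (x\<^sup>2 + y\<^sup>2) / 2)) * Er (s * x * y)"

lemma measurable_heat [measurable (raw)]:
  assumes [measurable]: "f \<in> borel_measurable M" "g \<in> borel_measurable M"
  shows "(\<lambda>z. heat s (f z) (g z)) \<in> borel_measurable M"
  unfolding heat_def by measurable

lemma heat_nonneg [simp]: "0 \<le> heat s x y"
  by (simp add: heat_def)

lemma heat_sym: "heat s x y = heat s y x"
  by (simp add: heat_def add.commute ac_simps)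

lemma dgm_real_moment:
  assumes s: "s > 0"
  shows "has_bochner_integral \<mu> (\<lambda>y. y ^ k * (gauss s y * Er (c * y))) (Re (dgm s (of_real c) k))"
proof -
  have "integrable \<mu> (\<lambda>y. gauss s y *\<^sub>R (of_real y ^ k * E (of_real c * of_real y)))"
    by (rule integrable_dgm[OF s])
  then have 1: "has_bochner_integral \<mu> (\<lambda>y. Re (gauss s y *\<^sub>R (of_real y ^ k * E (of_real c * of_real y)))) (Re (dgm s (of_real c) k))"
    unfolding dgm_def by (intro has_bochner_integral_Re has_bochner_integral_integrable)
  have eq: "Re (gauss s y *\<^sub>R (of_real y ^ k * E (of_real c * of_real y))) = y ^ k * (gauss s y * Er (c * y))" for y
    by (simp add: Er_dkernel flip: of_real_mult of_real_power)
  show ?thesis using 1 unfolding eq .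
qed

text \<open>As a function of \<open>y\<close> the kernel is a Gaussian of parameter 1 / s times
  \<open>Er (s * x * y)\<close>, so its moments are values of \<open>dgm\<close>, and
  \<open>dgm_Suc\<close> derives them from the total mass.\<close>

lemma heat_moments:
  assumes s: "s > 0"
  shows "has_bochner_integral \<mu> (\<lambda>y. heat s x y) 1"
    and "has_bochner_integral \<mu> (\<lambda>y. y * heat s x y) x"
    and "has_bochner_integral \<mu> (\<lambda>y. y\<^sup>2 * heat s x y) (x\<^sup>2 + (2 * \<kappa> + 2) / s)"
proof -
  define \<sigma> where "\<sigma> = 1 / s"
  have \<sigma>: "\<sigma> > 0" using s by (simp add: \<sigma>_def)
  let ?d = "dgm \<sigma> (of_real (s * x))"
  \<comment> \<open>The factor free of \<open>y\<close>; \<open>d0\<close> shows that it is exactly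
    the normalising one.\<close>
  define K where "K = s powr (\<kappa> + 1) * exp (- (s * x\<^sup>2 / 2))"
  have heq: "heat s x y = K * (gauss \<sigma> y * Er (s * x * y))" for y
    using s by (simp add: heat_def gauss_def K_def \<sigma>_def exp_add[symmetric] field_simps)
  have d0: "?d 0 = of_real (1 / K)"
  proof -
    have eq: "of_real \<sigma> * (of_real (s * x))\<^sup>2 / 2 = complex_of_real (s * x\<^sup>2 / 2)"
      using s by (simp add: \<sigma>_def power2_eq_square field_simps)
    have "?d 0 = of_real (\<sigma> powr (\<kappa> + 1) * exp (s * x\<^sup>2 / 2))"
      unfolding dgm_0[OF \<sigma>] eq by (simp only: exp_of_real of_real_mult)
    also have "\<sigma> powr (\<kappa> + 1) * exp (s * x\<^sup>2 / 2) = 1 / K"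
      using s by (simp add: K_def \<sigma>_def powr_divide exp_minus field_simps)
    finally show ?thesis .
  qed
  have \<sigma>s: "complex_of_real \<sigma> * of_real s = 1" using s by (simp add: \<sigma>_def flip: of_real_mult)
  have K: "K > 0" using s by (simp add: K_def)
  have d1: "?d 1 = of_real (x / K)"
    using dgm_Suc[OF \<sigma>, of "of_real (s * x)" 0] s d0 by (simp add: \<sigma>_def)
  have "?d 2 = of_real \<sigma> * (of_real (dth 1) * ?d 0 + of_real (s * x) * ?d 1)"
    using dgm_Suc[OF \<sigma>, of "of_real (s * x)" 1] by (simp add: numeral_2_eq_2)
  also have "\<dots> = of_real ((x\<^sup>2 + (2 * \<kappa> + 2) / s) / K)"
  proof -
    have "\<sigma> * ((2 * \<kappa> + 2) * (1 / K) + (s * x) * (x / K)) = (x\<^sup>2 + (2 * \<kappa> + 2) / s) / K"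
    proof -
      have "\<sigma> * ((2 * \<kappa> + 2) * (1 / K) + (s * x) * (x / K)) = (\<sigma> * (2 * \<kappa> + 2) + (\<sigma> * s) * x\<^sup>2) / K"
        by (simp add: add_divide_distrib distrib_left power2_eq_square mult.assoc)
      also have "\<sigma> * s = 1" using s by (simp add: \<sigma>_def)
      also have "\<sigma> * (2 * \<kappa> + 2) = (2 * \<kappa> + 2) / s" by (simp add: \<sigma>_def)
      finally show ?thesis by (simp add: add.commute)
    qed
    then show ?thesis
      unfolding d0 d1 dth_1 by (simp only: of_real_mult[symmetric] of_real_add[symmetric])
  qed
  finally have d2: "?d 2 = of_real ((x\<^sup>2 + (2 * \<kappa> + 2) / s) / K)" .
  have mom: "has_bochner_integral \<mu> (\<lambda>y. y ^ k * heat s x y) (K * Re (?d k))" for k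
  proof -
    have "has_bochner_integral \<mu> (\<lambda>y. K * (y ^ k * (gauss \<sigma> y * Er (s * x * y)))) (K * Re (?d k))"
      by (intro has_bochner_integral_mult_right dgm_real_moment \<sigma>)
    then show ?thesis unfolding heq by (simp add: ac_simps)
  qed
  show "has_bochner_integral \<mu> (\<lambda>y. heat s x y) 1"
    using mom[of 0] K unfolding d0 by simp
  show "has_bochner_integral \<mu> (\<lambda>y. y * heat s x y) x"
    using mom[of 1] K unfolding d1 by simp
  show "has_bochner_integral \<mu> (\<lambda>y. y\<^sup>2 * heat s x y) (x\<^sup>2 + (2 * \<kappa> + 2) / s)"
    using mom[of 2] K unfolding d2 by simp
qed

lemma heat_mass: "s > 0 \<Longrightarrow> (\<integral>\<^sup>+y. ennreal (heat s x y) \<partial>\<mu>) = 1"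
  using heat_moments(1)[of s x] by (subst nn_integral_eq_integral) (auto simp: has_bochner_integral_iff)

text \<open>The second moment about \<open>x\<close> is \<open>(2 * \<kappa> + 2) / s\<close>. The
  first follows from d <= (r d^2 + 1 / r) / 2, where r = \<open>sqrt s\<close> gives both terms the
  same order in \<open>s\<close>.\<close>

lemma heat_conc:
  assumes s: "s > 0"
  shows "(\<integral>\<^sup>+y. ennreal \<bar>x - y\<bar> * ennreal (heat s x y) \<partial>\<mu>) \<le> ennreal ((2 * \<kappa> + 3) / (2 * sqrt s))"
proof -
  let ?r = "sqrt s"
  have r: "?r > 0" "?r * ?r = s" using s by auto
  note m = heat_moments[OF s, of x]
  have "has_bochner_integral \<mu> (\<lambda>y. x\<^sup>2 * heat s x y - 2 * x * (y * heat s x y) + y\<^sup>2 * heat s x y) (x\<^sup>2 * 1 - 2 * x * x + (x\<^sup>2 + (2 * \<kappa> + 2) / s))"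
    by (intro has_bochner_integral_add has_bochner_integral_diff has_bochner_integral_mult_right m)
  then have "has_bochner_integral \<mu> (\<lambda>y. (x - y)\<^sup>2 * heat s x y) ((2 * \<kappa> + 2) / s)"
    by (simp add: power2_eq_square algebra_simps)
  then have "has_bochner_integral \<mu> (\<lambda>y. ?r / 2 * ((x - y)\<^sup>2 * heat s x y) + 1 / (2 * ?r) * heat s x y)
      (?r / 2 * ((2 * \<kappa> + 2) / s) + 1 / (2 * ?r) * 1)"
    by (intro has_bochner_integral_add has_bochner_integral_mult_right m)
  moreover have "?r / 2 * ((2 * \<kappa> + 2) / s) + 1 / (2 * ?r) * 1 = (2 * \<kappa> + 3) / (2 * ?r)"
  proof -
    have "\<rho> / 2 * ((2 * \<kappa> + 2) / (\<rho> * \<rho>)) + 1 / (2 * \<rho>) * 1 = (2 * \<kappa> + 3) / (2 * \<rho>)" if "\<rho> > 0" for \<rho>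
      using that by (simp add: field_simps)
    from this[OF r(1)] show ?thesis unfolding r(2) .
  qed
  ultimately have h: "has_bochner_integral \<mu> (\<lambda>y. ?r / 2 * ((x - y)\<^sup>2 * heat s x y) + 1 / (2 * ?r) * heat s x y) ((2 * \<kappa> + 3) / (2 * ?r))"
    by simp
  have "(\<integral>\<^sup>+y. ennreal \<bar>x - y\<bar> * ennreal (heat s x y) \<partial>\<mu>) \<le> (\<integral>\<^sup>+y. ennreal (?r / 2 * ((x - y)\<^sup>2 * heat s x y) + 1 / (2 * ?r) * heat s x y) \<partial>\<mu>)"
  proof (intro nn_integral_mono)
    fix y
    have "\<bar>x - y\<bar> \<le> ?r / 2 * (x - y)\<^sup>2 + 1 / (2 * ?r)"
    proof -
      have "0 \<le> (?r * \<bar>x - y\<bar> - 1)\<^sup>2" by simp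
      also have "\<dots> = ?r\<^sup>2 * (x - y)\<^sup>2 - 2 * ?r * \<bar>x - y\<bar> + 1"
        by (simp add: power2_diff power_mult_distrib)
      finally have "2 * ?r * \<bar>x - y\<bar> \<le> ?r\<^sup>2 * (x - y)\<^sup>2 + 1" by simp
      then have "\<bar>x - y\<bar> \<le> (?r\<^sup>2 * (x - y)\<^sup>2 + 1) / (2 * ?r)"
        using r by (subst pos_le_divide_eq) (auto simp: ac_simps)
      also have "\<dots> = ?r / 2 * (x - y)\<^sup>2 + 1 / (2 * ?r)"
        using r(1) by (simp add: add_divide_distrib power2_eq_square[of ?r] del: real_sqrt_mult_self)
      finally show ?thesis .
    qed
    from mult_right_mono[OF this, of "heat s x y"]
    have "ennreal (\<bar>x - y\<bar> * heat s x y) \<le> ennreal (?r / 2 * ((x - y)\<^sup>2 * heat s x y) + 1 / (2 * ?r) * heat s x y)"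
      by (intro ennreal_leI) (simp add: distrib_right mult.assoc)
    then show "ennreal \<bar>x - y\<bar> * ennreal (heat s x y) \<le> ennreal (?r / 2 * ((x - y)\<^sup>2 * heat s x y) + 1 / (2 * ?r) * heat s x y)"
      by (simp only: ennreal_mult[OF abs_ge_zero heat_nonneg])
  qed
  also have "\<dots> = ennreal ((2 * \<kappa> + 3) / (2 * ?r))"
    using h r by (subst nn_integral_eq_integral) (auto simp: has_bochner_integral_iff)
  finally show ?thesis .
qed

sublocale heat: concentrating_kernel \<kappa> "\<lambda>x. x" "\<lambda>n x y. ennreal (heat (real (Suc n)) x y)" "\<lambda>n. (2 * \<kappa> + 3) / (2 * sqrt (real (Suc n)))"
proof
  show "(\<lambda>n. (2 * \<kappa> + 3) / (2 * sqrt (real (Suc n)))) \<longlonglongrightarrow> 0"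
    by real_asymp
  show "(\<integral>\<^sup>+y. ennreal (heat (real (Suc n)) x y) \<partial>\<mu>) \<le> 1" for n x
    by (subst heat_mass) auto
  show "ennreal (heat (real (Suc n)) x y) = ennreal (heat (real (Suc n)) y x)" for n x y
    by (simp add: heat_sym)
  show "(\<integral>\<^sup>+y. ennreal \<bar>x - y\<bar> * ennreal (heat (real (Suc n)) x y) \<partial>\<mu>) \<le> ennreal ((2 * \<kappa> + 3) / (2 * sqrt (real (Suc n))))" for n x
    by (rule heat_conc) simp
  show "(\<integral>\<^sup>+ x. u x \<partial>\<mu>) \<le> 2 * (\<integral>\<^sup>+ x. u x \<partial>\<mu>)" if "u \<in> borel_measurable borel" for u
    by (simp add: mult_2 add_increasing)
  show "0 \<le> (2 * \<kappa> + 3) / (2 * sqrt (real (Suc n)))" for n using kappa by simp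
qed auto

text \<open>For \<open>T\<close> the identity this rule applies to every goal of the measurability prover.\<close>

declare heat.T_measurable [measurable del]

text \<open>Weber's formula at a = - i x and b = i y: the squares turn the exponential into a
  decaying one, and the product makes the argument of the kernel real.\<close>

lemma heat_spectral:
  assumes s: "s > 0"
  shows "(LINT l|\<mu>. gauss s l *\<^sub>R (E (- \<i> * of_real l * of_real x) * E (\<i> * of_real l * of_real y))) = of_real (heat s x y)"
proof -
  have "(LINT l|\<mu>. gauss s l *\<^sub>R (E (- \<i> * of_real l * of_real x) * E (\<i> * of_real l * of_real y))) =
     (LINT l|\<mu>. gauss s l *\<^sub>R (E ((- \<i> * of_real x) * of_real l) * E ((\<i> * of_real y) * of_real l)))"
    by (simp add: ac_simps)
  also have "\<dots> = of_real (s powr (\<kappa> + 1)) * exp (of_real s * ((- \<i> * of_real x)\<^sup>2 + (\<i> * of_real y)\<^sup>2) / 2) * E (of_real s * (- \<i> * of_real x) * (\<i> * of_real y))"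
    by (rule gauss_product_integral[OF s])
  also have "of_real s * ((- \<i> * of_real x)\<^sup>2 + (\<i> * of_real y)\<^sup>2) / 2 = complex_of_real (- (s * (x\<^sup>2 + y\<^sup>2) / 2))"
    by (simp add: power_mult_distrib algebra_simps)
  also have "of_real s * (- \<i> * of_real x) * (\<i> * of_real y) = complex_of_real (s * x * y)"
    by (simp add: algebra_simps)
  also have "of_real (s powr (\<kappa> + 1)) * exp (complex_of_real (- (s * (x\<^sup>2 + y\<^sup>2) / 2))) * E (complex_of_real (s * x * y)) = of_real (heat s x y)"
    unfolding Er_dkernel exp_of_real heat_def by simp
  finally show ?thesis .
qed

end

section \<open>The Plancherel theorem\<close>

lemma measurable_cnj [measurable]: "cnj \<in> borel_measurable borel"
  by (intro borel_measurable_continuous_onI continuous_intros)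

section \<open>Products in separated variables\<close>

context pair_sigma_finite begin

lemma integrable_product:
  fixes u v :: "_ \<Rightarrow> 'c :: {real_normed_field, banach, second_countable_topology}"
  assumes "integrable M1 u" "integrable M2 v"
  shows "integrable (M1 \<Otimes>\<^sub>M M2) (\<lambda>z. u (fst z) * v (snd z))"
proof -
  have [measurable]: "u \<in> borel_measurable M1" "v \<in> borel_measurable M2"
    using assms by auto
  show ?thesis
    by (rule Fubini_integrable)
       (auto simp: norm_mult intro!: integrable_mult_right integrable_mult_left integrable_norm assms)
qed

lemma integral_product:
  fixes u v :: "_ \<Rightarrow> 'c :: {real_normed_field, banach, second_countable_topology}"
  assumes "integrable M1 u" "integrable M2 v"
  shows "(LINT z|(M1 \<Otimes>\<^sub>M M2). u (fst z) * v (snd z)) = (LINT x|M1. u x) * (LINT y|M2. v y)"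
  by (subst integral_fst'[symmetric]) (simp_all add: integrable_product assms)

end

section \<open>The transform of integrable functions\<close>

context dunkl begin

abbreviation D :: "(real \<Rightarrow> complex) \<Rightarrow> real \<Rightarrow> complex" where "D \<equiv> dunkl_transform_L1 \<kappa>"

text \<open>The squared norm: without the root, the triangle inequality is replaced by one with
  constants 2.\<close>

definition N2 :: "(real \<Rightarrow> complex) \<Rightarrow> ennreal" where
  "N2 f = (\<integral>\<^sup>+x. ennreal ((cmod (f x))\<^sup>2) \<partial>\<mu>)"

lemma measurable_integrable_mu: "integrable \<mu> f \<Longrightarrow> f \<in> borel_measurable borel"
  using borel_measurable_integrable[of \<mu> f] by simp

lemma D_measurable [measurable]:
  assumes "f \<in> borel_measurable borel"
  shows "D f \<in> borel_measurable borel"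
proof -
  have [measurable]: "f \<in> borel_measurable borel" by fact
  show ?thesis unfolding dunkl_transform_L1_def by measurable
qed

lemma norm_dkernel_real [simp]: "norm (E (- \<i> * of_real l * of_real x)) \<le> 1" "norm (E (\<i> * of_real l * of_real x)) \<le> 1"
  by (rule norm_dkernel_imag; simp)+

lemma D_integrable:
  assumes "integrable \<mu> f"
  shows "integrable \<mu> (\<lambda>x. E (- \<i> * of_real l * of_real x) * f x)"
proof (rule Bochner_Integration.integrable_bound[OF assms])
  have [measurable]: "f \<in> borel_measurable borel" by (rule measurable_integrable_mu[OF assms])
  show "(\<lambda>x. E (- \<i> * of_real l * of_real x) * f x) \<in> borel_measurable \<mu>" by simp
  show "AE x in \<mu>. norm (E (- \<i> * of_real l * of_real x) * f x) \<le> norm (f x)"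
    unfolding norm_mult using norm_dkernel_real by (intro AE_I2 mult_left_le_one_le) auto
qed

lemma cnj_D: "cnj (D f l) = (LINT x|\<mu>. E (\<i> * of_real l * of_real x) * cnj (f x))"
proof -
  have "E (\<i> * of_real l * of_real x) * cnj (f x) = cnj (E (- \<i> * of_real l * of_real x) * f x)" for x
    by (simp flip: dkernel_cnj)
  then show ?thesis
    unfolding dunkl_transform_L1_def by (simp only: Bochner_Integration.integral_cnj)
qed

text \<open>The Gaussian makes the triple integral over frequency and two points absolutely
  convergent, so that its two iterated forms agree.\<close>

lemma plancherel_gauss:
  assumes s: "s > 0" and f: "integrable \<mu> f"
  shows "has_bochner_integral \<mu> (\<lambda>l. gauss s l * (cmod (D f l))\<^sup>2)
     (LINT z|(\<mu> \<Otimes>\<^sub>M \<mu>). heat s (fst z) (snd z) * Re (f (fst z) * cnj (f (snd z))))"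
proof -
  interpret P: pair_sigma_finite \<mu> "\<mu> \<Otimes>\<^sub>M \<mu>"
    by (intro pair_sigma_finite.intro mu.sigma_finite_measure_axioms mu2.P.sigma_finite_measure_axioms)
  have [measurable]: "f \<in> borel_measurable borel" by (rule measurable_integrable_mu[OF f])
  define F where "F z = f (fst z) * cnj (f (snd z))" for z
  have F: "integrable (\<mu> \<Otimes>\<^sub>M \<mu>) F"
    unfolding F_def by (rule mu2.integrable_product) (use f in auto)
  define H where "H l z = gauss s l *\<^sub>R (E (- \<i> * of_real l * of_real (fst z)) * E (\<i> * of_real l * of_real (snd z)) * F z)" for l z
  have [measurable]: "F \<in> borel_measurable (borel \<Otimes>\<^sub>M borel)" unfolding F_def by measurable
  have intH: "integrable (\<mu> \<Otimes>\<^sub>M (\<mu> \<Otimes>\<^sub>M \<mu>)) (\<lambda>(l, z). H l z)"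
  proof (rule Bochner_Integration.integrable_bound)
    show "integrable (\<mu> \<Otimes>\<^sub>M (\<mu> \<Otimes>\<^sub>M \<mu>)) (\<lambda>z. gauss s (fst z) * norm (F (snd z)))"
      by (intro P.integrable_product integrable_gauss s integrable_norm F)
    show "AE z in \<mu> \<Otimes>\<^sub>M (\<mu> \<Otimes>\<^sub>M \<mu>). norm (case z of (l, z) \<Rightarrow> H l z) \<le> norm (gauss s (fst z) * norm (F (snd z)))"
    proof (intro AE_I2, clarify)
      fix l x y
      have "norm (E (- \<i> * of_real l * of_real x) * E (\<i> * of_real l * of_real y)) \<le> 1 * 1"
        unfolding norm_mult by (intro mult_mono norm_dkernel_real) auto
      from mult_right_mono[OF this, of "norm (F (x, y))"]
      show "norm (H l (x, y)) \<le> norm (gauss s (fst (l, x, y)) * norm (F (snd (l, x, y))))"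
        unfolding H_def by (simp add: norm_mult[symmetric] mult_left_mono)
    qed
    show "(\<lambda>(l, z). H l z) \<in> borel_measurable (\<mu> \<Otimes>\<^sub>M (\<mu> \<Otimes>\<^sub>M \<mu>))"
      unfolding H_def by measurable
  qed
  \<comment> \<open>Integrating over the pair of points first separates the variables and produces
    \<open>(cmod (D f l))\<^sup>2\<close>; \<open>outer\<close> integrates over the frequency first
    and produces the heat kernel.\<close>
  have inner: "(LINT z|(\<mu> \<Otimes>\<^sub>M \<mu>). H l z) = of_real (gauss s l * (cmod (D f l))\<^sup>2)" for l
  proof -
    have "(LINT z|(\<mu> \<Otimes>\<^sub>M \<mu>). H l z) = (LINT z|(\<mu> \<Otimes>\<^sub>M \<mu>). of_real (gauss s l) *
       ((E (- \<i> * of_real l * of_real (fst z)) * f (fst z)) * (E (\<i> * of_real l * of_real (snd z)) * cnj (f (snd z)))))"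
      by (intro Bochner_Integration.integral_cong refl) (simp add: H_def F_def scaleR_conv_of_real ac_simps)
    also have "\<dots> = of_real (gauss s l) * (LINT z|(\<mu> \<Otimes>\<^sub>M \<mu>).
       ((E (- \<i> * of_real l * of_real (fst z)) * f (fst z)) * (E (\<i> * of_real l * of_real (snd z)) * cnj (f (snd z)))))"
      by (rule integral_mult_right_zero)
    also have "(LINT z|(\<mu> \<Otimes>\<^sub>M \<mu>).
       ((E (- \<i> * of_real l * of_real (fst z)) * f (fst z)) * (E (\<i> * of_real l * of_real (snd z)) * cnj (f (snd z)))))
       = D f l * cnj (D f l)"
      unfolding cnj_D unfolding dunkl_transform_L1_def
    proof (rule mu2.integral_product)
      show "integrable \<mu> (\<lambda>x. E (- \<i> * of_real l * of_real x) * f x)"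
        by (rule D_integrable[OF f])
      show "integrable \<mu> (\<lambda>x. E (\<i> * of_real l * of_real x) * cnj (f x))"
        using D_integrable[of "\<lambda>x. cnj (f x)" "- l"] f by simp
    qed
    finally show ?thesis
      by (simp only: complex_norm_square[symmetric] of_real_mult of_real_power)
  qed
  have outer: "(LINT l|\<mu>. H l z) = of_real (heat s (fst z) (snd z)) * F z" for z
  proof -
    have "(LINT l|\<mu>. H l z) = (LINT l|\<mu>. (gauss s l *\<^sub>R (E (- \<i> * of_real l * of_real (fst z)) * E (\<i> * of_real l * of_real (snd z)))) * F z)"
      by (simp add: H_def)
    then show ?thesis unfolding integral_mult_left_zero heat_spectral[OF s] .
  qed
  have i1: "integrable \<mu> (\<lambda>l. LINT z|(\<mu> \<Otimes>\<^sub>M \<mu>). H l z)"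
    using P.integrable_fst[OF intH] .
  have i2: "integrable (\<mu> \<Otimes>\<^sub>M \<mu>) (\<lambda>z. LINT l|\<mu>. H l z)"
    using P.integrable_snd[OF intH] .
  have eq: "(LINT l|\<mu>. (LINT z|(\<mu> \<Otimes>\<^sub>M \<mu>). H l z)) = (LINT z|(\<mu> \<Otimes>\<^sub>M \<mu>). (LINT l|\<mu>. H l z))"
    using P.Fubini_integral[OF intH] by simp
  have "(LINT l|\<mu>. gauss s l * (cmod (D f l))\<^sup>2) = Re (LINT l|\<mu>. (LINT z|(\<mu> \<Otimes>\<^sub>M \<mu>). H l z))"
    unfolding inner by (simp only: integral_complex_of_real Re_complex_of_real)
  also have "\<dots> = (LINT z|(\<mu> \<Otimes>\<^sub>M \<mu>). Re (LINT l|\<mu>. H l z))"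
    unfolding eq by (rule integral_Re[symmetric, OF i2])
  also have "\<dots> = (LINT z|(\<mu> \<Otimes>\<^sub>M \<mu>). heat s (fst z) (snd z) * Re (f (fst z) * cnj (f (snd z))))"
    unfolding outer F_def by simp
  finally show ?thesis
    using i1 unfolding inner by (simp only: has_bochner_integral_iff complex_of_real_integrable_eq simp_thms)
qed

theorem plancherel_L1:
  assumes f: "integrable \<mu> f" and fin: "N2 f < \<infinity>"
  shows "N2 (D f) = N2 f"
proof -
  have [measurable]: "f \<in> borel_measurable borel" by (rule measurable_integrable_mu[OF f])
  have f2: "integrable \<mu> (\<lambda>x. (cmod (f x))\<^sup>2)"
    using fin unfolding N2_def by (subst integrable_iff_bounded) auto
  define N where "N = (LINT x|\<mu>. (cmod (f x))\<^sup>2)"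
  have N: "N2 f = ennreal N"
    unfolding N2_def N_def by (rule nn_integral_eq_integral[OF f2]) auto
  define a where "a n = (LINT l|\<mu>. gauss (real (Suc n)) l * (cmod (D f l))\<^sup>2)" for n
  have agauss: "(\<integral>\<^sup>+l. ennreal (gauss (real (Suc n)) l * (cmod (D f l))\<^sup>2) \<partial>\<mu>) = ennreal (a n)" for n
    unfolding a_def using plancherel_gauss[OF _ f, of "real (Suc n)"]
    by (intro nn_integral_eq_integral) (auto simp: has_bochner_integral_iff)
  define S where "S n = (\<integral>\<^sup>+x. (\<integral>\<^sup>+y. ennreal ((cmod (f x - f y))\<^sup>2) * ennreal (heat (real (Suc n)) x y) \<partial>\<mu>) \<partial>\<mu>)" for n
  have S: "S \<longlonglongrightarrow> 0"
    unfolding S_def using heat.osc_sq_tendsto_0[OF f] fin unfolding N2_def by simp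
  \<comment> \<open>The square is expanded: both diagonal terms integrate to \<open>N\<close>, as
    the heat kernel has mass 1 in either variable, and the mixed term gives
    \<open>a n\<close>.\<close>
  have "ennreal (2 * N - 2 * a n) = S n" and aN: "a n \<le> N" for n
  proof -
    let ?s = "real (Suc n)"
    let ?h = "\<lambda>z. heat ?s (fst z) (snd z)"
    have [measurable]: "?h \<in> borel_measurable (borel \<Otimes>\<^sub>M borel)"
      by (rule measurable_heat[OF measurable_fst measurable_snd])
    have i1: "has_bochner_integral (\<mu> \<Otimes>\<^sub>M \<mu>) (\<lambda>z. ?h z * (cmod (f (fst z)))\<^sup>2) N"
    proof -
      have m: "(LINT y|\<mu>. heat ?s x y * c) = c" for x c
        using heat_moments(1)[of ?s x] by (simp add: has_bochner_integral_iff)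
      have i: "integrable \<mu> (\<lambda>y. heat ?s x y * c)" for x c
        using heat_moments(1)[of ?s x] by (simp add: has_bochner_integral_iff)
      have "integrable (\<mu> \<Otimes>\<^sub>M \<mu>) (\<lambda>z. ?h z * (cmod (f (fst z)))\<^sup>2)"
      proof (rule mu2.Fubini_integrable)
        show "(\<lambda>z. ?h z * (cmod (f (fst z)))\<^sup>2) \<in> borel_measurable (\<mu> \<Otimes>\<^sub>M \<mu>)" by measurable
        have "norm (?h (x, y) * (cmod (f (fst (x, y))))\<^sup>2) = heat ?s x y * (cmod (f x))\<^sup>2" for x y
          by (simp add: abs_mult)
        then show "integrable \<mu> (\<lambda>x. LINT y|\<mu>. norm (?h (x, y) * (cmod (f (fst (x, y))))\<^sup>2))"
          using f2 by (simp only: m)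
        show "AE x in \<mu>. integrable \<mu> (\<lambda>y. ?h (x, y) * (cmod (f (fst (x, y))))\<^sup>2)"
          by (intro AE_I2) (simp only: fst_conv snd_conv i)
      qed
      moreover from mu2.integral_fst'[OF this]
      have "(LINT z|(\<mu> \<Otimes>\<^sub>M \<mu>). ?h z * (cmod (f (fst z)))\<^sup>2) = N"
        by (simp only: m N_def fst_conv snd_conv)
      ultimately show ?thesis by (simp add: has_bochner_integral_iff)
    qed
    have i2: "has_bochner_integral (\<mu> \<Otimes>\<^sub>M \<mu>) (\<lambda>z. ?h z * (cmod (f (snd z)))\<^sup>2) N"
    proof -
      have "(\<lambda>(x, y). (\<lambda>z. ?h z * (cmod (f (fst z)))\<^sup>2) (y, x)) = (\<lambda>z. ?h z * (cmod (f (snd z)))\<^sup>2)"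
        by (auto simp: fun_eq_iff heat_sym)
      then show ?thesis
        using mu2.integrable_product_swap[of "\<lambda>z. ?h z * (cmod (f (fst z)))\<^sup>2"]
          mu2.integral_product_swap[of "\<lambda>z. ?h z * (cmod (f (fst z)))\<^sup>2"] i1
        by (auto simp: has_bochner_integral_iff)
    qed
    have i3: "has_bochner_integral (\<mu> \<Otimes>\<^sub>M \<mu>) (\<lambda>z. ?h z * Re (f (fst z) * cnj (f (snd z)))) (a n)"
    proof -
      have "integrable (\<mu> \<Otimes>\<^sub>M \<mu>) (\<lambda>z. ?h z * Re (f (fst z) * cnj (f (snd z))))"
      proof (rule Bochner_Integration.integrable_bound)
        show "integrable (\<mu> \<Otimes>\<^sub>M \<mu>) (\<lambda>z. ?h z * (cmod (f (fst z)))\<^sup>2 + ?h z * (cmod (f (snd z)))\<^sup>2)"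
          using i1 i2 by (intro Bochner_Integration.integrable_add) (auto simp: has_bochner_integral_iff)
        show "AE z in \<mu> \<Otimes>\<^sub>M \<mu>. norm (?h z * Re (f (fst z) * cnj (f (snd z)))) \<le> norm (?h z * (cmod (f (fst z)))\<^sup>2 + ?h z * (cmod (f (snd z)))\<^sup>2)"
        proof (intro AE_I2)
          fix z
          have "\<bar>Re (f (fst z) * cnj (f (snd z)))\<bar> \<le> cmod (f (fst z)) * cmod (f (snd z))"
            using abs_Re_le_cmod[of "f (fst z) * cnj (f (snd z))"] by (simp add: norm_mult)
          also have "\<dots> \<le> (cmod (f (fst z)))\<^sup>2 + (cmod (f (snd z)))\<^sup>2"
          proof -
            have "0 \<le> cmod (f (fst z)) * cmod (f (snd z))" by simp
            then show ?thesis
              using sum_squares_bound[of "cmod (f (fst z))" "cmod (f (snd z))"] by linarith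
          qed
          finally have "?h z * \<bar>Re (f (fst z) * cnj (f (snd z)))\<bar> \<le> ?h z * ((cmod (f (fst z)))\<^sup>2 + (cmod (f (snd z)))\<^sup>2)"
            by (rule mult_left_mono) simp
          moreover have "norm (?h z * A) = ?h z * \<bar>A\<bar>" for A
            by (simp only: real_norm_def abs_mult abs_of_nonneg[OF heat_nonneg])
          ultimately show "norm (?h z * Re (f (fst z) * cnj (f (snd z)))) \<le> norm (?h z * (cmod (f (fst z)))\<^sup>2 + ?h z * (cmod (f (snd z)))\<^sup>2)"
            unfolding distrib_left[symmetric] by simp
        qed
      qed measurable
      then show ?thesis
        using plancherel_gauss[OF _ f, of ?s] by (simp add: has_bochner_integral_iff a_def)
    qed
    have sq: "?h z * (cmod (f (fst z) - f (snd z)))\<^sup>2 =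
       ?h z * (cmod (f (fst z)))\<^sup>2 + ?h z * (cmod (f (snd z)))\<^sup>2 - 2 * (?h z * Re (f (fst z) * cnj (f (snd z))))" for z
    proof -
      have "(cmod (a - b))\<^sup>2 = (cmod a)\<^sup>2 + (cmod b)\<^sup>2 - 2 * Re (a * cnj b)" for a b
        unfolding cmod_power2 by (simp add: power2_eq_square algebra_simps)
      then show ?thesis by (simp only: distrib_left right_diff_distrib mult.left_commute)
    qed
    have i4: "has_bochner_integral (\<mu> \<Otimes>\<^sub>M \<mu>) (\<lambda>z. ?h z * (cmod (f (fst z) - f (snd z)))\<^sup>2) (N + N - 2 * a n)"
      unfolding sq by (intro has_bochner_integral_diff has_bochner_integral_add has_bochner_integral_mult_right i1 i2 i3)
    have "S n = (\<integral>\<^sup>+z. ennreal (?h z * (cmod (f (fst z) - f (snd z)))\<^sup>2) \<partial>(\<mu> \<Otimes>\<^sub>M \<mu>))"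
    proof -
      let ?g = "\<lambda>z. ennreal (?h z * (cmod (f (fst z) - f (snd z)))\<^sup>2)"
      have pw: "ennreal ((cmod (f x - f y))\<^sup>2) * ennreal (heat ?s x y) = ?g (x, y)" for x y
        by (simp only: ennreal_mult[symmetric] zero_le_power2 heat_nonneg mult.commute fst_conv snd_conv)
      have "S n = (\<integral>\<^sup>+x. (\<integral>\<^sup>+y. ?g (x, y) \<partial>\<mu>) \<partial>\<mu>)"
        unfolding S_def pw by (rule refl)
      also have "\<dots> = (\<integral>\<^sup>+z. ?g z \<partial>(\<mu> \<Otimes>\<^sub>M \<mu>))"
        by (rule mu.nn_integral_fst) measurable
      finally show ?thesis .
    qed
    also have "\<dots> = ennreal (N + N - 2 * a n)"
      using i4 by (subst nn_integral_eq_integral) (auto simp: has_bochner_integral_iff)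
    finally have "S n = ennreal (N + N - 2 * a n)" .
    moreover have "N + N = 2 * N" by simp
    ultimately show "ennreal (2 * N - 2 * a n) = S n" by (simp only:)
    \<comment> \<open>\<open>ennreal\<close> sends negative reals to 0, so the sign is required to
      bring the limit back to the reals.\<close>
    have "0 \<le> (LINT z|(\<mu> \<Otimes>\<^sub>M \<mu>). ?h z * (cmod (f (fst z) - f (snd z)))\<^sup>2)"
      by (intro integral_nonneg_AE AE_I2 mult_nonneg_nonneg heat_nonneg zero_le_power2)
    then have "N + N - 2 * a n \<ge> 0"
      using i4 by (simp only: has_bochner_integral_iff)
    then show "a n \<le> N" by simp
  qed
  then have "(\<lambda>n. ennreal (2 * N - 2 * a n)) \<longlonglongrightarrow> ennreal 0" using S by simp
  then have "(\<lambda>n. 2 * N - 2 * a n) \<longlonglongrightarrow> 0"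
    using aN by (subst (asm) tendsto_ennreal_iff) auto
  then have "(\<lambda>n. N - (2 * N - 2 * a n) / 2) \<longlonglongrightarrow> N - 0 / 2"
    by (intro tendsto_intros) auto
  then have "a \<longlonglongrightarrow> N" by (simp add: diff_divide_distrib)
  then have lim1: "(\<lambda>n. ennreal (a n)) \<longlonglongrightarrow> N2 f" unfolding N by (rule tendsto_ennrealI)
  \<comment> \<open>\<open>gauss (real (Suc n))\<close> increases to 1, so monotone convergence
    applies even though \<open>D f\<close> is not yet known to be in L2.\<close>
  have "(\<lambda>n. \<integral>\<^sup>+l. ennreal (gauss (real (Suc n)) l * (cmod (D f l))\<^sup>2) \<partial>\<mu>) \<longlonglongrightarrow> N2 (D f)"
    unfolding N2_def
  proof (rule nn_integral_LIMSEQ)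
    show "incseq (\<lambda>n l. ennreal (gauss (real (Suc n)) l * (cmod (D f l))\<^sup>2))"
      unfolding gauss_def
      by (intro incseq_SucI le_funI ennreal_leI mult_right_mono) (auto intro!: divide_left_mono)
    show "(\<lambda>n. ennreal (gauss (real (Suc n)) l * (cmod (D f l))\<^sup>2)) \<longlonglongrightarrow> ennreal ((cmod (D f l))\<^sup>2)" for l
    proof (intro tendsto_ennrealI)
      have "(\<lambda>n. gauss (real (Suc n)) l) \<longlonglongrightarrow> 1"
        unfolding gauss_def by real_asymp
      from tendsto_mult_right[OF this, of "(cmod (D f l))\<^sup>2"]
      show "(\<lambda>n. gauss (real (Suc n)) l * (cmod (D f l))\<^sup>2) \<longlonglongrightarrow> (cmod (D f l))\<^sup>2" by simp
    qed
  qed auto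
  then have "(\<lambda>n. ennreal (a n)) \<longlonglongrightarrow> N2 (D f)" unfolding agauss .
  then show ?thesis using lim1 by (rule LIMSEQ_unique)
qed

end

section \<open>The transform on \<open>L\<^sup>2\<close>\<close>

lemma ennpowr_ennreal: "0 \<le> r \<Longrightarrow> ennpowr (ennreal r) a = ennreal (r powr a)"
  by (simp add: ennpowr_def)

lemma ennpowr_top [simp]: "ennpowr \<infinity> a = \<infinity>" "ennpowr top a = top"
  by (simp_all add: ennpowr_def)

lemma ennpowr_0 [simp]: "ennpowr 0 a = 0"
  by (simp add: ennpowr_def)

lemma ennpowr_one [simp]: "ennpowr x 1 = x"
  by (cases x) (simp_all add: ennpowr_ennreal)

lemma ennpowr_eq_top_iff [simp]: "ennpowr x a = top \<longleftrightarrow> x = top"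
  by (simp add: ennpowr_def)

lemma ennpowr_less_top_iff [simp]: "ennpowr x a < top \<longleftrightarrow> x < top"
  by (simp add: less_top[symmetric])

lemma ennpowr_strict_mono_iff:
  assumes a: "0 < a"
  shows "ennpowr x a < ennpowr y a \<longleftrightarrow> x < y"
proof -
  have "r powr a < s powr a \<longleftrightarrow> r < s" if "0 \<le> r" "0 \<le> s" for r s :: real
    using that a by (meson not_le powr_less_mono2 powr_mono2 less_imp_le)
  then show ?thesis
    by (cases x; cases y) (auto simp: ennpowr_ennreal ennreal_less_iff)
qed

lemma ennpowr_mono_iff: "0 < a \<Longrightarrow> ennpowr x a \<le> ennpowr y a \<longleftrightarrow> x \<le> y"
  using ennpowr_strict_mono_iff[of a y x] by (simp add: not_less[symmetric])

lemma ennpowr_mono: "0 < a \<Longrightarrow> x \<le> y \<Longrightarrow> ennpowr x a \<le> ennpowr y a"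
  by (simp add: ennpowr_mono_iff)

lemma ennpowr_ennpowr [simp]: "ennpowr (ennpowr x a) b = ennpowr x (a * b)"
  by (cases x) (simp_all add: ennpowr_ennreal powr_powr)

lemma ennpowr_mult: "0 < a \<Longrightarrow> ennpowr (x * y) a = ennpowr x a * ennpowr y a"
proof (cases "x = top \<or> y = top")
  case True
  then show ?thesis
    by (cases "x = 0"; cases "y = 0"; cases x; cases y)
       (auto simp: ennreal_mult_top ennreal_top_mult ennpowr_ennreal)
next
  case False
  then obtain r s where "x = ennreal r" "y = ennreal s" "0 \<le> r" "0 \<le> s"
    by (cases x; cases y) auto
  then show ?thesis by (simp add: ennpowr_ennreal powr_mult flip: ennreal_mult)
qed

lemma measurable_ennpowr [measurable]: "(\<lambda>x. ennpowr x a) \<in> borel_measurable borel"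
  unfolding ennpowr_def by measurable

lemma tendsto_ennpowr_0_iff:
  assumes a: "0 < a"
  shows "((\<lambda>n. ennpowr (f n) a) \<longlongrightarrow> 0) F \<longleftrightarrow> (f \<longlongrightarrow> 0) F"
proof -
  have *: "((\<lambda>n. ennpowr (f n) a) \<longlongrightarrow> 0) F" if "(f \<longlongrightarrow> 0) F" "0 < a" for a f
  proof (rule order_tendstoI)
    fix e :: ennreal assume "0 < e"
    have "0 < ennpowr e (1 / a)"
      using \<open>0 < e\<close> \<open>0 < a\<close> ennpowr_strict_mono_iff[of "1 / a" 0 e] by simp
    with that(1) have "\<forall>\<^sub>F n in F. f n < ennpowr e (1 / a)" by (rule order_tendstoD)
    then show "\<forall>\<^sub>F n in F. ennpowr (f n) a < e"
    proof eventually_elim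
      fix n assume "f n < ennpowr e (1 / a)"
      then have "ennpowr (f n) a < ennpowr (ennpowr e (1 / a)) a"
        using \<open>0 < a\<close> by (subst ennpowr_strict_mono_iff)
      then show "ennpowr (f n) a < e" using \<open>0 < a\<close> by simp
    qed
  qed simp
  show ?thesis
    using *[of f a] *[of "\<lambda>n. ennpowr (f n) a" "1 / a"] a by auto
qed

section \<open>Completeness, existence and injectivity\<close>

context dunkl begin

lemma Lp_norm_2: "Lp_norm \<mu> 2 (\<lambda>x. ennreal (cmod (f x))) = ennpowr (N2 f) (1 / 2)"
proof -
  have half: "enn2real (1 / 2) = 1 / 2"
    by (metis divide_ennreal enn2real_ennreal ennreal_1 ennreal_numeral zero_le_numeral zero_less_numeral zero_le_one zero_le_divide_1_iff)
  show ?thesis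
    unfolding Lp_norm_def half N2_def by (simp add: ennpowr_ennreal)
qed

lemma Lp_space_2_iff: "f \<in> Lp_space \<mu> 2 \<longleftrightarrow> f \<in> borel_measurable borel \<and> N2 f < \<infinity>"
  by (simp add: Lp_space_def Lp_norm_2)

lemma Lp_space_1_iff: "f \<in> Lp_space \<mu> 1 \<longleftrightarrow> integrable \<mu> f"
  by (simp add: Lp_space_def Lp_norm_def integrable_iff_bounded divide_ennreal_def)

lemma L2_tendsto_iff: "L2_tendsto \<kappa> u f \<longleftrightarrow> (\<lambda>n. N2 (\<lambda>x. u n x - f x)) \<longlonglongrightarrow> 0"
  unfolding L2_tendsto_def Lp_norm_2 by (rule tendsto_ennpowr_0_iff) simp

lemma N2_add:
  assumes [measurable]: "f \<in> borel_measurable borel" "g \<in> borel_measurable borel"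
  shows "N2 (\<lambda>x. f x + g x) \<le> 2 * N2 f + 2 * N2 g"
proof -
  have "(cmod (a + b))\<^sup>2 \<le> 2 * (cmod a)\<^sup>2 + 2 * (cmod b)\<^sup>2" for a b
  proof -
    have "(cmod (a + b))\<^sup>2 \<le> (cmod a + cmod b)\<^sup>2"
      by (intro power_mono norm_triangle_ineq) simp
    also have "\<dots> \<le> 2 * (cmod a)\<^sup>2 + 2 * (cmod b)\<^sup>2"
      using sum_squares_bound[of "cmod a" "cmod b"] by (simp add: power2_sum)
    finally show ?thesis .
  qed
  then have "ennreal ((cmod (f x + g x))\<^sup>2) \<le> 2 * ennreal ((cmod (f x))\<^sup>2) + 2 * ennreal ((cmod (g x))\<^sup>2)" for x
    using ennreal_leI[of "(cmod (f x + g x))\<^sup>2" "2 * (cmod (f x))\<^sup>2 + 2 * (cmod (g x))\<^sup>2"]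
    by (simp add: ennreal_plus ennreal_mult)
  then have "N2 (\<lambda>x. f x + g x) \<le> (\<integral>\<^sup>+x. 2 * ennreal ((cmod (f x))\<^sup>2) + 2 * ennreal ((cmod (g x))\<^sup>2) \<partial>\<mu>)"
    unfolding N2_def by (intro nn_integral_mono)
  also have "\<dots> = 2 * N2 f + 2 * N2 g"
    unfolding N2_def by (simp add: nn_integral_add nn_integral_cmult)
  finally show ?thesis .
qed

lemma N2_minus_commute: "N2 (\<lambda>x. f x - g x) = N2 (\<lambda>x. g x - f x)"
  unfolding N2_def by (simp add: norm_minus_commute)

lemma N2_triangle:
  assumes "f \<in> borel_measurable borel" "g \<in> borel_measurable borel" "h \<in> borel_measurable borel"
  shows "N2 (\<lambda>x. f x - h x) \<le> 2 * N2 (\<lambda>x. f x - g x) + 2 * N2 (\<lambda>x. g x - h x)"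
proof -
  have [measurable]: "f \<in> borel_measurable borel" "g \<in> borel_measurable borel" "h \<in> borel_measurable borel" by fact+
  show ?thesis using N2_add[of "\<lambda>x. f x - g x" "\<lambda>x. g x - h x"] by simp
qed

lemma N2_eq_0_iff:
  assumes [measurable]: "f \<in> borel_measurable borel" "g \<in> borel_measurable borel"
  shows "N2 (\<lambda>x. f x - g x) = 0 \<longleftrightarrow> (AE x in \<mu>. f x = g x)"
  unfolding N2_def by (subst nn_integral_0_iff_AE) auto

lemma D_diff:
  assumes "integrable \<mu> f" "integrable \<mu> g"
  shows "D (\<lambda>x. f x - g x) l = D f l - D g l"
  unfolding dunkl_transform_L1_def right_diff_distrib
  by (rule Bochner_Integration.integral_diff) (intro D_integrable assms)+

lemma N2_D_diff:
  assumes "integrable \<mu> f" "integrable \<mu> g" "N2 f < \<infinity>" "N2 g < \<infinity>"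
  shows "N2 (\<lambda>l. D f l - D g l) = N2 (\<lambda>x. f x - g x)"
proof -
  have [measurable]: "f \<in> borel_measurable borel" "g \<in> borel_measurable borel"
    using assms by (auto intro: measurable_integrable_mu)
  have "N2 (\<lambda>x. f x - g x) \<le> 2 * N2 f + 2 * N2 g"
    using N2_triangle[of f "\<lambda>_. 0" g] by (simp add: N2_def)
  also have "\<dots> < \<infinity>" using assms by (simp add: ennreal_mult_less_top)
  finally have "N2 (D (\<lambda>x. f x - g x)) = N2 (\<lambda>x. f x - g x)"
    by (intro plancherel_L1 Bochner_Integration.integrable_diff assms)
  moreover have "D (\<lambda>x. f x - g x) = (\<lambda>l. D f l - D g l)"
    by (rule ext) (rule D_diff[OF assms(1,2)])
  ultimately show ?thesis by simp
qed

text \<open>Density of L1 \<inter> L2 in L2. On a bounded interval integrability follows since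
  \<open>cmod (f x)\<close> is at most 1 plus its square.\<close>

lemma N2_truncate:
  assumes [measurable]: "f \<in> borel_measurable borel" and fin: "N2 f < \<infinity>"
  shows "integrable \<mu> (\<lambda>x. indicator {- real n..real n} x *\<^sub>R f x)"
    and "N2 (\<lambda>x. indicator {- real n..real n} x *\<^sub>R f x) < \<infinity>"
    and "(\<lambda>n. N2 (\<lambda>x. indicator {- real n..real n} x *\<^sub>R f x - f x)) \<longlonglongrightarrow> 0"
proof -
  have "N2 (\<lambda>x. indicator {- real n..real n} x *\<^sub>R f x) \<le> N2 f"
    unfolding N2_def by (intro nn_integral_mono) (auto simp: indicator_def)
  then show "N2 (\<lambda>x. indicator {- real n..real n} x *\<^sub>R f x) < \<infinity>"
    using fin by (rule le_less_trans)
  show "integrable \<mu> (\<lambda>x. indicator {- real n..real n} x *\<^sub>R f x)"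
    unfolding integrable_iff_bounded
  proof
    have "(\<integral>\<^sup>+x. ennreal (norm (indicator {- real n..real n} x *\<^sub>R f x)) \<partial>\<mu>) \<le>
       (\<integral>\<^sup>+x. indicator {- real n..real n} x + ennreal ((cmod (f x))\<^sup>2) \<partial>\<mu>)"
    proof (intro nn_integral_mono)
      fix x
      have "2 * cmod (f x) \<le> 1 + (cmod (f x))\<^sup>2"
        using sum_squares_bound[of 1 "cmod (f x)"] by simp
      then have "cmod (f x) \<le> 1 + (cmod (f x))\<^sup>2"
        using norm_ge_zero[of "f x"] by linarith
      then have "ennreal (cmod (f x)) \<le> 1 + ennreal ((cmod (f x))\<^sup>2)"
        by (metis ennreal_1 ennreal_leI ennreal_plus zero_le_one zero_le_power2)
      then show "ennreal (norm (indicator {- real n..real n} x *\<^sub>R f x)) \<le> indicator {- real n..real n} x + ennreal ((cmod (f x))\<^sup>2)"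
        by (auto simp: indicator_def)
    qed
    also have "\<dots> = emeasure \<mu> {- real n..real n} + N2 f"
      unfolding N2_def by (simp add: nn_integral_add)
    also have "\<dots> < \<infinity>" using fin emeasure_mu_bounded by simp
    finally show "(\<integral>\<^sup>+x. ennreal (norm (indicator {- real n..real n} x *\<^sub>R f x)) \<partial>\<mu>) < \<infinity>" .
  qed simp
  have "(\<lambda>n. \<integral>\<^sup>+x. ennreal ((cmod (indicator {- real n..real n} x *\<^sub>R f x - f x))\<^sup>2) \<partial>\<mu>) \<longlonglongrightarrow> (\<integral>\<^sup>+x. 0 \<partial>\<mu>)"
  proof (rule nn_integral_dominated_convergence[where w = "\<lambda>x. ennreal ((cmod (f x))\<^sup>2)"])
    show "AE x in \<mu>. ennreal ((cmod (indicator {- real n..real n} x *\<^sub>R f x - f x))\<^sup>2) \<le> ennreal ((cmod (f x))\<^sup>2)" for n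
      by (intro AE_I2) (auto simp: indicator_def)
    show "AE x in \<mu>. (\<lambda>n. ennreal ((cmod (indicator {- real n..real n} x *\<^sub>R f x - f x))\<^sup>2)) \<longlonglongrightarrow> 0"
    proof (intro AE_I2 tendsto_eventually)
      fix x
      obtain N :: nat where "\<bar>x\<bar> \<le> real N" using real_arch_simple by blast
      then have "ennreal ((cmod (indicator {- real n..real n} x *\<^sub>R f x - f x))\<^sup>2) = 0" if "n \<ge> N" for n
        using that by (auto simp: indicator_def)
      then show "\<forall>\<^sub>F n in sequentially. ennreal ((cmod (indicator {- real n..real n} x *\<^sub>R f x - f x))\<^sup>2) = 0"
        by (intro eventually_sequentiallyI[of N]) simp
    qed
  qed (use fin in \<open>auto simp: N2_def\<close>)
  then show "(\<lambda>n. N2 (\<lambda>x. indicator {- real n..real n} x *\<^sub>R f x - f x)) \<longlonglongrightarrow> 0"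
    by (simp add: N2_def)
qed

text \<open>Riesz-Fischer for a geometric rate. The rate 8^(-n) leaves room for the weight 2^n: the
  weighted squares still have a finite sum, and so the increments at almost every point are at most
  a constant times 2^(-n/2).\<close>

lemma L2_complete_seq:
  assumes [measurable]: "\<And>n. w n \<in> borel_measurable borel"
    and c: "\<And>m n. n \<le> m \<Longrightarrow> N2 (\<lambda>x. w m x - w n x) \<le> ennreal (4 / 8 ^ n)"
  obtains g where "g \<in> borel_measurable borel" "\<And>n. N2 (\<lambda>x. w n x - g x) \<le> ennreal (4 / 8 ^ n)"
proof -
  define g where "g x = lim (\<lambda>n. w n x)" for x
  have [measurable]: "g \<in> borel_measurable borel" unfolding g_def by measurable
  have "(\<integral>\<^sup>+x. (\<Sum>n. ennreal (2 ^ n) * ennreal ((cmod (w (Suc n) x - w n x))\<^sup>2)) \<partial>\<mu>) =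
      (\<Sum>n. \<integral>\<^sup>+x. ennreal (2 ^ n) * ennreal ((cmod (w (Suc n) x - w n x))\<^sup>2) \<partial>\<mu>)"
    by (rule nn_integral_suminf) measurable
  also have "\<dots> \<le> (\<Sum>n. ennreal (4 * (1 / 4) ^ n))"
  proof (intro suminf_le summableI)
    fix n
    have "(\<integral>\<^sup>+x. ennreal (2 ^ n) * ennreal ((cmod (w (Suc n) x - w n x))\<^sup>2) \<partial>\<mu>) = ennreal (2 ^ n) * N2 (\<lambda>x. w (Suc n) x - w n x)"
      unfolding N2_def by (rule nn_integral_cmult) measurable
    also have "\<dots> \<le> ennreal (2 ^ n) * ennreal (4 / 8 ^ n)"
      by (intro mult_left_mono c) auto
    also have "\<dots> = ennreal (4 * (1 / 4) ^ n)"
    proof -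
      have "(8::real) ^ n = 2 ^ n * 4 ^ n" by (simp flip: power_mult_distrib)
      then show ?thesis by (simp add: power_divide flip: ennreal_mult)
    qed
    finally show "(\<integral>\<^sup>+x. ennreal (2 ^ n) * ennreal ((cmod (w (Suc n) x - w n x))\<^sup>2) \<partial>\<mu>) \<le> ennreal (4 * (1 / 4) ^ n)" .
  qed
  also have "\<dots> = ennreal (\<Sum>n. 4 * (1 / 4) ^ n)"
    by (intro suminf_ennreal2 summable_mult summable_geometric) auto
  also have "\<dots> < \<infinity>" by simp
  finally have "AE x in \<mu>. (\<Sum>n. ennreal (2 ^ n) * ennreal ((cmod (w (Suc n) x - w n x))\<^sup>2)) \<noteq> \<infinity>"
    by (intro nn_integral_noteq_infinite) auto
  then have conv: "AE x in \<mu>. (\<lambda>n. w n x) \<longlonglongrightarrow> g x"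
  proof eventually_elim
    fix x assume fin: "(\<Sum>n. ennreal (2 ^ n) * ennreal ((cmod (w (Suc n) x - w n x))\<^sup>2)) \<noteq> \<infinity>"
    then obtain A where A: "(\<Sum>n. ennreal (2 ^ n) * ennreal ((cmod (w (Suc n) x - w n x))\<^sup>2)) = ennreal A" "A \<ge> 0"
      by (cases "\<Sum>n. ennreal (2 ^ n) * ennreal ((cmod (w (Suc n) x - w n x))\<^sup>2)") auto
    have "cmod (w (Suc n) x - w n x) \<le> sqrt A * (1 / sqrt 2) ^ n" for n
    proof -
      have "ennreal (2 ^ n) * ennreal ((cmod (w (Suc n) x - w n x))\<^sup>2) \<le> ennreal A"
        unfolding A(1)[symmetric] using sum_le_suminf[of "\<lambda>n. ennreal (2 ^ n) * ennreal ((cmod (w (Suc n) x - w n x))\<^sup>2)" "{n}"] by simp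
      then have "2 ^ n * (cmod (w (Suc n) x - w n x))\<^sup>2 \<le> A"
        using A(2) by (simp flip: ennreal_mult)
      then have "(cmod (w (Suc n) x - w n x))\<^sup>2 \<le> A / 2 ^ n"
        by (simp add: field_simps)
      then have "cmod (w (Suc n) x - w n x) \<le> sqrt (A / 2 ^ n)"
        by (rule real_le_rsqrt)
      then show ?thesis by (simp add: real_sqrt_divide real_sqrt_power power_divide)
    qed
    note bnd = this
    have sg: "summable (\<lambda>n. sqrt A * (1 / sqrt 2) ^ n)"
      by (rule summable_mult, rule summable_geometric) simp
    have "summable (\<lambda>n. w (Suc n) x - w n x)"
      by (rule summable_comparison_test'[OF sg]) (rule bnd)
    then have "convergent (\<lambda>n. (w n x - w 0 x) + w 0 x)"
      unfolding summable_iff_convergent sum_lessThan_telescope[of "\<lambda>n. w n x"]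
      by (intro convergent_add convergent_const)
    then have "convergent (\<lambda>n. w n x)" by simp
    then show "(\<lambda>n. w n x) \<longlonglongrightarrow> g x" unfolding g_def by (simp add: convergent_LIMSEQ_iff)
  qed
  have "N2 (\<lambda>x. w n x - g x) \<le> ennreal (4 / 8 ^ n)" for n
  proof -
    \<comment> \<open>Fatou's lemma carries the bound for the differences with \<open>w m\<close>
      over to the limit.\<close>
    have "N2 (\<lambda>x. w n x - g x) = (\<integral>\<^sup>+x. liminf (\<lambda>m. ennreal ((cmod (w n x - w m x))\<^sup>2)) \<partial>\<mu>)"
      unfolding N2_def
    proof (intro nn_integral_cong_AE)
      show "AE x in \<mu>. ennreal ((cmod (w n x - g x))\<^sup>2) = liminf (\<lambda>m. ennreal ((cmod (w n x - w m x))\<^sup>2))"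
        using conv
      proof eventually_elim
        fix x assume "(\<lambda>m. w m x) \<longlonglongrightarrow> g x"
        then have "(\<lambda>m. ennreal ((cmod (w n x - w m x))\<^sup>2)) \<longlonglongrightarrow> ennreal ((cmod (w n x - g x))\<^sup>2)"
          by (intro tendsto_ennrealI tendsto_intros)
        then show "ennreal ((cmod (w n x - g x))\<^sup>2) = liminf (\<lambda>m. ennreal ((cmod (w n x - w m x))\<^sup>2))"
          by (rule lim_imp_Liminf[symmetric, rotated]) simp
      qed
    qed
    also have "\<dots> \<le> liminf (\<lambda>m. \<integral>\<^sup>+x. ennreal ((cmod (w n x - w m x))\<^sup>2) \<partial>\<mu>)"
      by (rule nn_integral_liminf) measurable
    also have "\<dots> \<le> liminf (\<lambda>m. ennreal (4 / 8 ^ n))"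
    proof (rule Liminf_mono)
      show "\<forall>\<^sub>F m in sequentially. (\<integral>\<^sup>+x. ennreal ((cmod (w n x - w m x))\<^sup>2) \<partial>\<mu>) \<le> ennreal (4 / 8 ^ n)"
        using c[of n] unfolding N2_def by (intro eventually_sequentiallyI[of n]) (simp add: norm_minus_commute)
    qed
    finally show ?thesis by (simp add: Liminf_const)
  qed
  then show ?thesis by (rule that[rotated]) simp
qed

text \<open>Supplies the witness for the \<open>SOME\<close> in \<open>dunkl_transform_L2\<close>.
  Truncations are selected at the rate 8^(-k); by Plancherel their transforms are Cauchy at that
  rate, with 4 = 2 + 2 from \<open>N2_triangle\<close>.\<close>

lemma L2_transform_exists:
  assumes f: "f \<in> Lp_space \<mu> 2"
  shows "\<exists>g. g \<in> Lp_space \<mu> 2 \<and>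
     (\<exists>u. (\<forall>n. u n \<in> Lp_space \<mu> 1 \<inter> Lp_space \<mu> 2) \<and> L2_tendsto \<kappa> u f \<and> L2_tendsto \<kappa> (\<lambda>n. D (u n)) g)"
proof -
  have [measurable]: "f \<in> borel_measurable borel" and fin: "N2 f < \<infinity>"
    using f by (auto simp: Lp_space_2_iff)
  define t where "t n x = indicator {- real n..real n} x *\<^sub>R f x" for n :: nat and x
  have t: "integrable \<mu> (t n)" "N2 (t n) < \<infinity>" "(\<lambda>n. N2 (\<lambda>x. t n x - f x)) \<longlonglongrightarrow> 0" for n
    unfolding t_def using N2_truncate(1)[of f n] N2_truncate(2)[of f n] N2_truncate(3)[of f] fin by auto
  have "\<exists>n. N2 (\<lambda>x. t n x - f x) \<le> ennreal (1 / 8 ^ k)" for k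
  proof -
    have "\<forall>\<^sub>F n in sequentially. N2 (\<lambda>x. t n x - f x) < ennreal (1 / 8 ^ k)"
      by (rule order_tendstoD[OF t(3)]) simp
    then show ?thesis by (auto simp: eventually_sequentially intro: less_imp_le)
  qed
  then obtain r where r: "\<And>k. N2 (\<lambda>x. t (r k) x - f x) \<le> ennreal (1 / 8 ^ k)" by metis
  define u where "u k = t (r k)" for k
  have u: "integrable \<mu> (u k)" "N2 (u k) < \<infinity>" for k unfolding u_def by (rule t)+
  have [measurable]: "u k \<in> borel_measurable borel" for k by (rule measurable_integrable_mu[OF u(1)])
  have "N2 (\<lambda>l. D (u m) l - D (u n) l) \<le> ennreal (4 / 8 ^ n)" if "n \<le> m" for m n
  proof -
    have "N2 (\<lambda>l. D (u m) l - D (u n) l) = N2 (\<lambda>x. u m x - u n x)"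
      by (rule N2_D_diff) (use u in auto)
    also have "\<dots> \<le> 2 * N2 (\<lambda>x. u m x - f x) + 2 * N2 (\<lambda>x. f x - u n x)"
      by (rule N2_triangle) auto
    also have "\<dots> \<le> 2 * ennreal (1 / 8 ^ n) + 2 * ennreal (1 / 8 ^ n)"
    proof (intro add_mono mult_left_mono)
      have "(1::real) / 8 ^ m \<le> 1 / 8 ^ n" using that by (intro divide_left_mono power_increasing) auto
      then show "N2 (\<lambda>x. u m x - f x) \<le> ennreal (1 / 8 ^ n)"
        using r[of m] unfolding u_def by (meson ennreal_leI order_trans)
      show "N2 (\<lambda>x. f x - u n x) \<le> ennreal (1 / 8 ^ n)"
        using r[of n] unfolding u_def by (subst N2_minus_commute)
    qed auto
    also have "\<dots> = ennreal (4 / 8 ^ n)"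
      by (simp flip: ennreal_numeral ennreal_mult ennreal_plus)
    finally show ?thesis .
  qed
  from L2_complete_seq[OF _ this] obtain g where
    g: "g \<in> borel_measurable borel" "\<And>n. N2 (\<lambda>x. D (u n) x - g x) \<le> ennreal (4 / 8 ^ n)"
    by auto
  have [measurable]: "g \<in> borel_measurable borel" by (rule g)
  have geo: "(\<lambda>n. ennreal (c / 8 ^ n)) \<longlonglongrightarrow> 0" for c :: real
  proof -
    have "(\<lambda>n. c / 8 ^ n) \<longlonglongrightarrow> 0" by real_asymp
    then show ?thesis using tendsto_ennrealI by fastforce
  qed
  have "N2 g < \<infinity>"
  proof -
    have "N2 g = N2 (\<lambda>x. 0 - g x)" by (simp add: N2_def)
    also have "\<dots> \<le> 2 * N2 (\<lambda>x. 0 - D (u 0) x) + 2 * N2 (\<lambda>x. D (u 0) x - g x)"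
      by (rule N2_triangle) auto
    also have "N2 (\<lambda>x. 0 - D (u 0) x) = N2 (D (u 0))" by (simp add: N2_def)
    also have "\<dots> = N2 (u 0)" by (rule plancherel_L1) (rule u)+
    also have "2 * N2 (u 0) + 2 * N2 (\<lambda>x. D (u 0) x - g x) < \<infinity>"
      using u(2)[of 0] le_less_trans[OF g(2)[of 0]] by (simp add: ennreal_mult_less_top)
    finally show ?thesis .
  qed
  moreover have "L2_tendsto \<kappa> u f"
    unfolding L2_tendsto_iff using tendsto_0_le_ennreal[OF geo[of 1] r] by (simp add: u_def)
  moreover have "L2_tendsto \<kappa> (\<lambda>n. D (u n)) g"
    unfolding L2_tendsto_iff using tendsto_0_le_ennreal[OF geo g(2)] .
  ultimately show ?thesis
    using u g(1) measurable_integrable_mu[OF u(1)]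
    by (intro exI[of _ g] exI[of _ u] conjI) (simp_all add: Lp_space_1_iff Lp_space_2_iff)
qed

lemma L2_transform_props:
  assumes "f \<in> Lp_space \<mu> 2"
  shows "dunkl_transform_L2 \<kappa> f \<in> Lp_space \<mu> 2"
    and "\<exists>u. (\<forall>n. integrable \<mu> (u n) \<and> N2 (u n) < \<infinity>) \<and> (\<lambda>n. N2 (\<lambda>x. u n x - f x)) \<longlonglongrightarrow> 0 \<and>
       (\<lambda>n. N2 (\<lambda>x. D (u n) x - dunkl_transform_L2 \<kappa> f x)) \<longlonglongrightarrow> 0"
  using someI_ex[OF L2_transform_exists[OF assms]]
  unfolding dunkl_transform_L2_def[symmetric]
  by (auto simp: L2_tendsto_iff Lp_space_1_iff Lp_space_2_iff)

lemma tendsto_0_twice: "x \<longlonglongrightarrow> 0 \<Longrightarrow> (\<lambda>n. 2 * x n) \<longlonglongrightarrow> 0" for x :: "nat \<Rightarrow> ennreal"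
  using ennreal_tendsto_cmult[of 2 x 0 sequentially] by simp

lemma tendsto_0_add: "x \<longlonglongrightarrow> 0 \<Longrightarrow> y \<longlonglongrightarrow> 0 \<Longrightarrow> (\<lambda>n. x n + y n) \<longlonglongrightarrow> 0" for x y :: "nat \<Rightarrow> ennreal"
  using tendsto_add[of x 0 sequentially y 0] by simp

text \<open>Whichever sequence the choice in the definition rests on, Plancherel compares
  \<open>D (u n)\<close> with \<open>D f\<close> and forces the chosen limit to be
  \<open>D f\<close>.\<close>

lemma L2_transform_eq_L1:
  assumes f: "integrable \<mu> f" "N2 f < \<infinity>"
  shows "AE x in \<mu>. dunkl_transform_L2 \<kappa> f x = D f x"
proof -
  have [measurable]: "f \<in> borel_measurable borel" by (rule measurable_integrable_mu[OF f(1)])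
  have fL: "f \<in> Lp_space \<mu> 2" using f by (simp add: Lp_space_2_iff)
  let ?F = "dunkl_transform_L2 \<kappa> f"
  have [measurable]: "?F \<in> borel_measurable borel"
    using L2_transform_props(1)[OF fL] by (simp add: Lp_space_2_iff)
  obtain u where u: "\<And>n. integrable \<mu> (u n)" "\<And>n. N2 (u n) < \<infinity>" "(\<lambda>n. N2 (\<lambda>x. u n x - f x)) \<longlonglongrightarrow> 0"
       "(\<lambda>n. N2 (\<lambda>x. D (u n) x - ?F x)) \<longlonglongrightarrow> 0"
    using L2_transform_props(2)[OF fL] by blast
  have [measurable]: "u k \<in> borel_measurable borel" for k by (rule measurable_integrable_mu[OF u(1)])
  have "N2 (\<lambda>x. ?F x - D f x) \<le> 2 * N2 (\<lambda>x. D (u n) x - ?F x) + 2 * N2 (\<lambda>x. u n x - f x)" for n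
    using N2_triangle[of ?F "D (u n)" "D f"] N2_D_diff[OF u(1) f(1) u(2) f(2), of n]
    by (simp add: N2_minus_commute[of ?F])
  moreover have "(\<lambda>n. 2 * N2 (\<lambda>x. D (u n) x - ?F x) + 2 * N2 (\<lambda>x. u n x - f x)) \<longlonglongrightarrow> 0"
    by (intro tendsto_0_twice tendsto_0_add u)
  ultimately have "(\<lambda>n::nat. N2 (\<lambda>x. ?F x - D f x)) \<longlonglongrightarrow> 0"
    by (rule tendsto_0_le_ennreal[rotated])
  then have "N2 (\<lambda>x. ?F x - D f x) = 0" by (simp add: LIMSEQ_const_iff)
  then show ?thesis by (simp add: N2_eq_0_iff)
qed

text \<open>By Plancherel the approximants are as close as their transforms. This is the uniqueness
  that turns the implicit definition of the translation into a determined function.\<close>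

lemma L2_transform_inj:
  assumes f: "f \<in> Lp_space \<mu> 2" and h: "h \<in> Lp_space \<mu> 2"
    and eq: "AE x in \<mu>. dunkl_transform_L2 \<kappa> f x = dunkl_transform_L2 \<kappa> h x"
  shows "AE x in \<mu>. f x = h x"
proof -
  let ?F = "dunkl_transform_L2 \<kappa> f" and ?H = "dunkl_transform_L2 \<kappa> h"
  have [measurable]: "f \<in> borel_measurable borel" "h \<in> borel_measurable borel" "?F \<in> borel_measurable borel" "?H \<in> borel_measurable borel"
    using f h L2_transform_props(1)[OF f] L2_transform_props(1)[OF h] by (simp_all add: Lp_space_2_iff)
  obtain u where u: "\<And>n. integrable \<mu> (u n)" "\<And>n. N2 (u n) < \<infinity>" "(\<lambda>n. N2 (\<lambda>x. u n x - f x)) \<longlonglongrightarrow> 0"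
       "(\<lambda>n. N2 (\<lambda>x. D (u n) x - ?F x)) \<longlonglongrightarrow> 0"
    using L2_transform_props(2)[OF f] by blast
  obtain v where v: "\<And>n. integrable \<mu> (v n)" "\<And>n. N2 (v n) < \<infinity>" "(\<lambda>n. N2 (\<lambda>x. v n x - h x)) \<longlonglongrightarrow> 0"
       "(\<lambda>n. N2 (\<lambda>x. D (v n) x - ?H x)) \<longlonglongrightarrow> 0"
    using L2_transform_props(2)[OF h] by blast
  have [measurable]: "u k \<in> borel_measurable borel" "v k \<in> borel_measurable borel" for k
    by (rule measurable_integrable_mu[OF u(1)] measurable_integrable_mu[OF v(1)])+
  define b where "b n = 2 * N2 (\<lambda>x. u n x - f x) + 2 * (2 * (2 * N2 (\<lambda>x. D (u n) x - ?F x) + 2 * N2 (\<lambda>x. D (v n) x - ?H x)) + 2 * N2 (\<lambda>x. v n x - h x))" for n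
  have "N2 (\<lambda>x. f x - h x) \<le> b n" for n
  proof -
    have "N2 (\<lambda>x. u n x - v n x) = N2 (\<lambda>x. D (u n) x - D (v n) x)"
      using N2_D_diff[OF u(1) v(1) u(2) v(2)] by simp
    also have "\<dots> \<le> 2 * N2 (\<lambda>x. D (u n) x - ?F x) + 2 * N2 (\<lambda>x. ?F x - D (v n) x)"
      by (rule N2_triangle) auto
    also have "N2 (\<lambda>x. ?F x - D (v n) x) = N2 (\<lambda>x. D (v n) x - ?H x)"
      unfolding N2_minus_commute[of ?F] unfolding N2_def
      by (rule nn_integral_cong_AE) (use eq in eventually_elim, simp)
    finally have uv: "N2 (\<lambda>x. u n x - v n x) \<le> 2 * N2 (\<lambda>x. D (u n) x - ?F x) + 2 * N2 (\<lambda>x. D (v n) x - ?H x)" .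
    have "N2 (\<lambda>x. f x - h x) \<le> 2 * N2 (\<lambda>x. u n x - f x) + 2 * N2 (\<lambda>x. u n x - h x)"
      using N2_triangle[of f "u n" h] by (simp add: N2_minus_commute[of f])
    also have "\<dots> \<le> 2 * N2 (\<lambda>x. u n x - f x) + 2 * (2 * N2 (\<lambda>x. u n x - v n x) + 2 * N2 (\<lambda>x. v n x - h x))"
      by (intro add_left_mono mult_left_mono N2_triangle) auto
    also have "\<dots> \<le> b n"
      unfolding b_def by (intro add_left_mono mult_left_mono add_mono uv) auto
    finally show ?thesis .
  qed
  moreover have "b \<longlonglongrightarrow> 0"
    unfolding b_def by (intro tendsto_0_twice tendsto_0_add u v)
  ultimately have "(\<lambda>n::nat. N2 (\<lambda>x. f x - h x)) \<longlonglongrightarrow> 0"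
    by (rule tendsto_0_le_ennreal[rotated])
  then have "N2 (\<lambda>x. f x - h x) = 0" by (simp add: LIMSEQ_const_iff)
  then show ?thesis by (simp add: N2_eq_0_iff)
qed

end

section \<open>Translation of radial functions\<close>

context dunkl begin

text \<open>The law of cosines with \<open>t\<close> as the cosine: the translate of the function g
  (x^2) will be the \<open>dbeta\<close> average of g (\<open>cosq x y t\<close>).\<close>

definition cosq :: "real \<Rightarrow> real \<Rightarrow> real \<Rightarrow> real" where
  "cosq x y t = x\<^sup>2 + y\<^sup>2 - 2 * x * y * t"

lemma measurable_cosq [measurable (raw)]:
  assumes [measurable]: "f \<in> borel_measurable M" "g \<in> borel_measurable M" "h \<in> borel_measurable M"
  shows "(\<lambda>z. cosq (f z) (g z) (h z)) \<in> borel_measurable M"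
  unfolding cosq_def by measurable

lemma cosq_bounds:
  assumes "\<bar>t\<bar> \<le> 1"
  shows "(\<bar>x\<bar> - \<bar>y\<bar>)\<^sup>2 \<le> cosq x y t" "cosq x y t \<le> (\<bar>x\<bar> + \<bar>y\<bar>)\<^sup>2"
proof -
  have "\<bar>x * y * t\<bar> \<le> \<bar>x\<bar> * \<bar>y\<bar>"
    using assms by (simp add: abs_mult mult_left_le)
  then have "x * y * t \<le> \<bar>x\<bar> * \<bar>y\<bar>" "- (x * y * t) \<le> \<bar>x\<bar> * \<bar>y\<bar>"
    by linarith+
  then show "(\<bar>x\<bar> - \<bar>y\<bar>)\<^sup>2 \<le> cosq x y t" "cosq x y t \<le> (\<bar>x\<bar> + \<bar>y\<bar>)\<^sup>2"
  proof -
    assume *: "x * y * t \<le> \<bar>x\<bar> * \<bar>y\<bar>" "- (x * y * t) \<le> \<bar>x\<bar> * \<bar>y\<bar>"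
    have "(\<bar>x\<bar> - \<bar>y\<bar>)\<^sup>2 = x\<^sup>2 + y\<^sup>2 - 2 * (\<bar>x\<bar> * \<bar>y\<bar>)" "(\<bar>x\<bar> + \<bar>y\<bar>)\<^sup>2 = x\<^sup>2 + y\<^sup>2 + 2 * (\<bar>x\<bar> * \<bar>y\<bar>)"
      "cosq x y t = x\<^sup>2 + y\<^sup>2 - 2 * (x * y * t)"
      by (simp_all add: cosq_def power2_diff power2_sum)
    with * show "(\<bar>x\<bar> - \<bar>y\<bar>)\<^sup>2 \<le> cosq x y t" "cosq x y t \<le> (\<bar>x\<bar> + \<bar>y\<bar>)\<^sup>2" by linarith+
  qed
qed

lemma cosq_nonneg: "\<bar>t\<bar> \<le> 1 \<Longrightarrow> 0 \<le> cosq x y t"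
  using cosq_bounds(1)[of t x y] zero_le_power2[of "\<bar>x\<bar> - \<bar>y\<bar>"] by linarith

text \<open>A majorant that is uniform in \<open>t\<close> and Gaussian in \<open>x\<close>; it
  amounts to (|x| - 2 |y|)^2 >= 0.\<close>

lemma exp_cosq_le:
  assumes "\<bar>t\<bar> \<le> 1"
  shows "exp (- cosq x y t) \<le> exp (y\<^sup>2) * gauss 1 x"
proof -
  have "0 \<le> (\<bar>x\<bar> - 2 * \<bar>y\<bar>)\<^sup>2" by simp
  then have "x\<^sup>2 / 2 - y\<^sup>2 \<le> (\<bar>x\<bar> - \<bar>y\<bar>)\<^sup>2"
    by (simp add: power2_diff)
  then have "x\<^sup>2 / 2 - y\<^sup>2 \<le> cosq x y t"
    using cosq_bounds(1)[OF assms, of x y] by linarith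
  then show ?thesis by (simp add: gauss_def flip: exp_add)
qed

text \<open>Written in v = exp (- u), so that monomials give Gaussians and Weierstrass approximation
  takes place on the compact interval [0, 1]. The extra factor v keeps translates integrable when
  \<open>h\<close> is merely bounded.\<close>

definition phi :: "(real \<Rightarrow> real) \<Rightarrow> real \<Rightarrow> real" where
  "phi h u = exp (- u) * h (exp (- u))"

definition rtrans :: "(real \<Rightarrow> real) \<Rightarrow> real \<Rightarrow> real \<Rightarrow> real" where
  "rtrans h y x = (LINT t|dbeta. phi h (cosq x y t))"

definition admissible :: "real \<Rightarrow> (real \<Rightarrow> real) \<Rightarrow> bool" where
  "admissible C h \<longleftrightarrow> h \<in> borel_measurable borel \<and> (\<forall>v\<in>{0<..1}. \<bar>h v\<bar> \<le> C)"

lemma admissible_measurable: "admissible C h \<Longrightarrow> h \<in> borel_measurable borel"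
  by (simp add: admissible_def)

lemma phi_bound:
  assumes "admissible C h" "\<bar>t\<bar> \<le> 1"
  shows "\<bar>phi h (cosq x y t)\<bar> \<le> C * (exp (y\<^sup>2) * gauss 1 x)" and "\<bar>phi h (cosq x y t)\<bar> \<le> C"
proof -
  have "exp (- cosq x y t) \<in> {0<..1}" using cosq_nonneg[OF assms(2)] by simp
  then have h: "\<bar>h (exp (- cosq x y t))\<bar> \<le> C" using assms(1) by (auto simp: admissible_def)
  then have C: "C \<ge> 0" by linarith
  have "\<bar>phi h (cosq x y t)\<bar> \<le> exp (- cosq x y t) * C"
    using h by (simp add: phi_def abs_mult)
  also have "\<dots> \<le> exp (y\<^sup>2) * gauss 1 x * C"
    by (intro mult_right_mono exp_cosq_le assms C)
  finally show "\<bar>phi h (cosq x y t)\<bar> \<le> C * (exp (y\<^sup>2) * gauss 1 x)" by (simp add: mult.commute)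
  have "exp (- cosq x y t) * C \<le> 1 * C"
    using cosq_nonneg[OF assms(2)] by (intro mult_right_mono C) simp
  then show "\<bar>phi h (cosq x y t)\<bar> \<le> C"
    using \<open>\<bar>phi h (cosq x y t)\<bar> \<le> exp (- cosq x y t) * C\<close> by linarith
qed

lemma integrable_phi_dbeta:
  assumes "admissible C h"
  shows "integrable dbeta (\<lambda>t. phi h (cosq x y t))"
proof -
  have [measurable]: "h \<in> borel_measurable borel" by (rule admissible_measurable[OF assms])
  show ?thesis
    by (rule integrable_dbeta[where B = C]) (auto simp: phi_def intro!: phi_bound(2)[OF assms, unfolded phi_def])
qed

lemma measurable_rtrans [measurable (raw)]:
  assumes "h \<in> borel_measurable borel" "f \<in> borel_measurable M" "g \<in> borel_measurable M"
  shows "(\<lambda>z. rtrans h (f z) (g z)) \<in> borel_measurable M"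
proof -
  have [measurable]: "h \<in> borel_measurable borel" by fact
  have "(\<lambda>z. rtrans h (fst z) (snd z)) \<in> borel_measurable (borel \<Otimes>\<^sub>M borel)"
    unfolding rtrans_def phi_def by measurable
  from measurable_compose[OF measurable_Pair[OF assms(2,3)] this] show ?thesis by simp
qed

lemma rtrans_bound:
  assumes "admissible C h"
  shows "\<bar>rtrans h y x\<bar> \<le> C * (exp (y\<^sup>2) * gauss 1 x)"
proof -
  have "\<bar>rtrans h y x\<bar> \<le> (LINT t|dbeta. \<bar>phi h (cosq x y t)\<bar>)"
    unfolding rtrans_def by (rule integral_abs_bound)
  also have "\<dots> \<le> (LINT t|dbeta. C * (exp (y\<^sup>2) * gauss 1 x))"
  proof (rule integral_mono_AE)
    show "integrable dbeta (\<lambda>t. \<bar>phi h (cosq x y t)\<bar>)"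
      using integrable_phi_dbeta[OF assms] by simp
    show "AE t in dbeta. \<bar>phi h (cosq x y t)\<bar> \<le> C * (exp (y\<^sup>2) * gauss 1 x)"
      using AE_dbeta by eventually_elim (simp add: phi_bound(1)[OF assms])
  qed simp
  finally show ?thesis by simp
qed

lemma integrable_rtrans:
  assumes "admissible C h"
  shows "integrable \<mu> (\<lambda>x. complex_of_real (rtrans h y x))"
proof (rule Bochner_Integration.integrable_bound)
  show "integrable \<mu> (\<lambda>x. C * (exp (y\<^sup>2) * gauss 1 x))"
    by (intro integrable_mult_right integrable_gauss) simp
  show "AE x in \<mu>. norm (complex_of_real (rtrans h y x)) \<le> norm (C * (exp (y\<^sup>2) * gauss 1 x))"
    using rtrans_bound[OF assms] by (intro AE_I2) (simp add: order_trans[OF _ abs_ge_self])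
  show "(\<lambda>x. complex_of_real (rtrans h y x)) \<in> borel_measurable \<mu>"
    using admissible_measurable[OF assms] by simp
qed

text \<open>The product formula. At \<open>y = 0\<close> the integrand does not depend on
  \<open>t\<close>, so \<open>rtrans h 0\<close> is the untranslated function.\<close>

definition good :: "(real \<Rightarrow> real) \<Rightarrow> bool" where
  "good h \<longleftrightarrow> (\<forall>y l. D (\<lambda>x. of_real (rtrans h y x)) l =
     E (- \<i> * of_real l * of_real y) * D (\<lambda>x. of_real (rtrans h 0 x)) l)"

text \<open>The exponential of \<open>- c * cosq x y t\<close> factors into Gaussians in x and y and
  an exponential linear in \<open>t\<close>, whose average is \<open>Er\<close>; Weber's formula
  with one imaginary and one real parameter evaluates the transform.\<close>

lemma good_monomial: "good (\<lambda>v. v ^ i)"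
  unfolding good_def
proof (intro allI)
  fix y l
  define c where "c = real (Suc i)"
  \<comment> \<open>Chosen so that \<open>gauss s x\<close> is exp (- c x^2); the coefficient 2 c y
    of x t is then \<open>y / s\<close>.\<close>
  define s where "s = 1 / (2 * c)"
  have s: "s > 0" by (simp add: s_def c_def)
  have phi: "phi (\<lambda>v. v ^ i) u = exp (- (c * u))" for u
    by (simp add: phi_def c_def exp_of_nat_mult[symmetric] distrib_right flip: exp_add)
  have tr: "rtrans (\<lambda>v. v ^ i) y x = exp (- (y\<^sup>2 / (2 * s))) * (gauss s x * Er (y / s * x))" for x y
  proof -
    have "exp (- (c * cosq x y t)) = exp (- (y\<^sup>2 / (2 * s))) * gauss s x * exp (y / s * x * t)" for t
      by (simp add: cosq_def gauss_def s_def algebra_simps flip: exp_add)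
    then show ?thesis unfolding rtrans_def phi Er_def by (simp add: mult.assoc)
  qed
  have key: "D (\<lambda>x. of_real (rtrans (\<lambda>v. v ^ i) y x)) l =
     of_real (s powr (\<kappa> + 1)) * exp (of_real (- (s * l\<^sup>2 / 2))) * E (- \<i> * of_real l * of_real y)" for y
  proof -
    have "D (\<lambda>x. of_real (rtrans (\<lambda>v. v ^ i) y x)) l =
      (LINT x|\<mu>. of_real (exp (- (y\<^sup>2 / (2 * s)))) * (gauss s x *\<^sub>R (E ((- \<i> * of_real l) * of_real x) * E (of_real (y / s) * of_real x))))"
      unfolding dunkl_transform_L1_def tr
      by (intro Bochner_Integration.integral_cong refl)
         (simp add: Er_dkernel scaleR_conv_of_real flip: of_real_mult of_real_divide)
    also have "\<dots> = of_real (exp (- (y\<^sup>2 / (2 * s)))) *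
       (of_real (s powr (\<kappa> + 1)) * exp (of_real s * ((- \<i> * of_real l)\<^sup>2 + (of_real (y / s))\<^sup>2) / 2) * E (of_real s * (- \<i> * of_real l) * of_real (y / s)))"
      unfolding integral_mult_right_zero gauss_product_integral[OF s] ..
    also have "of_real s * ((- \<i> * of_real l)\<^sup>2 + (of_real (y / s))\<^sup>2) / 2 = complex_of_real (- (s * l\<^sup>2 / 2) + y\<^sup>2 / (2 * s))"
      using s by (simp add: power_mult_distrib power_divide field_simps power2_eq_square)
    also have "of_real s * (- \<i> * of_real l) * complex_of_real (y / s) = - \<i> * of_real l * of_real y"
      using s by simp
    \<comment> \<open>The positive exponent in y cancels the Gaussian prefactor, so that
      \<open>y\<close> survives only inside the kernel.\<close>
    also have "exp (complex_of_real (- (s * l\<^sup>2 / 2) + y\<^sup>2 / (2 * s))) = exp (of_real (- (s * l\<^sup>2 / 2))) * of_real (exp (y\<^sup>2 / (2 * s)))"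
      by (simp only: of_real_add exp_add exp_of_real)
    also have "of_real (exp (- (y\<^sup>2 / (2 * s)))) * (of_real (s powr (\<kappa> + 1)) * (exp (of_real (- (s * l\<^sup>2 / 2))) * of_real (exp (y\<^sup>2 / (2 * s)))) * E (- \<i> * of_real l * of_real y)) =
      of_real (exp (- (y\<^sup>2 / (2 * s))) * exp (y\<^sup>2 / (2 * s))) * (of_real (s powr (\<kappa> + 1)) * exp (of_real (- (s * l\<^sup>2 / 2))) * E (- \<i> * of_real l * of_real y))"
      by (simp only: of_real_mult mult_ac)
    also have "exp (- (y\<^sup>2 / (2 * s))) * exp (y\<^sup>2 / (2 * s)) = 1" by (simp flip: exp_add)
    finally show ?thesis by simp
  qed
  show "D (\<lambda>x. of_real (rtrans (\<lambda>v. v ^ i) y x)) l =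
     E (- \<i> * of_real l * of_real y) * D (\<lambda>x. of_real (rtrans (\<lambda>v. v ^ i) 0 x)) l"
    unfolding key[of y] key[of 0] by simp
qed

lemma good_lincomb:
  assumes h: "admissible C h" "good h" and g: "admissible C' g" "good g"
  shows "good (\<lambda>v. a * h v + g v)" "admissible (\<bar>a\<bar> * C + C') (\<lambda>v. a * h v + g v)"
proof -
  have [measurable]: "h \<in> borel_measurable borel" "g \<in> borel_measurable borel"
    using admissible_measurable h g by auto
  have tr: "rtrans (\<lambda>v. a * h v + g v) y x = a * rtrans h y x + rtrans g y x" for x y
  proof -
    have "rtrans (\<lambda>v. a * h v + g v) y x = (LINT t|dbeta. a * phi h (cosq x y t) + phi g (cosq x y t))"
      unfolding rtrans_def by (intro Bochner_Integration.integral_cong refl) (simp add: phi_def algebra_simps)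
    then show ?thesis
      using integrable_phi_dbeta[OF h(1)] integrable_phi_dbeta[OF g(1)] by (simp add: rtrans_def)
  qed
  have lin: "D (\<lambda>x. of_real (rtrans (\<lambda>v. a * h v + g v) y x)) l =
     of_real a * D (\<lambda>x. of_real (rtrans h y x)) l + D (\<lambda>x. of_real (rtrans g y x)) l" for y l
  proof -
    have "D (\<lambda>x. of_real (rtrans (\<lambda>v. a * h v + g v) y x)) l =
      (LINT x|\<mu>. of_real a * (E (- \<i> * of_real l * of_real x) * of_real (rtrans h y x)) + E (- \<i> * of_real l * of_real x) * of_real (rtrans g y x))"
      unfolding dunkl_transform_L1_def tr
      by (intro Bochner_Integration.integral_cong refl) (simp add: algebra_simps)
    also have "\<dots> = of_real a * D (\<lambda>x. of_real (rtrans h y x)) l + D (\<lambda>x. of_real (rtrans g y x)) l"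
      unfolding dunkl_transform_L1_def
      using D_integrable[OF integrable_rtrans[OF h(1)], of l y] D_integrable[OF integrable_rtrans[OF g(1)], of l y]
      by (subst Bochner_Integration.integral_add) (auto simp only: integral_mult_right_zero intro!: integrable_mult_right)
    finally show ?thesis .
  qed
  show "good (\<lambda>v. a * h v + g v)"
    unfolding good_def
  proof (intro allI)
    fix y l
    have 1: "D (\<lambda>x. of_real (rtrans h y x)) l = E (- \<i> * of_real l * of_real y) * D (\<lambda>x. of_real (rtrans h 0 x)) l"
      and 2: "D (\<lambda>x. of_real (rtrans g y x)) l = E (- \<i> * of_real l * of_real y) * D (\<lambda>x. of_real (rtrans g 0 x)) l"
      using h(2) g(2) unfolding good_def by blast+
    show "D (\<lambda>x. of_real (rtrans (\<lambda>v. a * h v + g v) y x)) l =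
       E (- \<i> * of_real l * of_real y) * D (\<lambda>x. of_real (rtrans (\<lambda>v. a * h v + g v) 0 x)) l"
      unfolding lin[of y l] lin[of 0 l] 1 2 by (simp only: distrib_left mult.left_commute)
  qed
  show "admissible (\<bar>a\<bar> * C + C') (\<lambda>v. a * h v + g v)"
    using h(1) g(1) unfolding admissible_def
    by (auto simp: abs_mult intro!: order_trans[OF abs_triangle_ineq] add_mono mult_left_mono)
qed

text \<open>Dominated convergence twice: in \<open>t\<close> with the constant \<open>C\<close>, in
  \<open>x\<close> with the Gaussian of \<open>rtrans_bound\<close>. The common \<open>C\<close>
  keeps both majorants independent of \<open>n\<close>.\<close>

lemma good_limit:
  assumes hn: "\<And>n::nat. admissible C (h n)" "\<And>n. good (h n)" and h: "admissible C h'"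
    and lim: "\<And>v. v \<in> {0<..1} \<Longrightarrow> (\<lambda>n. h n v) \<longlonglongrightarrow> h' v"
  shows "good h'"
proof -
  have [measurable]: "h n \<in> borel_measurable borel" "h' \<in> borel_measurable borel" for n
    using admissible_measurable hn h by auto
  have tr: "(\<lambda>n. rtrans (h n) y x) \<longlonglongrightarrow> rtrans h' y x" for x y
    unfolding rtrans_def
  proof (rule integral_dominated_convergence[where w = "\<lambda>_. C"])
    show "AE t in dbeta. (\<lambda>n. phi (h n) (cosq x y t)) \<longlonglongrightarrow> phi h' (cosq x y t)"
      using AE_dbeta
    proof eventually_elim
      fix t :: real assume "\<bar>t\<bar> < 1"
      then have "exp (- cosq x y t) \<in> {0<..1}" using cosq_nonneg[of t x y] by simp
      then show "(\<lambda>n. phi (h n) (cosq x y t)) \<longlonglongrightarrow> phi h' (cosq x y t)"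
        unfolding phi_def by (intro tendsto_intros lim)
    qed
    show "AE t in dbeta. norm (phi (h n) (cosq x y t)) \<le> C" for n
      using AE_dbeta by eventually_elim (simp add: phi_bound(2)[OF hn(1)])
  qed (auto simp: phi_def)
  have Dlim: "(\<lambda>n. D (\<lambda>x. of_real (rtrans (h n) y x)) l) \<longlonglongrightarrow> D (\<lambda>x. of_real (rtrans h' y x)) l" for y l
    unfolding dunkl_transform_L1_def
  proof (rule integral_dominated_convergence[where w = "\<lambda>x. C * (exp (y\<^sup>2) * gauss 1 x)"])
    show "integrable \<mu> (\<lambda>x. C * (exp (y\<^sup>2) * gauss 1 x))"
      by (intro integrable_mult_right integrable_gauss) simp
    show "AE x in \<mu>. (\<lambda>n. E (- \<i> * of_real l * of_real x) * of_real (rtrans (h n) y x)) \<longlonglongrightarrow> E (- \<i> * of_real l * of_real x) * of_real (rtrans h' y x)"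
      by (intro AE_I2 tendsto_intros tr)
    show "AE x in \<mu>. norm (E (- \<i> * of_real l * of_real x) * of_real (rtrans (h n) y x)) \<le> C * (exp (y\<^sup>2) * gauss 1 x)" for n
    proof (intro AE_I2)
      fix x
      have "norm (E (- \<i> * of_real l * of_real x) * of_real (rtrans (h n) y x)) \<le> 1 * \<bar>rtrans (h n) y x\<bar>"
        unfolding norm_mult by (intro mult_mono norm_dkernel_real) auto
      also have "\<dots> \<le> C * (exp (y\<^sup>2) * gauss 1 x)" using rtrans_bound[OF hn(1)] by simp
      finally show "norm (E (- \<i> * of_real l * of_real x) * of_real (rtrans (h n) y x)) \<le> C * (exp (y\<^sup>2) * gauss 1 x)" .
    qed
  qed auto
  show ?thesis unfolding good_def
  proof (intro allI)
    fix y l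
    have "(\<lambda>n. E (- \<i> * of_real l * of_real y) * D (\<lambda>x. of_real (rtrans (h n) 0 x)) l) \<longlonglongrightarrow> E (- \<i> * of_real l * of_real y) * D (\<lambda>x. of_real (rtrans h' 0 x)) l"
      by (intro tendsto_mult_left Dlim)
    moreover have "(\<lambda>n. E (- \<i> * of_real l * of_real y) * D (\<lambda>x. of_real (rtrans (h n) 0 x)) l) = (\<lambda>n. D (\<lambda>x. of_real (rtrans (h n) y x)) l)"
      using hn(2) unfolding good_def by metis
    ultimately show "D (\<lambda>x. of_real (rtrans h' y x)) l = E (- \<i> * of_real l * of_real y) * D (\<lambda>x. of_real (rtrans h' 0 x)) l"
      using Dlim[of y l] LIMSEQ_unique by metis
  qed
qed

lemma good_polynomial: "good (\<lambda>v. \<Sum>i<n. a i * v ^ i) \<and> (\<exists>C. admissible C (\<lambda>v. \<Sum>i<n. a i * v ^ i))"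
proof (induction n)
  case 0
  have "admissible 0 (\<lambda>_. 0)" by (simp add: admissible_def)
  moreover have "good (\<lambda>_. 0)" by (simp add: good_def rtrans_def phi_def dunkl_transform_L1_def)
  ultimately show ?case by auto
next
  case (Suc n)
  then obtain C where C: "good (\<lambda>v. \<Sum>i<n. a i * v ^ i)" "admissible C (\<lambda>v. \<Sum>i<n. a i * v ^ i)" by auto
  have m: "admissible 1 (\<lambda>v. v ^ n)" by (auto simp: admissible_def power_abs intro!: power_le_one)
  from good_lincomb[OF m good_monomial C(2,1), of "a n"]
  show ?case by (auto simp: add.commute)
qed

text \<open>Weierstrass approximation on [0, 1]; as the errors are at most 1, \<open>C + 1\<close>
  bounds all approximants.\<close>

lemma good_continuous:
  assumes "continuous_on UNIV h" and C: "\<And>v. v \<in> {0..1} \<Longrightarrow> \<bar>h v\<bar> \<le> C"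
  shows "good h"
proof -
  have [measurable]: "h \<in> borel_measurable borel" by (rule borel_measurable_continuous_onI) fact
  have "\<exists>a m. \<forall>v\<in>{0..1}. \<bar>h v - (\<Sum>i<m. a i * v ^ i)\<bar> < 1 / Suc n" for n
  proof -
    obtain g where g: "real_polynomial_function g" "\<And>x. x \<in> {0..1} \<Longrightarrow> \<bar>h x - g x\<bar> < 1 / Suc n"
      using Stone_Weierstrass_real_polynomial_function[of "{0..1::real}" h "1 / Suc n"] assms(1)
      by (auto intro: continuous_on_subset)
    then obtain a m where "g = (\<lambda>x. \<Sum>i\<le>m. a i * x ^ i)"
      unfolding real_polynomial_function_iff_sum by auto
    then show ?thesis using g(2)
      by (intro exI[of _ a] exI[of _ "Suc m"]) (simp add: lessThan_Suc_atMost del: sum.lessThan_Suc)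
  qed
  then obtain a m where am: "\<And>n v. v \<in> {0..1} \<Longrightarrow> \<bar>h v - (\<Sum>i<m n. a n i * v ^ i)\<bar> < 1 / Suc n"
    by metis
  define p where "p n v = (\<Sum>i<m n. a n i * v ^ i)" for n :: nat and v :: real
  show ?thesis
  proof (rule good_limit[where h = p and C = "C + 1"])
    show "good (p n)" for n unfolding p_def using good_polynomial by blast
    have "\<bar>h v\<bar> \<le> C + 1" if "v \<in> {0<..1}" for v using C[of v] that by auto
    then show "admissible (C + 1) h" by (simp add: admissible_def)
    show "admissible (C + 1) (p n)" for n
    proof -
      have "\<bar>p n v\<bar> \<le> C + 1" if "v \<in> {0<..1}" for v
      proof -
        have "\<bar>h v - p n v\<bar> < 1 / Suc n" using am[of v n] that by (simp add: p_def)
        moreover have "1 / real (Suc n) \<le> 1" by simp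
        moreover have "\<bar>h v\<bar> \<le> C" using C[of v] that by auto
        ultimately show ?thesis by linarith
      qed
      moreover have "p n \<in> borel_measurable borel"
        unfolding p_def by measurable
      ultimately show ?thesis by (simp add: admissible_def)
    qed
    show "(\<lambda>n. p n v) \<longlonglongrightarrow> h v" if "v \<in> {0<..1}" for v
    proof (rule LIM_zero_cancel, rule tendsto_rabs_zero_cancel, rule tendsto_sandwich[of "\<lambda>_. 0" _ _ "\<lambda>n. 1 / Suc n"])
      show "\<forall>\<^sub>F n in sequentially. \<bar>p n v - h v\<bar> \<le> 1 / Suc n"
        using am[of v] that by (intro always_eventually allI) (simp add: p_def abs_minus_commute less_imp_le)
      show "(\<lambda>n. 1 / real (Suc n)) \<longlonglongrightarrow> 0" by (rule LIMSEQ_Suc[OF lim_1_over_n])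
    qed auto
  qed
qed

text \<open>The quotient \<open>1 / v\<close> undoes the factor exp (- u) in \<open>phi\<close>,
  which leaves a plain indicator.\<close>

definition hcut :: "real \<Rightarrow> real \<Rightarrow> real" where
  "hcut R v = (if exp (- R) < v then 1 / v else 0)"

lemma phi_hcut: "phi (hcut R) u = indicator {..<R} u"
  by (auto simp: phi_def hcut_def indicator_def)

lemma admissible_hcut: "admissible (exp R) (hcut R)"
proof -
  have "1 / v \<le> exp R" if "exp (- R) < v" for v
  proof -
    have "0 < v" using that exp_gt_zero[of "- R"] by linarith
    then have "1 / v \<le> 1 / exp (- R)" using that by (intro divide_left_mono) auto
    then show ?thesis by (simp add: exp_minus inverse_eq_divide)
  qed
  then have "\<bar>hcut R v\<bar> \<le> exp R" if "v \<in> {0<..1}" for v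
    using that by (auto simp: hcut_def)
  moreover have "hcut R \<in> borel_measurable borel" unfolding hcut_def by measurable
  ultimately show ?thesis by (simp add: admissible_def)
qed

lemma good_hcut: "good (hcut R)"
proof -
  let ?v0 = "exp (- R)"
  \<comment> \<open>A ramp of slope \<open>n\<close> that starts at the jump, divided by
    \<open>max v ?v0\<close> so that the quotient stays below \<open>exp R\<close>. At the jump
    itself every \<open>h n\<close> vanishes, as \<open>hcut R\<close> does, so convergence holds
    there too.\<close>
  define h where "h n v = min 1 (real n * max 0 (v - ?v0)) / max v ?v0" for n :: nat and v
  have v0: "max v ?v0 > 0" for v using exp_gt_zero[of "- R"] by (simp add: less_max_iff_disj)
  have b: "\<bar>h n v\<bar> \<le> exp R" for n v
  proof -
    have "\<bar>h n v\<bar> = min 1 (real n * max 0 (v - ?v0)) / max v ?v0"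
      unfolding h_def using v0[of v] by (intro abs_of_nonneg divide_nonneg_pos) auto
    also have "\<dots> \<le> 1 / ?v0" by (intro frac_le) auto
    finally show ?thesis by (simp add: exp_minus inverse_eq_divide)
  qed
  have cont: "continuous_on UNIV (h n)" for n
    unfolding h_def using v0 by (intro continuous_intros) (metis less_irrefl)
  show ?thesis
  proof (rule good_limit[where h = h, OF _ _ admissible_hcut])
    show "good (h n)" for n by (rule good_continuous[OF cont b])
    show "admissible (exp R) (h n)" for n
      using cont b by (simp add: admissible_def borel_measurable_continuous_onI)
    show "(\<lambda>n. h n v) \<longlonglongrightarrow> hcut R v" for v
    proof (cases "?v0 < v")
      case True
      then obtain N :: nat where N: "1 < real N * (v - ?v0)"
        using reals_Archimedean3[of "v - ?v0"] by auto
      have "h n v = hcut R v" if "n \<ge> N" for n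
      proof -
        have "real N * (v - ?v0) \<le> real n * (v - ?v0)" using that True by (intro mult_right_mono) auto
        then have "1 \<le> real n * (v - ?v0)" using N by linarith
        then show ?thesis using True by (simp add: h_def hcut_def max_def min_absorb1)
      qed
      then show ?thesis by (intro tendsto_eventually eventually_sequentiallyI[of N])
    next
      case False
      then have "h n v = hcut R v" for n by (simp add: h_def hcut_def)
      then show ?thesis by simp
    qed
  qed
qed

section \<open>The translate of the indicator of a ball\<close>

definition K :: "real \<Rightarrow> real \<Rightarrow> real \<Rightarrow> real" where
  "K r x y = rtrans (hcut (r\<^sup>2)) y x"

lemma K_eq: "K r x y = (LINT t|dbeta. indicator {..<r\<^sup>2} (cosq x y t))"
  by (simp add: K_def rtrans_def phi_hcut)

lemma measurable_K [measurable (raw)]: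
  assumes "f \<in> borel_measurable M" "g \<in> borel_measurable M"
  shows "(\<lambda>z. K r (f z) (g z)) \<in> borel_measurable M"
  unfolding K_def by (intro measurable_rtrans admissible_measurable[OF admissible_hcut] assms)

lemma K_sym: "K r x y = K r y x"
  by (simp add: K_eq cosq_def ac_simps)

lemma K_minus: "K r (- x) y = K r x (- y)"
  by (simp add: K_eq cosq_def)

lemma K_nonneg [simp]: "0 \<le> K r x y"
  unfolding K_eq by (intro integral_nonneg_AE) auto

lemma K_le_1 [simp]: "K r x y \<le> 1"
proof -
  have "K r x y \<le> (LINT t|dbeta. 1)"
    unfolding K_eq
    by (intro integral_mono integrable_dbeta[where B = 1]) (auto simp: indicator_def)
  then show ?thesis by simp
qed

lemma K_eq_0:
  assumes "0 \<le> r" "r \<le> \<bar>\<bar>x\<bar> - \<bar>y\<bar>\<bar>"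
  shows "K r x y = 0"
proof -
  have "r\<^sup>2 \<le> (\<bar>x\<bar> - \<bar>y\<bar>)\<^sup>2" using power_mono[OF assms(2,1), of 2] by simp
  then have "K r x y = (LINT t|dbeta. 0)"
    unfolding K_eq using AE_dbeta
    by (intro integral_cong_AE) (auto elim!: eventually_mono simp: indicator_def not_less intro: order_trans[OF _ cosq_bounds(1)])
  then show ?thesis by simp
qed

lemma K_eq_1:
  assumes "\<bar>x\<bar> + \<bar>y\<bar> < r"
  shows "K r x y = 1"
proof -
  have "(\<bar>x\<bar> + \<bar>y\<bar>)\<^sup>2 < r\<^sup>2" using assms by (intro power_strict_mono) auto
  then have "K r x y = (LINT t|dbeta. 1)"
    unfolding K_eq using AE_dbeta
    by (intro integral_cong_AE) (auto elim!: eventually_mono simp: indicator_def intro: le_less_trans[OF cosq_bounds(2)])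
  then show ?thesis by simp
qed

lemma K_0: "0 < r \<Longrightarrow> K r x 0 = indicator {- r<..<r} x"
  using K_eq_0[of r x 0] K_eq_1[of x 0 r] by (auto simp: indicator_def abs_less_iff)

lemma integrable_K: "integrable \<mu> (\<lambda>x. complex_of_real (K r x y))"
  unfolding K_def by (rule integrable_rtrans[OF admissible_hcut])

lemma D_K: "0 < r \<Longrightarrow> D (\<lambda>x. of_real (K r x y)) l = E (- \<i> * of_real l * of_real y) * D (indicator {- r<..<r}) l"
proof -
  assume r: "0 < r"
  have eq: "(\<lambda>x. complex_of_real (K r x 0)) = indicator {- r<..<r}"
    by (auto simp: K_0[OF r] indicator_def)
  have "D (\<lambda>x. of_real (K r x y)) l = E (- \<i> * of_real l * of_real y) * D (\<lambda>x. of_real (K r x 0)) l"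
    using good_hcut[of "r\<^sup>2"] unfolding good_def K_def by blast
  then show ?thesis unfolding eq .
qed

text \<open>The product formula at frequency 0, where the Dunkl kernel is 1.\<close>

lemma K_mass:
  assumes r: "0 < r"
  shows "(\<integral>\<^sup>+x. ennreal (K r x y) \<partial>\<mu>) = emeasure \<mu> {- r<..<r}"
proof -
  have fin: "emeasure \<mu> {- r<..<r} < \<infinity>"
    by (rule le_less_trans[OF emeasure_mono emeasure_mu_bounded[of "- r" r]]) auto
  have i: "integrable \<mu> (\<lambda>x. K r x y)" using integrable_K complex_of_real_integrable_eq by blast
  have "complex_of_real (LINT x|\<mu>. K r x y) = D (\<lambda>x. of_real (K r x y)) 0"
    by (simp add: dunkl_transform_L1_def)
  also have "\<dots> = D (indicator {- r<..<r}) 0"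
    by (subst D_K[OF r]) simp
  also have "\<dots> = (LINT x|\<mu>. complex_of_real (indicator {- r<..<r} x))"
    unfolding dunkl_transform_L1_def by (intro Bochner_Integration.integral_cong refl) (simp add: indicator_def)
  also have "\<dots> = complex_of_real (LINT x|\<mu>. indicator {- r<..<r} x)"
    by (rule integral_complex_of_real)
  finally have "(LINT x|\<mu>. K r x y) = measure \<mu> {- r<..<r}"
    by (simp only: of_real_eq_iff) simp
  then show ?thesis
    using i fin by (simp add: nn_integral_eq_integral emeasure_eq_ennreal_measure)
qed

lemma N2_K: "N2 (\<lambda>x. complex_of_real (K r x y)) < \<infinity>"
proof -
  have "N2 (\<lambda>x. complex_of_real (K r x y)) \<le> (\<integral>\<^sup>+x. ennreal (norm (complex_of_real (K r x y))) \<partial>\<mu>)"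
    unfolding N2_def by (intro nn_integral_mono ennreal_leI) (simp add: power2_eq_square mult_left_le)
  also have "\<dots> < \<infinity>" using integrable_K[of r y] by (simp add: integrable_iff_bounded)
  finally show ?thesis .
qed

text \<open>\<open>K\<close> meets the condition inside the \<open>SOME\<close> of the definition,
  so the chosen function meets it as well, and injectivity of the transform identifies the two.
  Translating by \<open>- y\<close> multiplies by the kernel at - i x y, which is the sign in
  \<open>D_K\<close>.\<close>

theorem dunkl_translation_indicator:
  assumes r: "0 < r"
  shows "AE x in \<mu>. dunkl_translation \<kappa> (- y) (indicator (dunkl_ball 0 r)) x = of_real (K r x y)"
proof -
  let ?\<chi> = "indicator (dunkl_ball 0 r) :: real \<Rightarrow> complex"
  let ?k = "\<lambda>x. complex_of_real (K r x y)"
  have \<chi>: "?\<chi> = (\<lambda>x. complex_of_real (K r x 0))"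
    by (auto simp: K_0[OF r] indicator_def dunkl_ball_def)
  have kL: "?k \<in> Lp_space \<mu> 2" using N2_K by (simp add: Lp_space_2_iff)
  have "AE x in \<mu>. dunkl_transform_L2 \<kappa> ?k x = dunkl_kernel \<kappa> (\<i> * of_real x * of_real (- y)) * dunkl_transform_L2 \<kappa> ?\<chi> x"
    using L2_transform_eq_L1[OF integrable_K N2_K, of r y] L2_transform_eq_L1[OF integrable_K N2_K, of r 0]
  proof eventually_elim
    case (elim x)
    have "dunkl_transform_L2 \<kappa> ?\<chi> x = D (indicator {- r<..<r}) x"
      using elim(2) D_K[OF r, of 0 x] unfolding \<chi> by simp
    then show ?case using elim(1) D_K[OF r, of y x] by simp
  qed
  then have "?k \<in> Lp_space \<mu> 2 \<and> (AE x in \<mu>. dunkl_transform_L2 \<kappa> ?k x = dunkl_kernel \<kappa> (\<i> * of_real x * of_real (- y)) * dunkl_transform_L2 \<kappa> ?\<chi> x)"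
    using kL by simp
  note ex = this
  have "dunkl_translation \<kappa> (- y) ?\<chi> \<in> Lp_space \<mu> 2 \<and> (AE x in \<mu>. dunkl_transform_L2 \<kappa> (dunkl_translation \<kappa> (- y) ?\<chi>) x =
      dunkl_kernel \<kappa> (\<i> * of_real x * of_real (- y)) * dunkl_transform_L2 \<kappa> ?\<chi> x)"
    unfolding dunkl_translation_def by (rule someI[where P = "\<lambda>h. h \<in> Lp_space \<mu> 2 \<and> (AE x in \<mu>. dunkl_transform_L2 \<kappa> h x =
      dunkl_kernel \<kappa> (\<i> * of_real x * of_real (- y)) * dunkl_transform_L2 \<kappa> ?\<chi> x)", OF ex])
  then have tr: "dunkl_translation \<kappa> (- y) ?\<chi> \<in> Lp_space \<mu> 2" and
    eq: "AE x in \<mu>. dunkl_transform_L2 \<kappa> (dunkl_translation \<kappa> (- y) ?\<chi>) x =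
      dunkl_kernel \<kappa> (\<i> * of_real x * of_real (- y)) * dunkl_transform_L2 \<kappa> ?\<chi> x"
    by blast+
  show ?thesis
    by (rule L2_transform_inj[OF tr kL]) (use eq ex[THEN conjunct2] in eventually_elim, simp)
qed

end

section \<open>Averages over balls\<close>

lemma ennpowr_add_le:
  assumes s: "0 < s"
  shows "ennpowr (u + v) s \<le> ennreal (2 powr s) * (ennpowr u s + ennpowr v s)"
proof -
  have "u + v \<le> 2 * max u v" by (simp add: mult_2 add_mono)
  then have "ennpowr (u + v) s \<le> ennpowr (2 * max u v) s" by (rule ennpowr_mono[OF s])
  also have "\<dots> = ennreal (2 powr s) * ennpowr (max u v) s"
    using ennpowr_ennreal[of 2 s] by (simp add: ennpowr_mult[OF s])
  also have "ennpowr (max u v) s \<le> ennpowr u s + ennpowr v s"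
    by (simp add: max_def add_increasing add_increasing2)
  finally show ?thesis by (simp add: mult_left_mono)
qed

lemma ennpowr_le_mult:
  assumes "1 \<le> s" "a \<le> G" "G < top"
  shows "ennpowr a s \<le> ennpowr G (s - 1) * a"
proof -
  obtain x y where xy: "a = ennreal x" "G = ennreal y" "0 \<le> x" "0 \<le> y" "x \<le> y"
    using assms by (cases a; cases G) (auto simp: top_unique)
  have "x powr s \<le> y powr (s - 1) * x"
  proof (cases "x = 0")
    case False
    then have "x powr s = x powr (s - 1) * x" using xy powr_add[of x "s - 1" 1] by simp
    also have "\<dots> \<le> y powr (s - 1) * x" using assms xy by (intro mult_right_mono powr_mono2) auto
    finally show ?thesis .
  qed simp
  then show ?thesis using xy by (simp add: ennpowr_ennreal flip: ennreal_mult)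
qed

text \<open>A convex power lies above its tangent at \<open>m\<close>, by Young's inequality with
  weights 1 / s and 1 - 1 / s. The terms are arranged additively because subtraction in
  \<open>ennreal\<close> is truncated.\<close>

lemma ennpowr_tangent:
  assumes s: "1 \<le> s" and m: "0 \<le> m"
  shows "ennreal (s * m powr (s - 1)) * u \<le> ennpowr u s + ennreal ((s - 1) * m powr s)"
proof (cases u)
  case (real x)
  have "s * m powr (s - 1) * x \<le> x powr s + (s - 1) * m powr s"
  proof (cases "s = 1 \<or> x = 0 \<or> m = 0")
    case True
    then show ?thesis using real m s by (cases "m = 0") auto
  next
    case False
    then have s1: "s > 1" "x > 0" "m > 0" using s m real by auto
    have "(x powr s) powr (1 / s) * (m powr s) powr (1 - 1 / s) \<le> 1 / s * x powr s + (1 - 1 / s) * m powr s"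
      using s1 Youngs_inequality_0[of "1 / s" "1 - 1 / s" "x powr s" "m powr s"] by simp
    moreover have "(x powr s) powr (1 / s) = x" using s1 real by (simp add: powr_powr)
    moreover have "(m powr s) powr (1 - 1 / s) = m powr (s - 1)"
      using s1 by (simp add: powr_powr right_diff_distrib)
    ultimately have "s * (x * m powr (s - 1)) \<le> s * (1 / s * x powr s + (1 - 1 / s) * m powr s)"
      using s1 by (intro mult_left_mono) auto
    also have "\<dots> = x powr s + (s - 1) * m powr s" using s1 by (simp add: field_simps)
    finally show ?thesis by (simp add: ac_simps)
  qed
  then have "ennreal (s * m powr (s - 1) * x) \<le> ennreal (x powr s + (s - 1) * m powr s)"
    by (rule ennreal_leI)
  then show ?thesis
    using real s m by (simp add: ennpowr_ennreal ennreal_mult ennreal_plus)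
qed simp

lemma Lp_norm_top: "Lp_norm M \<infinity> g = esssup M g" "Lp_norm M top g = esssup M g"
  by (simp_all add: Lp_norm_def)

lemma one_divide_ennreal: "1 \<le> P \<Longrightarrow> 1 / ennreal P = ennreal (1 / P)"
  by (metis divide_ennreal ennreal_1 zero_le_one less_le_trans zero_less_one)

lemma enn2real_one_divide: "1 \<le> P \<Longrightarrow> enn2real (1 / ennreal P) = 1 / P"
  by (simp add: one_divide_ennreal)

lemma Lp_norm_real:
  assumes "1 \<le> P"
  shows "Lp_norm M (ennreal P) g = ennpowr (\<integral>\<^sup>+x. ennpowr (g x) P \<partial>M) (1 / P)"
  using assms by (simp add: Lp_norm_def enn2real_one_divide)

lemma ennreal_exponent_cases:
  assumes "1 \<le> (p :: ennreal)"
  obtains (infinite) "p = \<infinity>" "enn2real (1 / p) = 0"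
  | (finite) P where "p = ennreal P" "1 \<le> P" "enn2real p = P" "enn2real (1 / p) = 1 / P"
proof (cases p)
  case (real P)
  then have "1 \<le> P" using assms by (metis ennreal_1 ennreal_le_iff)
  then show ?thesis using finite[of P] real by (simp add: enn2real_one_divide)
next
  case top
  then show ?thesis using infinite by (simp add: infinity_ennreal_def)
qed

section \<open>Averages with the explicit kernel\<close>

context dunkl begin

definition V :: "real \<Rightarrow> real" where "V r = measure \<mu> {- r<..<r}"

lemma emeasure_V: "emeasure \<mu> {- r<..<r} = ennreal (V r)"
proof -
  have "emeasure \<mu> {- r<..<r} < \<infinity>"
    by (rule le_less_trans[OF emeasure_mono emeasure_mu_bounded[of "- r" r]]) auto
  then show ?thesis unfolding V_def by (intro emeasure_eq_ennreal_measure) auto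
qed

lemma V_pos: "0 < r \<Longrightarrow> 0 < V r"
  using emeasure_mu_pos[of "- r" r] by (simp add: emeasure_V)

lemma V_half:
  assumes "0 < r"
  shows "V (r / 2) = (1 / 2) powr (2 * \<kappa> + 2) * V r"
proof -
  have "ennreal (V (r / 2)) = ennreal ((1 / 2) powr (2 * \<kappa> + 2) * V r)"
    using emeasure_mu_ball_scale[of "1 / 2" r] V_pos[OF assms]
    by (simp add: emeasure_V ennreal_mult)
  then show ?thesis using V_pos[OF assms] V_pos[of "r / 2"] assms by (simp add: ennreal_inj)
qed

definition avg :: "real \<Rightarrow> (real \<Rightarrow> ennreal) \<Rightarrow> real \<Rightarrow> ennreal" where
  "avg r g y = (\<integral>\<^sup>+x. g x * ennreal (K r x y) \<partial>\<mu>)"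

text \<open>This removes the choice operators: for each fixed \<open>y\<close> the two integrands
  agree off a null set of \<open>x\<close>.\<close>

lemma dunkl_average_eq: "0 < r \<Longrightarrow> dunkl_average \<kappa> r g y = avg r g y"
  unfolding dunkl_average_def avg_def
proof (intro nn_integral_cong_AE)
  assume "0 < r"
  from dunkl_translation_indicator[OF this, of y]
  show "AE x in \<mu>. g x * ennreal (Re (dunkl_translation \<kappa> (- y) (indicator (dunkl_ball 0 r)) x)) = g x * ennreal (K r x y)"
    by eventually_elim simp
qed

lemma measurable_avg [measurable]:
  assumes "g \<in> borel_measurable borel"
  shows "avg r g \<in> borel_measurable borel"
proof -
  have [measurable]: "g \<in> borel_measurable borel" by fact
  show ?thesis unfolding avg_def by measurable
qed

lemma avg_mono: "(\<And>x. g x \<le> h x) \<Longrightarrow> avg r g y \<le> avg r h y"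
  unfolding avg_def by (intro nn_integral_mono mult_right_mono) auto

lemma avg_le: "avg r g y \<le> (\<integral>\<^sup>+x. g x \<partial>\<mu>)"
  unfolding avg_def by (intro nn_integral_mono) (simp add: mult_left_le)

lemma avg_const: "0 < r \<Longrightarrow> avg r (\<lambda>_. c) y = c * ennreal (V r)"
  unfolding avg_def by (subst nn_integral_cmult) (auto simp: K_mass emeasure_V)

lemma avg_total:
  assumes [measurable]: "g \<in> borel_measurable borel" and r: "0 < r"
  shows "(\<integral>\<^sup>+y. avg r g y \<partial>\<mu>) = (\<integral>\<^sup>+x. g x \<partial>\<mu>) * ennreal (V r)"
proof -
  have "(\<integral>\<^sup>+y. avg r g y \<partial>\<mu>) = (\<integral>\<^sup>+x. (\<integral>\<^sup>+y. g x * ennreal (K r x y) \<partial>\<mu>) \<partial>\<mu>)"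
    unfolding avg_def by (rule mu2.Fubini') measurable
  also have "\<dots> = (\<integral>\<^sup>+x. g x * ennreal (V r) \<partial>\<mu>)"
  proof (intro nn_integral_cong)
    fix x
    have "(\<integral>\<^sup>+y. g x * ennreal (K r x y) \<partial>\<mu>) = g x * (\<integral>\<^sup>+y. ennreal (K r y x) \<partial>\<mu>)"
      by (subst K_sym) (rule nn_integral_cmult, measurable)
    then show "(\<integral>\<^sup>+y. g x * ennreal (K r x y) \<partial>\<mu>) = g x * ennreal (V r)"
      by (simp add: K_mass[OF r] emeasure_V)
  qed
  also have "\<dots> = (\<integral>\<^sup>+x. g x \<partial>\<mu>) * ennreal (V r)"
    by (rule nn_integral_multc) simp
  finally show ?thesis .
qed

text \<open>If both points are within \<open>r / 2\<close> of the origin, \<open>K_eq_1\<close>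
  applies.\<close>

lemma avg_ge:
  assumes "\<bar>y\<bar> < r / 2"
  shows "(\<integral>\<^sup>+x. g x * indicator {- (r / 2)<..<r / 2} x \<partial>\<mu>) \<le> avg r g y"
  unfolding avg_def
proof (intro nn_integral_mono)
  fix x
  show "g x * indicator {- (r / 2)<..<r / 2} x \<le> g x * ennreal (K r x y)"
  proof (cases "x \<in> {- (r / 2)<..<r / 2}")
    case True
    then have "\<bar>x\<bar> < r / 2" by auto
    then have "\<bar>x\<bar> + \<bar>y\<bar> < r" using assms by linarith
    then show ?thesis using True by (simp add: K_eq_1)
  qed simp
qed

text \<open>Jensen's inequality: the tangent inequality is averaged, and the point of tangency is
  then taken to be the mean itself.\<close>

lemma avg_jensen:
  assumes [measurable]: "g \<in> borel_measurable borel" and r: "0 < r" and s: "1 \<le> s"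
  shows "ennpowr (avg r g y / ennreal (V r)) s \<le> avg r (\<lambda>x. ennpowr (g x) s) y / ennreal (V r)"
proof -
  have V: "0 < V r" by (rule V_pos[OF r])
  let ?A = "avg r g y / ennreal (V r)" and ?B = "avg r (\<lambda>x. ennpowr (g x) s) y / ennreal (V r)"
  have tang: "ennreal (s * m powr (s - 1)) * ?A \<le> ?B + ennreal ((s - 1) * m powr s)" if m: "0 \<le> m" for m
  proof -
    have "ennreal (s * m powr (s - 1)) * avg r g y = (\<integral>\<^sup>+x. (ennreal (s * m powr (s - 1)) * g x) * ennreal (K r x y) \<partial>\<mu>)"
      unfolding avg_def by (subst nn_integral_cmult[symmetric]) (auto simp: mult.assoc)
    also have "\<dots> \<le> (\<integral>\<^sup>+x. (ennpowr (g x) s + ennreal ((s - 1) * m powr s)) * ennreal (K r x y) \<partial>\<mu>)"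
      by (intro nn_integral_mono mult_right_mono ennpowr_tangent s m) simp
    also have "\<dots> = avg r (\<lambda>x. ennpowr (g x) s) y + avg r (\<lambda>_. ennreal ((s - 1) * m powr s)) y"
      unfolding avg_def by (simp add: distrib_right nn_integral_add)
    also have "\<dots> = avg r (\<lambda>x. ennpowr (g x) s) y + ennreal ((s - 1) * m powr s) * ennreal (V r)"
      by (simp add: avg_const[OF r])
    finally have "ennreal (s * m powr (s - 1)) * avg r g y / ennreal (V r) \<le>
        (avg r (\<lambda>x. ennpowr (g x) s) y + ennreal ((s - 1) * m powr s) * ennreal (V r)) / ennreal (V r)"
      by (rule divide_right_mono_ennreal)
    also have "\<dots> = ?B + ennreal ((s - 1) * m powr s)"
      using V by (simp add: add_divide_distrib_ennreal mult_divide_eq_ennreal)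
    finally show ?thesis by (simp add: ennreal_times_divide)
  qed
  show ?thesis
  proof (cases ?B)
    case (real b)
    \<comment> \<open>The tangent at 1 shows that the mean is finite and hence may serve as a point
      of tangency.\<close>
    have "ennreal (s * 1 powr (s - 1)) * ?A < top"
      using tang[of 1] real by (auto intro: le_less_trans)
    then have "?A \<noteq> top" using s by (auto simp: ennreal_mult_less_top less_top)
    then obtain a where a: "?A = ennreal a" "0 \<le> a" by (cases ?A) auto
    have "ennreal (s * a powr (s - 1) * a) \<le> ennreal (b + (s - 1) * a powr s)"
      using tang[OF a(2)] real s a by (simp add: ennreal_mult ennreal_plus)
    then have "s * a powr (s - 1) * a \<le> b + (s - 1) * a powr s"
      using real s by (subst (asm) ennreal_le_iff) auto
    moreover have "a powr (s - 1) * a = a powr s"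
      using a(2) powr_add[of a "s - 1" 1] by (cases "a = 0") auto
    ultimately have "s * a powr s \<le> b + (s - 1) * a powr s" by (simp only: mult.assoc)
    then have "a powr s \<le> b" by (simp add: left_diff_distrib)
    then show ?thesis using real a by (simp add: ennpowr_ennreal ennreal_leI)
  qed simp
qed

section \<open>Averages over shrinking balls\<close>

definition ker :: "nat \<Rightarrow> real" where "ker n = 1 / real (Suc n)"

lemma ker_pos [simp]: "0 < ker n" by (simp add: ker_def)

lemma V_ker_pos [simp]: "0 < V (ker n)" by (simp add: V_pos)

lemma V_ker_div [simp]: "ennreal (V (ker n)) / ennreal (V (ker n)) = 1"
  by (rule ennreal_divide_self) (simp_all add: ennreal_eq_0_iff not_le)

text \<open>The first moment is at most the radius, since the kernel vanishes unless |x| and |y|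
  differ by less than that. In \<open>T_bound\<close> the 2 counts the two signs.\<close>

sublocale avgk: concentrating_kernel \<kappa> abs "\<lambda>n x y. ennreal (K (ker n) x y) / ennreal (V (ker n))" ker
proof
  show "(\<integral>\<^sup>+x. u \<bar>x\<bar> \<partial>\<mu>) \<le> 2 * (\<integral>\<^sup>+x. u x \<partial>\<mu>)" if [measurable]: "u \<in> borel_measurable borel" for u
  proof -
    have "(\<integral>\<^sup>+x. u \<bar>x\<bar> \<partial>\<mu>) \<le> (\<integral>\<^sup>+x. u x + u (- x) \<partial>\<mu>)"
      by (intro nn_integral_mono) (auto simp: abs_if add_increasing add_increasing2)
    also have "\<dots> = 2 * (\<integral>\<^sup>+x. u x \<partial>\<mu>)"
      by (simp add: nn_integral_add nn_integral_mu_minus mult_2)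
    finally show ?thesis .
  qed
  show mass: "(\<integral>\<^sup>+y. ennreal (K (ker n) x y) / ennreal (V (ker n)) \<partial>\<mu>) \<le> 1" for n x
    by (subst K_sym, subst nn_integral_divide) (auto simp: K_mass emeasure_V)
  show "ennreal (K (ker n) x y) / ennreal (V (ker n)) = ennreal (K (ker n) y x) / ennreal (V (ker n))" for n x y
    by (subst K_sym) (rule refl)
  show "(\<integral>\<^sup>+y. ennreal \<bar>\<bar>x\<bar> - \<bar>y\<bar>\<bar> * (ennreal (K (ker n) x y) / ennreal (V (ker n))) \<partial>\<mu>) \<le> ennreal (ker n)" for n x
  proof -
    have "(\<integral>\<^sup>+y. ennreal \<bar>\<bar>x\<bar> - \<bar>y\<bar>\<bar> * (ennreal (K (ker n) x y) / ennreal (V (ker n))) \<partial>\<mu>) \<le>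
      (\<integral>\<^sup>+y. ennreal (ker n) * (ennreal (K (ker n) x y) / ennreal (V (ker n))) \<partial>\<mu>)"
    proof (intro nn_integral_mono)
      fix y
      show "ennreal \<bar>\<bar>x\<bar> - \<bar>y\<bar>\<bar> * (ennreal (K (ker n) x y) / ennreal (V (ker n))) \<le> ennreal (ker n) * (ennreal (K (ker n) x y) / ennreal (V (ker n)))"
      proof (cases "ker n \<le> \<bar>\<bar>x\<bar> - \<bar>y\<bar>\<bar>")
        case True
        then show ?thesis using K_eq_0[of "ker n" x y] ker_pos[of n] by (simp add: less_imp_le)
      next
        case False
        then show ?thesis by (intro mult_right_mono ennreal_leI) auto
      qed
    qed
    also have "\<dots> = ennreal (ker n) * (\<integral>\<^sup>+y. ennreal (K (ker n) x y) / ennreal (V (ker n)) \<partial>\<mu>)"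
      by (rule nn_integral_cmult) measurable
    also have "\<dots> \<le> ennreal (ker n) * 1" by (intro mult_left_mono mass) simp
    finally show ?thesis by simp
  qed
  show "ker \<longlonglongrightarrow> 0" unfolding ker_def by (rule LIMSEQ_Suc[OF lim_1_over_n])
  show "0 \<le> ker n" for n by (simp add: less_imp_le)
qed auto

text \<open>For even \<open>h\<close> this is the inner integral of \<open>avgk.osc\<close>, kept as
  a function of the point so that it can act as a pointwise error term.\<close>

definition oscp :: "nat \<Rightarrow> (real \<Rightarrow> real) \<Rightarrow> real \<Rightarrow> ennreal" where
  "oscp n h y = (\<integral>\<^sup>+x. ennreal \<bar>h y - h x\<bar> * (ennreal (K (ker n) y x) / ennreal (V (ker n))) \<partial>\<mu>)"

lemma measurable_oscp [measurable]:
  assumes "h \<in> borel_measurable borel"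
  shows "oscp n h \<in> borel_measurable borel"
proof -
  have [measurable]: "h \<in> borel_measurable borel" by fact
  show ?thesis unfolding oscp_def by measurable
qed

lemma oscp_tendsto:
  assumes h: "integrable \<mu> h" and even: "\<And>x. h \<bar>x\<bar> = h x"
  shows "(\<lambda>n. \<integral>\<^sup>+y. oscp n h y \<partial>\<mu>) \<longlonglongrightarrow> 0"
  using avgk.osc_tendsto_0[OF h] unfolding avgk.osc_def oscp_def by (simp add: even)

lemma le_avg_oscp:
  assumes [measurable]: "h \<in> borel_measurable borel" and nn: "\<And>x. 0 \<le> h x"
  shows "ennreal (h y) \<le> avg (ker n) (\<lambda>x. ennreal (h x)) y / ennreal (V (ker n)) + oscp n h y"
proof -
  let ?k = "\<lambda>x. ennreal (K (ker n) x y) / ennreal (V (ker n))"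
  have "ennreal (h y) = ennreal (h y) * (\<integral>\<^sup>+x. ?k x \<partial>\<mu>)"
    by (subst nn_integral_divide) (auto simp: K_mass emeasure_V)
  also have "\<dots> = (\<integral>\<^sup>+x. ennreal (h y) * ?k x \<partial>\<mu>)"
    by (rule nn_integral_cmult[symmetric]) measurable
  also have "\<dots> \<le> (\<integral>\<^sup>+x. ennreal (h x) * ?k x + ennreal \<bar>h y - h x\<bar> * ?k x \<partial>\<mu>)"
  proof (intro nn_integral_mono)
    fix x
    have "ennreal (h y) \<le> ennreal (h x + \<bar>h y - h x\<bar>)" by (intro ennreal_leI) linarith
    also have "\<dots> = ennreal (h x) + ennreal \<bar>h y - h x\<bar>" using nn by (simp add: ennreal_plus)
    finally show "ennreal (h y) * ?k x \<le> ennreal (h x) * ?k x + ennreal \<bar>h y - h x\<bar> * ?k x"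
      unfolding distrib_right[symmetric] by (rule mult_right_mono) simp
  qed
  also have "\<dots> = (\<integral>\<^sup>+x. ennreal (h x) * ?k x \<partial>\<mu>) + (\<integral>\<^sup>+x. ennreal \<bar>h y - h x\<bar> * ?k x \<partial>\<mu>)"
    by (rule nn_integral_add) measurable
  also have "(\<integral>\<^sup>+x. ennreal (h x) * ?k x \<partial>\<mu>) = avg (ker n) (\<lambda>x. ennreal (h x)) y / ennreal (V (ker n))"
    unfolding avg_def ennreal_times_divide by (rule nn_integral_divide) measurable
  also have "(\<integral>\<^sup>+x. ennreal \<bar>h y - h x\<bar> * ?k x \<partial>\<mu>) = oscp n h y"
    unfolding oscp_def by (subst K_sym) (rule refl)
  finally show ?thesis .
qed

lemma oscp_bound:
  assumes "\<And>x. 0 \<le> h x" "\<And>x. h x \<le> B" and [measurable]: "h \<in> borel_measurable borel"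
  shows "oscp n h y \<le> ennreal B"
proof -
  have "oscp n h y \<le> (\<integral>\<^sup>+x. ennreal B * (ennreal (K (ker n) x y) / ennreal (V (ker n))) \<partial>\<mu>)"
    unfolding oscp_def
  proof (intro nn_integral_mono)
    fix x
    have "\<bar>h y - h x\<bar> \<le> B" using assms(1)[of x] assms(1)[of y] assms(2)[of x] assms(2)[of y] by linarith
    then show "ennreal \<bar>h y - h x\<bar> * (ennreal (K (ker n) y x) / ennreal (V (ker n))) \<le> ennreal B * (ennreal (K (ker n) x y) / ennreal (V (ker n)))"
      by (subst K_sym) (intro mult_right_mono ennreal_leI, auto)
  qed
  also have "\<dots> = ennreal B * (\<integral>\<^sup>+x. ennreal (K (ker n) x y) / ennreal (V (ker n)) \<partial>\<mu>)"
    by (rule nn_integral_cmult) measurable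
  also have "\<dots> = ennreal B"
    by (subst nn_integral_divide) (auto simp: K_mass emeasure_V)
  finally show ?thesis .
qed

lemma avg_minus:
  assumes [measurable]: "g \<in> borel_measurable borel"
  shows "avg r (\<lambda>x. g (- x)) y = avg r g (- y)"
proof -
  have "avg r (\<lambda>x. g (- x)) y = (\<integral>\<^sup>+x. (\<lambda>x. g x * ennreal (K r (- x) y)) (- x) \<partial>\<mu>)"
    unfolding avg_def by simp
  also have "\<dots> = (\<integral>\<^sup>+x. g x * ennreal (K r (- x) y) \<partial>\<mu>)"
    by (rule nn_integral_mu_minus) measurable
  finally show ?thesis unfolding avg_def K_minus .
qed

end

section \<open>Norm estimates\<close>

context dunkl begin

section \<open>Means and their norms\<close>

definition pw :: "(real \<Rightarrow> complex) \<Rightarrow> real \<Rightarrow> real \<Rightarrow> ennreal" where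
  "pw f Q x = ennreal (cmod (f x) powr Q)"

lemma pw_eq: "pw f Q x = ennpowr (ennreal (cmod (f x))) Q"
  by (simp add: pw_def ennpowr_ennreal)

lemma ennpowr_pw: "ennpowr (pw f Q x) s = pw f (Q * s) x"
  by (simp add: pw_eq)

lemma measurable_pw [measurable]:
  assumes "f \<in> borel_measurable borel"
  shows "pw f Q \<in> borel_measurable borel"
proof -
  have [measurable]: "f \<in> borel_measurable borel" by fact
  show ?thesis unfolding pw_def by measurable
qed

lemma Lp_norm_f: "1 \<le> P \<Longrightarrow> Lp_norm \<mu> (ennreal P) (\<lambda>x. ennreal (cmod (f x))) = ennpowr (\<integral>\<^sup>+x. pw f P x \<partial>\<mu>) (1 / P)"
  by (simp add: Lp_norm_real pw_eq)

definition mean :: "real \<Rightarrow> real \<Rightarrow> (real \<Rightarrow> complex) \<Rightarrow> real \<Rightarrow> ennreal" where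
  "mean r Q f y = ennpowr (avg r (pw f Q) y) (1 / Q)"

lemma measurable_mean [measurable]:
  assumes "f \<in> borel_measurable borel"
  shows "mean r Q f \<in> borel_measurable borel"
proof -
  have [measurable]: "f \<in> borel_measurable borel" by fact
  show ?thesis unfolding mean_def by measurable
qed

lemma amalgam_norm_r_eq:
  assumes "0 < r" "1 \<le> Q"
  shows "amalgam_norm_r \<kappa> r (ennreal Q) p f = Lp_norm \<mu> p (mean r Q f)"
  using assms unfolding amalgam_norm_r_def mean_def
  by (simp add: dunkl_average_eq pw_def[abs_def] enn2real_one_divide)

lemma dunkl_ball_0 [simp]: "dunkl_ball 0 r = {- r<..<r}"
  by (simp add: dunkl_ball_def)

lemma amalgam_norm_eq:
  assumes "1 \<le> Q"
  shows "amalgam_norm \<kappa> (ennreal Q) p \<alpha> f =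
    (SUP r\<in>{0<..}. ennreal (V r powr (enn2real (1 / \<alpha>) - 1 / Q - enn2real (1 / p))) * Lp_norm \<mu> p (mean r Q f))"
  unfolding amalgam_norm_def using assms
  by (intro SUP_cong refl) (simp add: amalgam_norm_r_eq V_def enn2real_one_divide)

lemma V_powr_cancel: "0 < r \<Longrightarrow> ennreal (V r powr (- a)) * ennreal (V r powr a) = 1"
  using V_pos[of r] by (simp flip: ennreal_mult powr_add)

text \<open>The average is bounded by the whole integral G and has total integral G times the
  volume, so its power s = P / Q integrates to at most G^s times the volume.\<close>

lemma mean_norm_le_small:
  assumes [measurable]: "f \<in> borel_measurable borel" and r: "0 < r" and Q: "1 \<le> Q"
    and p: "ennreal Q \<le> p" and fin: "(\<integral>\<^sup>+x. pw f Q x \<partial>\<mu>) < top"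
  shows "Lp_norm \<mu> p (mean r Q f) \<le> ennreal (V r powr enn2real (1 / p)) * ennpowr (\<integral>\<^sup>+x. pw f Q x \<partial>\<mu>) (1 / Q)"
proof -
  let ?G = "\<integral>\<^sup>+x. pw f Q x \<partial>\<mu>"
  have "1 \<le> p" using Q p by (metis ennreal_1 ennreal_leI order_trans)
  then show ?thesis
  proof (cases rule: ennreal_exponent_cases)
    case infinite
    have "esssup \<mu> (mean r Q f) \<le> ennpowr ?G (1 / Q)"
      using Q by (intro esssup_I) (auto simp: mean_def intro!: ennpowr_mono avg_le)
    then show ?thesis using infinite V_pos[OF r] by (simp add: Lp_norm_top)
  next
    case (finite P)
    have QP: "Q \<le> P" using p finite Q by (simp add: ennreal_le_iff)
    define s where "s = P / Q"
    have s: "1 \<le> s" using QP Q by (simp add: s_def)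
    have "(\<integral>\<^sup>+y. ennpowr (mean r Q f y) P \<partial>\<mu>) = (\<integral>\<^sup>+y. ennpowr (avg r (pw f Q) y) s \<partial>\<mu>)"
      by (simp add: mean_def s_def)
    also have "\<dots> \<le> (\<integral>\<^sup>+y. ennpowr ?G (s - 1) * avg r (pw f Q) y \<partial>\<mu>)"
      using fin s by (intro nn_integral_mono ennpowr_le_mult avg_le)
    also have "\<dots> = ennpowr ?G (s - 1) * (?G * ennreal (V r))"
      by (subst nn_integral_cmult) (auto simp: avg_total[OF _ r])
    also have "\<dots> = ennpowr ?G s * ennreal (V r)"
    proof -
      obtain g where g: "?G = ennreal g" "0 \<le> g" using fin by (cases ?G) auto
      have "g powr (s - 1) * g = g powr s"
        using g powr_add[of g "s - 1" 1] by (cases "g = 0") auto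
      then have "ennpowr ?G (s - 1) * ?G = ennpowr ?G s"
        unfolding g(1) using g(2) by (simp add: ennpowr_ennreal flip: ennreal_mult)
      then show ?thesis by (simp add: mult.assoc[symmetric])
    qed
    finally have "Lp_norm \<mu> p (mean r Q f) \<le> ennpowr (ennpowr ?G s * ennreal (V r)) (1 / P)"
      unfolding finite(1) Lp_norm_real[OF finite(2)] using finite(2) by (intro ennpowr_mono) auto
    also have "\<dots> = ennpowr ?G (1 / Q) * ennreal (V r powr (1 / P))"
      using finite(2) V_pos[OF r] by (simp add: ennpowr_mult ennpowr_ennreal s_def)
    finally show ?thesis by (simp add: finite(4) mult.commute)
  qed
qed

text \<open>Chebyshev's bound on the interval (-r, r); for infinite \<open>p\<close> it holds
  because that interval has positive measure.\<close>

lemma Lp_norm_ge_const: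
  assumes "h \<in> borel_measurable borel" "1 \<le> p" and r: "0 < r"
    and h: "\<And>y. \<bar>y\<bar> < r \<Longrightarrow> c \<le> h y"
  shows "ennreal (V r powr enn2real (1 / p)) * c \<le> Lp_norm \<mu> p h"
  using assms(2)
proof (cases rule: ennreal_exponent_cases)
  case infinite
  have [measurable]: "h \<in> borel_measurable borel" by fact
  have "c \<le> esssup \<mu> h"
  proof (rule ccontr)
    assume "\<not> c \<le> esssup \<mu> h"
    with esssup_AE[of h \<mu>] have "AE y in \<mu>. y \<notin> {- r<..<r}"
      by (rule_tac eventually_mono[OF esssup_AE[of h \<mu>]]) (use h in \<open>force simp: abs_less_iff\<close>)
    then have "emeasure \<mu> {- r<..<r} = 0"
      by (subst (asm) AE_iff_measurable[of "{- r<..<r}"]) auto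
    then show False using V_pos[OF r] by (simp add: emeasure_V)
  qed
  then show ?thesis using infinite V_pos[OF r] by (simp add: Lp_norm_top)
next
  case (finite P)
  have [measurable]: "h \<in> borel_measurable borel" by fact
  have "ennpowr c P * ennreal (V r) = (\<integral>\<^sup>+y. ennpowr c P * indicator {- r<..<r} y \<partial>\<mu>)"
    by (simp add: nn_integral_cmult emeasure_V)
  also have "\<dots> \<le> (\<integral>\<^sup>+y. ennpowr (h y) P \<partial>\<mu>)"
    using finite(2) by (intro nn_integral_mono) (auto simp: indicator_def intro!: ennpowr_mono h)
  finally have "ennpowr (ennpowr c P * ennreal (V r)) (1 / P) \<le> Lp_norm \<mu> p h"
    unfolding finite(1) Lp_norm_real[OF finite(2)] using finite(2) by (intro ennpowr_mono) auto
  then show ?thesis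
    using finite V_pos[OF r] by (simp add: ennpowr_mult ennpowr_ennreal mult.commute)
qed

lemma mean_norm_ge:
  assumes [measurable]: "f \<in> borel_measurable borel" and r: "0 < r" and Q: "1 \<le> Q" and p: "1 \<le> p"
  shows "ennreal (V (r / 2) powr enn2real (1 / p)) * ennpowr (\<integral>\<^sup>+x. pw f Q x * indicator {- (r / 2)<..<r / 2} x \<partial>\<mu>) (1 / Q)
     \<le> Lp_norm \<mu> p (mean r Q f)"
  using r Q by (intro Lp_norm_ge_const p) (auto simp: mean_def intro!: ennpowr_mono avg_ge)

text \<open>Jensen moves the power P / Q inside the normalised average, and by
  \<open>avg_total\<close> the normalisation disappears on integration.\<close>

lemma mean_norm_le_large:
  assumes [measurable]: "f \<in> borel_measurable borel" and r: "0 < r" and Q: "1 \<le> Q" and p: "ennreal Q \<le> p"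
  shows "Lp_norm \<mu> p (mean r Q f) \<le> ennreal (V r powr (1 / Q)) * Lp_norm \<mu> p (\<lambda>x. ennreal (cmod (f x)))"
proof -
  have V: "0 < V r" by (rule V_pos[OF r])
  have "1 \<le> p" using Q p by (metis ennreal_1 ennreal_leI order_trans)
  then show ?thesis
  proof (cases rule: ennreal_exponent_cases)
    case infinite
    define c where "c = esssup \<mu> (\<lambda>x. ennreal (cmod (f x)))"
    have c: "AE x in \<mu>. ennreal (cmod (f x)) \<le> c" unfolding c_def by (rule esssup_AE)
    have "avg r (pw f Q) y \<le> ennpowr c Q * ennreal (V r)" for y
    proof -
      have "avg r (pw f Q) y \<le> avg r (\<lambda>_. ennpowr c Q) y"
        unfolding avg_def using c Q
        by (intro nn_integral_mono_AE) (auto elim!: eventually_mono simp: pw_eq intro!: mult_right_mono ennpowr_mono)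
      then show ?thesis by (simp add: avg_const[OF r])
    qed
    then have "mean r Q f y \<le> ennreal (V r powr (1 / Q)) * c" for y
      using ennpowr_mono[of "1 / Q" "avg r (pw f Q) y" "ennpowr c Q * ennreal (V r)"] Q V
      by (simp add: mean_def ennpowr_mult ennpowr_ennreal mult.commute)
    then have "esssup \<mu> (mean r Q f) \<le> ennreal (V r powr (1 / Q)) * c"
      by (intro esssup_I) auto
    then show ?thesis using infinite by (simp add: Lp_norm_top c_def)
  next
    case (finite P)
    have QP: "Q \<le> P" using p finite Q by (simp add: ennreal_le_iff)
    define s where "s = P / Q"
    have s: "1 \<le> s" using QP Q by (simp add: s_def)
    let ?v = "ennreal (V r)"
    have vv: "?v / ?v = 1" using V by (intro ennreal_divide_self) (auto simp: ennreal_eq_0_iff not_le)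
    have pt: "ennpowr (mean r Q f y) P \<le> ennreal (V r powr s) * (avg r (pw f P) y / ?v)" for y
    proof -
      have "ennpowr (mean r Q f y) P = ennpowr (avg r (pw f Q) y) s"
        by (simp add: mean_def s_def)
      also have "avg r (pw f Q) y = ?v * (avg r (pw f Q) y / ?v)"
        using vv by (metis ennreal_times_divide mult.commute mult_1_right)
      also have "ennpowr \<dots> s = ennreal (V r powr s) * ennpowr (avg r (pw f Q) y / ?v) s"
        using s V by (simp add: ennpowr_mult ennpowr_ennreal)
      also have "\<dots> \<le> ennreal (V r powr s) * (avg r (\<lambda>x. ennpowr (pw f Q x) s) y / ?v)"
        by (intro mult_left_mono avg_jensen s r) auto
      finally show ?thesis using Q by (simp add: ennpowr_pw s_def)
    qed
    have "(\<integral>\<^sup>+y. ennpowr (mean r Q f y) P \<partial>\<mu>) \<le> (\<integral>\<^sup>+y. ennreal (V r powr s) * (avg r (pw f P) y / ?v) \<partial>\<mu>)"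
      by (intro nn_integral_mono pt)
    also have "\<dots> = ennreal (V r powr s) * ((\<integral>\<^sup>+x. pw f P x \<partial>\<mu>) * ?v / ?v)"
      by (simp add: nn_integral_cmult nn_integral_divide avg_total[OF _ r])
    also have "\<dots> = ennreal (V r powr s) * (\<integral>\<^sup>+x. pw f P x \<partial>\<mu>)"
      using vv by (metis ennreal_times_divide mult_1_right)
    finally have "Lp_norm \<mu> p (mean r Q f) \<le> ennpowr (ennreal (V r powr s) * (\<integral>\<^sup>+x. pw f P x \<partial>\<mu>)) (1 / P)"
      unfolding finite(1) Lp_norm_real[OF finite(2)] using finite(2) by (intro ennpowr_mono) auto
    also have "\<dots> = ennreal (V r powr (1 / Q)) * ennpowr (\<integral>\<^sup>+x. pw f P x \<partial>\<mu>) (1 / P)"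
      using finite(2) V by (simp add: ennpowr_mult ennpowr_ennreal s_def powr_powr)
    finally show ?thesis unfolding finite(1) Lp_norm_f[OF finite(2)] .
  qed
qed

text \<open>
  The even symmetrisation is what makes the approximate identity argument work: the kernel
  \<open>K r x y\<close> is concentrated where \<open>\<bar>x\<bar>\<close> is close to \<open>\<bar>y\<bar>\<close>, not where \<open>x\<close> is close to \<open>y\<close>.
\<close>

definition even_sum :: "(real \<Rightarrow> complex) \<Rightarrow> real \<Rightarrow> real \<Rightarrow> real" where
  "even_sum f Q x = cmod (f x) powr Q + cmod (f (- x)) powr Q"

text \<open>\<open>f\<close> is only known to be measurable. Cutting in size and in space makes the
  symmetrised power integrable, so that \<open>oscp_tendsto\<close> applies, and the cutoffs
  increase to it.\<close>

definition cutoff :: "(real \<Rightarrow> complex) \<Rightarrow> real \<Rightarrow> nat \<Rightarrow> real \<Rightarrow> real" where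
  "cutoff f Q m x = indicator {- real m..real m} x * min (even_sum f Q x) (real m)"

lemma measurable_even_sum [measurable]:
  assumes "f \<in> borel_measurable borel"
  shows "even_sum f Q \<in> borel_measurable borel"
proof -
  have [measurable]: "f \<in> borel_measurable borel" by fact
  show ?thesis unfolding even_sum_def by measurable
qed

lemma measurable_cutoff [measurable]:
  assumes "f \<in> borel_measurable borel"
  shows "cutoff f Q m \<in> borel_measurable borel"
proof -
  have [measurable]: "f \<in> borel_measurable borel" by fact
  show ?thesis unfolding cutoff_def by measurable
qed

lemma even_sum_nonneg [simp]: "0 \<le> even_sum f Q x" by (simp add: even_sum_def)

lemma cutoff_bounds: "0 \<le> cutoff f Q m x" "cutoff f Q m x \<le> real m" "cutoff f Q m x \<le> even_sum f Q x"
  by (auto simp: cutoff_def indicator_def)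

lemma cutoff_even: "cutoff f Q m \<bar>x\<bar> = cutoff f Q m x"
  by (cases "0 \<le> x") (auto simp: cutoff_def even_sum_def indicator_def add.commute)

lemma cutoff_mono: "m \<le> n \<Longrightarrow> cutoff f Q m x \<le> cutoff f Q n x"
  by (auto simp: cutoff_def indicator_def min_def)

lemma cutoff_eventually: "\<forall>\<^sub>F m in sequentially. cutoff f Q m x = even_sum f Q x"
proof -
  obtain N :: nat where N: "max \<bar>x\<bar> (even_sum f Q x) \<le> real N" using real_arch_simple by blast
  have "cutoff f Q m x = even_sum f Q x" if "m \<ge> N" for m
  proof -
    have "real N \<le> real m" using that by simp
    then have "\<bar>x\<bar> \<le> real m" "even_sum f Q x \<le> real m" using N by linarith+
    then show ?thesis by (auto simp: cutoff_def indicator_def abs_le_iff)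
  qed
  then show ?thesis by (rule eventually_sequentiallyI)
qed

lemma integrable_cutoff:
  assumes [measurable]: "f \<in> borel_measurable borel"
  shows "integrable \<mu> (cutoff f Q m)"
proof (rule Bochner_Integration.integrable_bound)
  show "integrable \<mu> (\<lambda>x. real m * indicator {- real m..real m} x)"
    using emeasure_mu_bounded by (intro integrable_mult_right integrable_real_indicator) auto
  show "AE x in \<mu>. norm (cutoff f Q m x) \<le> norm (real m * indicator {- real m..real m} x)"
    by (intro AE_I2) (auto simp: cutoff_def indicator_def)
qed simp

text \<open>The normalised average of the symmetrised power, since reflecting a function reflects
  the point at which it is averaged (\<open>avg_minus\<close>).\<close>

definition sym_mean :: "(real \<Rightarrow> complex) \<Rightarrow> real \<Rightarrow> nat \<Rightarrow> real \<Rightarrow> ennreal" where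
  "sym_mean f Q n y = avg (ker n) (pw f Q) y / ennreal (V (ker n)) + avg (ker n) (pw f Q) (- y) / ennreal (V (ker n))"

lemma cutoff_le_sym_mean:
  assumes [measurable]: "f \<in> borel_measurable borel"
  shows "ennreal (cutoff f Q m y) \<le> sym_mean f Q n y + oscp n (cutoff f Q m) y"
proof -
  have "avg (ker n) (\<lambda>x. ennreal (cutoff f Q m x)) y \<le> avg (ker n) (\<lambda>x. pw f Q x + pw f Q (- x)) y"
    using cutoff_bounds(3)[of f Q m] by (intro avg_mono) (auto simp: even_sum_def pw_def intro!: ennreal_leI simp flip: ennreal_plus)
  also have "\<dots> = avg (ker n) (pw f Q) y + avg (ker n) (\<lambda>x. pw f Q (- x)) y"
    unfolding avg_def by (simp add: distrib_right nn_integral_add)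
  also have "\<dots> = avg (ker n) (pw f Q) y + avg (ker n) (pw f Q) (- y)"
    by (simp add: avg_minus)
  finally have "avg (ker n) (\<lambda>x. ennreal (cutoff f Q m x)) y / ennreal (V (ker n)) \<le> sym_mean f Q n y"
    unfolding sym_mean_def add_divide_distrib_ennreal[symmetric] by (rule divide_right_mono_ennreal)
  then show ?thesis
    using le_avg_oscp[of "cutoff f Q m" y n] cutoff_bounds(1)[of f Q m]
    by (auto intro: order_trans add_right_mono)
qed

text \<open>The part of a cutoff above the bound is dominated by its oscillation, whose integral
  tends to 0. The 2 counts the halves of \<open>sym_mean\<close>; the bound on the symmetrised power
  passes to its first summand.\<close>

lemma L_infinity_of_means:
  assumes [measurable]: "f \<in> borel_measurable borel" and Q: "1 \<le> Q" and N: "N < top"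
    and bound: "\<And>n. AE y in \<mu>. avg (ker n) (pw f Q) y / ennreal (V (ker n)) \<le> N"
  shows "AE y in \<mu>. pw f Q y \<le> 2 * N"
proof -
  obtain B where B: "2 * N = ennreal B" "0 \<le> B"
    using N by (cases "2 * N") (auto simp: ennreal_mult_eq_top_iff)
  have b2: "AE y in \<mu>. sym_mean f Q n y \<le> ennreal B" for n
  proof -
    have "AE y in \<mu>. avg (ker n) (pw f Q) (- y) / ennreal (V (ker n)) \<le> N"
    proof -
      \<comment> \<open>The exceptional set is reflected through the integral of its
        indicator.\<close>
      let ?h = "\<lambda>y. indicator {y. \<not> avg (ker n) (pw f Q) y / ennreal (V (ker n)) \<le> N} y :: ennreal"
      have "(\<integral>\<^sup>+y. ?h (- y) \<partial>\<mu>) = (\<integral>\<^sup>+y. ?h y \<partial>\<mu>)"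
        by (rule nn_integral_mu_minus) measurable
      also have "\<dots> = 0"
        using bound[of n] by (subst nn_integral_0_iff_AE) (auto elim!: eventually_mono simp: indicator_def)
      finally show ?thesis
        by (subst (asm) nn_integral_0_iff_AE) (auto elim!: eventually_mono simp: indicator_def split: if_splits)
    qed
    with bound[of n] show ?thesis
      unfolding B(1)[symmetric] sym_mean_def mult_2
      by eventually_elim (rule add_mono)
  qed
  have "AE y in \<mu>. cutoff f Q m y \<le> B" for m
  proof -
    \<comment> \<open>\<open>ennreal\<close> of this difference is its positive part.\<close>
    have "(\<integral>\<^sup>+y. ennreal (cutoff f Q m y - B) \<partial>\<mu>) \<le> (\<integral>\<^sup>+y. oscp n (cutoff f Q m) y \<partial>\<mu>)" for n
    proof (rule nn_integral_mono_AE)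
      show "AE y in \<mu>. ennreal (cutoff f Q m y - B) \<le> oscp n (cutoff f Q m) y"
        using b2[of n]
      proof eventually_elim
        fix y assume "sym_mean f Q n y \<le> ennreal B"
        then have "ennreal (cutoff f Q m y) \<le> ennreal B + oscp n (cutoff f Q m) y"
          using cutoff_le_sym_mean[of f Q m y n] by (auto intro: order_trans add_right_mono)
        then show "ennreal (cutoff f Q m y - B) \<le> oscp n (cutoff f Q m) y"
          using B(2) by (simp add: ennreal_minus[symmetric] ennreal_minus_le_iff)
      qed
    qed
    moreover have "(\<lambda>n. \<integral>\<^sup>+y. oscp n (cutoff f Q m) y \<partial>\<mu>) \<longlonglongrightarrow> 0"
      by (rule oscp_tendsto[OF integrable_cutoff cutoff_even]) simp
    ultimately have "(\<lambda>n::nat. \<integral>\<^sup>+y. ennreal (cutoff f Q m y - B) \<partial>\<mu>) \<longlonglongrightarrow> 0"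
      by (rule tendsto_0_le_ennreal[rotated])
    then have "(\<integral>\<^sup>+y. ennreal (cutoff f Q m y - B) \<partial>\<mu>) = 0" by (simp add: LIMSEQ_const_iff)
    then show ?thesis
      by (subst (asm) nn_integral_0_iff_AE) (auto elim!: eventually_mono simp: ennreal_eq_0_iff)
  qed
  then have "AE y in \<mu>. \<forall>m. cutoff f Q m y \<le> B" by (simp add: AE_all_countable)
  then show ?thesis
  proof eventually_elim
    fix y assume *: "\<forall>m. cutoff f Q m y \<le> B"
    obtain m where "cutoff f Q m y = even_sum f Q y"
      using cutoff_eventually[of f Q y] by (auto simp: eventually_sequentially)
    then have "even_sum f Q y \<le> B" using * by metis
    then show "pw f Q y \<le> 2 * N"
      unfolding B(1) pw_def even_sum_def by (intro ennreal_leI) (smt (verit) powr_ge_zero)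
  qed
qed

text \<open>The oscillation is known to vanish in L1 only; as it is at most \<open>m\<close>, its
  power \<open>s\<close> is at most m^(s-1) times itself and also vanishes for fixed
  \<open>m\<close>. The remaining bound \<open>C\<close> is free of \<open>m\<close>, so monotone
  convergence lifts the cutoff.\<close>

lemma L_power_of_means:
  assumes [measurable]: "f \<in> borel_measurable borel" and Q: "1 \<le> Q" and s: "1 \<le> s" and N: "N < top"
    and bound: "\<And>n. (\<integral>\<^sup>+y. ennpowr (avg (ker n) (pw f Q) y / ennreal (V (ker n))) s \<partial>\<mu>) \<le> N"
  shows "(\<integral>\<^sup>+y. pw f (Q * s) y \<partial>\<mu>) < top"
proof -
  let ?c = "ennreal (2 powr s)"
  have s0: "0 < s" using s by simp
  \<comment> \<open>One factor \<open>?c\<close> separates the mean from the oscillation, the other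
    separates the two reflected halves of the mean.\<close>
  define C where "C = ?c * (?c * (N + N))"
  have C: "C < top" using N by (simp add: C_def ennreal_mult_less_top)
  have b2: "(\<integral>\<^sup>+y. ennpowr (sym_mean f Q n y) s \<partial>\<mu>) \<le> ?c * (N + N)" for n
  proof -
    let ?A = "\<lambda>y. ennpowr (avg (ker n) (pw f Q) y / ennreal (V (ker n))) s"
    have "(\<integral>\<^sup>+y. ennpowr (sym_mean f Q n y) s \<partial>\<mu>) \<le> (\<integral>\<^sup>+y. ?c * (?A y + ?A (- y)) \<partial>\<mu>)"
      unfolding sym_mean_def by (intro nn_integral_mono ennpowr_add_le s0)
    also have "\<dots> = ?c * ((\<integral>\<^sup>+y. ?A y \<partial>\<mu>) + (\<integral>\<^sup>+y. ?A (- y) \<partial>\<mu>))"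
      by (simp add: nn_integral_cmult nn_integral_add)
    also have "(\<integral>\<^sup>+y. ?A (- y) \<partial>\<mu>) = (\<integral>\<^sup>+y. ?A y \<partial>\<mu>)"
      by (rule nn_integral_mu_minus) measurable
    also have "?c * ((\<integral>\<^sup>+y. ?A y \<partial>\<mu>) + (\<integral>\<^sup>+y. ?A y \<partial>\<mu>)) \<le> ?c * (N + N)"
      by (intro mult_left_mono add_mono bound) simp
    finally show ?thesis .
  qed
  have cut: "(\<integral>\<^sup>+y. ennpowr (ennreal (cutoff f Q m y)) s \<partial>\<mu>) \<le> C" for m
  proof (rule LIMSEQ_le_const)
    let ?O = "\<lambda>n y. oscp n (cutoff f Q m) y"
    have "(\<lambda>n. \<integral>\<^sup>+y. ?O n y \<partial>\<mu>) \<longlonglongrightarrow> 0"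
      by (rule oscp_tendsto[OF integrable_cutoff cutoff_even]) simp
    then have "(\<lambda>n. (?c * ennpowr (ennreal (real m)) (s - 1)) * (\<integral>\<^sup>+y. ?O n y \<partial>\<mu>)) \<longlonglongrightarrow> (?c * ennpowr (ennreal (real m)) (s - 1)) * 0"
      by (intro ennreal_tendsto_cmult) (auto simp: ennreal_mult_less_top)
    then show "(\<lambda>n. C + (?c * ennpowr (ennreal (real m)) (s - 1)) * (\<integral>\<^sup>+y. ?O n y \<partial>\<mu>)) \<longlonglongrightarrow> C"
      using tendsto_add[OF tendsto_const[of C]] by fastforce
    have "(\<integral>\<^sup>+y. ennpowr (ennreal (cutoff f Q m y)) s \<partial>\<mu>) \<le> C + (?c * ennpowr (ennreal (real m)) (s - 1)) * (\<integral>\<^sup>+y. ?O n y \<partial>\<mu>)" for n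
    proof -
      have "(\<integral>\<^sup>+y. ennpowr (ennreal (cutoff f Q m y)) s \<partial>\<mu>) \<le>
         (\<integral>\<^sup>+y. ?c * ennpowr (sym_mean f Q n y) s + ?c * ennpowr (ennreal (real m)) (s - 1) * ?O n y \<partial>\<mu>)"
      proof (intro nn_integral_mono)
        fix y
        have "ennpowr (ennreal (cutoff f Q m y)) s \<le> ennpowr (sym_mean f Q n y + ?O n y) s"
          by (intro ennpowr_mono s0 cutoff_le_sym_mean) simp
        also have "\<dots> \<le> ?c * (ennpowr (sym_mean f Q n y) s + ennpowr (?O n y) s)"
          by (rule ennpowr_add_le[OF s0])
        also have "ennpowr (?O n y) s \<le> ennpowr (ennreal (real m)) (s - 1) * ?O n y"
          by (intro ennpowr_le_mult s oscp_bound cutoff_bounds) auto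
        finally show "ennpowr (ennreal (cutoff f Q m y)) s \<le> ?c * ennpowr (sym_mean f Q n y) s + ?c * ennpowr (ennreal (real m)) (s - 1) * ?O n y"
          by (simp add: distrib_left mult.assoc mult_left_mono add_left_mono)
      qed
      also have "\<dots> = ?c * (\<integral>\<^sup>+y. ennpowr (sym_mean f Q n y) s \<partial>\<mu>) + ?c * ennpowr (ennreal (real m)) (s - 1) * (\<integral>\<^sup>+y. ?O n y \<partial>\<mu>)"
        unfolding sym_mean_def by (subst nn_integral_add) (auto simp: nn_integral_cmult)
      also have "\<dots> \<le> C + ?c * ennpowr (ennreal (real m)) (s - 1) * (\<integral>\<^sup>+y. ?O n y \<partial>\<mu>)"
        unfolding C_def by (intro add_right_mono mult_left_mono b2) simp
      finally show ?thesis .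
    qed
    then show "\<exists>n0. \<forall>n\<ge>n0. (\<integral>\<^sup>+y. ennpowr (ennreal (cutoff f Q m y)) s \<partial>\<mu>) \<le> C + (?c * ennpowr (ennreal (real m)) (s - 1)) * (\<integral>\<^sup>+y. ?O n y \<partial>\<mu>)"
      by auto
  qed
  have "(\<integral>\<^sup>+y. pw f (Q * s) y \<partial>\<mu>) \<le> (\<integral>\<^sup>+y. ennpowr (ennreal (even_sum f Q y)) s \<partial>\<mu>)"
  proof (intro nn_integral_mono)
    fix y
    have "pw f Q y \<le> ennreal (even_sum f Q y)" unfolding pw_def even_sum_def by (intro ennreal_leI) simp
    then show "pw f (Q * s) y \<le> ennpowr (ennreal (even_sum f Q y)) s"
      unfolding ennpowr_pw[symmetric] by (rule ennpowr_mono[OF s0])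
  qed
  also have "\<dots> \<le> C"
  proof (rule LIMSEQ_le_const2)
    show "(\<lambda>m. \<integral>\<^sup>+y. ennpowr (ennreal (cutoff f Q m y)) s \<partial>\<mu>) \<longlonglongrightarrow> (\<integral>\<^sup>+y. ennpowr (ennreal (even_sum f Q y)) s \<partial>\<mu>)"
    proof (rule nn_integral_LIMSEQ)
      show "incseq (\<lambda>m y. ennpowr (ennreal (cutoff f Q m y)) s)"
        by (intro monoI le_funI ennpowr_mono s0 ennreal_leI cutoff_mono)
      show "(\<lambda>m. ennpowr (ennreal (cutoff f Q m y)) s) \<longlonglongrightarrow> ennpowr (ennreal (even_sum f Q y)) s" for y
        using cutoff_eventually[of f Q y] by (intro tendsto_eventually) (auto elim: eventually_mono)
    qed simp
    show "\<exists>M. \<forall>m\<ge>M. (\<integral>\<^sup>+y. ennpowr (ennreal (cutoff f Q m y)) s \<partial>\<mu>) \<le> C"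
      using cut by auto
  qed
  finally show ?thesis using C by (rule le_less_trans)
qed

end

section \<open>Amalgam spaces at the end points\<close>

lemma ennpowr_divide_ennreal:
  assumes "0 < s" "0 < v"
  shows "ennpowr (a / ennreal v) s = ennpowr a s / ennreal (v powr s)"
proof -
  have "a / ennreal v = a * ennreal (1 / v)"
    using assms by (simp add: divide_ennreal_def inverse_ennreal inverse_eq_divide)
  moreover have "ennpowr a s / ennreal (v powr s) = ennpowr a s * ennreal (1 / v powr s)"
    using assms by (simp add: divide_ennreal_def inverse_ennreal inverse_eq_divide)
  ultimately show ?thesis
    using assms by (simp add: ennpowr_mult ennpowr_ennreal powr_divide)
qed

context dunkl begin

lemma Lp_space_iff:
  assumes "1 \<le> P"
  shows "f \<in> Lp_space \<mu> (ennreal P) \<longleftrightarrow> f \<in> borel_measurable borel \<and> (\<integral>\<^sup>+x. pw f P x \<partial>\<mu>) < top"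
  using assms by (simp add: Lp_space_def Lp_norm_f)

lemma local_mass_tendsto:
  assumes [measurable]: "f \<in> borel_measurable borel"
  shows "(\<lambda>n. \<integral>\<^sup>+x. pw f Q x * indicator {- real n<..<real n} x \<partial>\<mu>) \<longlonglongrightarrow> (\<integral>\<^sup>+x. pw f Q x \<partial>\<mu>)"
proof (rule nn_integral_LIMSEQ)
  show "incseq (\<lambda>n x. pw f Q x * indicator {- real n<..<real n} x)"
    by (intro monoI le_funI mult_left_mono) (auto simp: indicator_def)
  show "(\<lambda>n. pw f Q x * indicator {- real n<..<real n} x) \<longlonglongrightarrow> pw f Q x" for x
  proof -
    obtain N :: nat where "\<bar>x\<bar> < real N" using reals_Archimedean2 by blast
    then have "pw f Q x * indicator {- real n<..<real n} x = pw f Q x" if "n \<ge> N" for n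
      using that by (auto simp: indicator_def)
    then show ?thesis by (intro tendsto_eventually eventually_sequentiallyI[of N])
  qed
qed simp

theorem amalgam_space_lower_exponent:
  assumes Q: "1 \<le> Q" and p: "ennreal Q \<le> p"
  shows "amalgam_space \<kappa> (ennreal Q) p (ennreal Q) = Lp_space \<mu> (ennreal Q)"
proof -
  define e where "e = enn2real (1 / p)"
  have p1: "1 \<le> p" using Q p by (metis ennreal_1 ennreal_leI order_trans)
  have norm_eq: "amalgam_norm \<kappa> (ennreal Q) p (ennreal Q) f = (SUP r\<in>{0<..}. ennreal (V r powr (- e)) * Lp_norm \<mu> p (mean r Q f))" for f
    unfolding amalgam_norm_eq[OF Q] enn2real_one_divide[OF Q] e_def by simp
  have "amalgam_norm \<kappa> (ennreal Q) p (ennreal Q) f < top \<longleftrightarrow> (\<integral>\<^sup>+x. pw f Q x \<partial>\<mu>) < top"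
    if f[measurable]: "f \<in> borel_measurable borel" for f
  proof
    assume fin: "(\<integral>\<^sup>+x. pw f Q x \<partial>\<mu>) < top"
    have "ennreal (V r powr (- e)) * Lp_norm \<mu> p (mean r Q f) \<le> ennpowr (\<integral>\<^sup>+x. pw f Q x \<partial>\<mu>) (1 / Q)" if r: "0 < r" for r
    proof -
      have "ennreal (V r powr (- e)) * Lp_norm \<mu> p (mean r Q f) \<le>
        ennreal (V r powr (- e)) * (ennreal (V r powr e) * ennpowr (\<integral>\<^sup>+x. pw f Q x \<partial>\<mu>) (1 / Q))"
        unfolding e_def by (intro mult_left_mono mean_norm_le_small r Q p fin) auto
      also have "\<dots> = ennpowr (\<integral>\<^sup>+x. pw f Q x \<partial>\<mu>) (1 / Q)"
        unfolding mult.assoc[symmetric] V_powr_cancel[OF r] by simp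
      finally show ?thesis .
    qed
    then have "amalgam_norm \<kappa> (ennreal Q) p (ennreal Q) f \<le> ennpowr (\<integral>\<^sup>+x. pw f Q x \<partial>\<mu>) (1 / Q)"
      unfolding norm_eq by (intro SUP_least) simp
    also have "\<dots> < top" using fin by simp
    finally show "amalgam_norm \<kappa> (ennreal Q) p (ennreal Q) f < top" .
  next
    define N where "N = amalgam_norm \<kappa> (ennreal Q) p (ennreal Q) f"
    assume "amalgam_norm \<kappa> (ennreal Q) p (ennreal Q) f < top"
    then have N: "N < top" by (simp add: N_def)
    \<comment> \<open>The ratio of \<open>V (r / 2) powr e\<close> to \<open>V r powr e\<close>: the
      lower bound for the means lives on half the radius, the weight in the norm on the full
      one.\<close>
    define c where "c = (1 / 2 :: real) powr ((2 * \<kappa> + 2) * e)"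
    have c: "0 < c" by (simp add: c_def)
    let ?J = "\<lambda>n::nat. \<integral>\<^sup>+x. pw f Q x * indicator {- real n<..<real n} x \<partial>\<mu>"
    have J: "?J n \<le> ennpowr (N / ennreal c) Q" if n: "n > 0" for n
    proof -
      \<comment> \<open>Mass is detected up to half the radius, hence twice
        \<open>n\<close>.\<close>
      define r where "r = 2 * real n"
      have r: "0 < r" "r / 2 = real n" using n by (auto simp: r_def)
      have Vr: "0 < V r" by (rule V_pos[OF r(1)])
      have "V (r / 2) powr e = c * V r powr e"
        unfolding V_half[OF r(1)] c_def using Vr by (simp add: powr_mult powr_powr)
      then have "ennreal c = ennreal (V r powr (- e)) * ennreal (V (r / 2) powr e)"
        using V_powr_cancel[OF r(1), of e] c by (simp add: ennreal_mult mult.left_commute)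
      then have "ennreal c * ennpowr (?J n) (1 / Q) \<le> ennreal (V r powr (- e)) * Lp_norm \<mu> p (mean r Q f)"
        using mean_norm_ge[OF f r(1) Q p1] unfolding r(2) e_def
        by (simp add: mult.assoc mult_left_mono)
      also have "\<dots> \<le> N"
        unfolding N_def norm_eq using r(1) by (intro SUP_upper) simp
      finally have "ennreal c * ennpowr (?J n) (1 / Q) / ennreal c \<le> N / ennreal c"
        by (rule divide_right_mono_ennreal)
      moreover have "ennreal c * ennpowr (?J n) (1 / Q) / ennreal c = ennpowr (?J n) (1 / Q)"
        using c by (subst mult.commute) (simp add: mult_divide_eq_ennreal)
      ultimately have "ennpowr (ennpowr (?J n) (1 / Q)) Q \<le> ennpowr (N / ennreal c) Q"
        using Q by (intro ennpowr_mono) auto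
      then show ?thesis using Q by simp
    qed
    have "(\<integral>\<^sup>+x. pw f Q x \<partial>\<mu>) \<le> ennpowr (N / ennreal c) Q"
      by (rule LIMSEQ_le_const2[OF local_mass_tendsto]) (use J in \<open>auto intro: exI[of _ 1]\<close>)
    also have "\<dots> < top"
      using N c by (simp add: ennreal_divide_eq_top_iff less_top[symmetric] ennreal_eq_0_iff not_le)
    finally show "(\<integral>\<^sup>+x. pw f Q x \<partial>\<mu>) < top" .
  qed
  then show ?thesis
    by (auto simp: amalgam_space_def Lp_space_iff[OF Q])
qed

theorem amalgam_space_upper_exponent:
  assumes Q: "1 \<le> Q" and p: "ennreal Q \<le> p"
  shows "amalgam_space \<kappa> (ennreal Q) p p = Lp_space \<mu> p"
proof -
  have Q0: "0 < Q" "Q \<noteq> 0" using Q by auto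
  have p1: "1 \<le> p" using Q p by (metis ennreal_1 ennreal_leI order_trans)
  \<comment> \<open>With \<alpha> = p the exponents cancel down to - 1 / Q, which is the
    normalisation of the mean.\<close>
  have norm_eq: "amalgam_norm \<kappa> (ennreal Q) p p f = (SUP r\<in>{0<..}. ennreal (V r powr (- (1 / Q))) * Lp_norm \<mu> p (mean r Q f))" for f
    unfolding amalgam_norm_eq[OF Q] by simp
  have "amalgam_norm \<kappa> (ennreal Q) p p f < top \<longleftrightarrow> Lp_norm \<mu> p (\<lambda>x. ennreal (cmod (f x))) < top"
    if f[measurable]: "f \<in> borel_measurable borel" for f
  proof
    assume fin: "Lp_norm \<mu> p (\<lambda>x. ennreal (cmod (f x))) < top"
    have "ennreal (V r powr (- (1 / Q))) * Lp_norm \<mu> p (mean r Q f) \<le> Lp_norm \<mu> p (\<lambda>x. ennreal (cmod (f x)))" if r: "0 < r" for r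
    proof -
      have "ennreal (V r powr (- (1 / Q))) * Lp_norm \<mu> p (mean r Q f) \<le>
        ennreal (V r powr (- (1 / Q))) * (ennreal (V r powr (1 / Q)) * Lp_norm \<mu> p (\<lambda>x. ennreal (cmod (f x))))"
        by (intro mult_left_mono mean_norm_le_large r Q p f) simp
      also have "\<dots> = Lp_norm \<mu> p (\<lambda>x. ennreal (cmod (f x)))"
        unfolding mult.assoc[symmetric] V_powr_cancel[OF r] by simp
      finally show ?thesis .
    qed
    then have "amalgam_norm \<kappa> (ennreal Q) p p f \<le> Lp_norm \<mu> p (\<lambda>x. ennreal (cmod (f x)))"
      unfolding norm_eq by (intro SUP_least) simp
    then show "amalgam_norm \<kappa> (ennreal Q) p p f < top" using fin by (rule le_less_trans)
  next
    define N where "N = amalgam_norm \<kappa> (ennreal Q) p p f"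
    assume "amalgam_norm \<kappa> (ennreal Q) p p f < top"
    then have N: "N < top" by (simp add: N_def)
    \<comment> \<open>The supremum is tested on the shrinking radii \<open>ker n\<close>, along
      which the averages recover the symmetrised power.\<close>
    have bound: "Lp_norm \<mu> p (mean (ker n) Q f) \<le> ennreal (V (ker n) powr (1 / Q)) * N" for n
    proof -
      have "Lp_norm \<mu> p (mean (ker n) Q f) = ennreal (V (ker n) powr (1 / Q)) * (ennreal (V (ker n) powr (- (1 / Q))) * Lp_norm \<mu> p (mean (ker n) Q f))"
        using V_powr_cancel[OF ker_pos, of n "1 / Q"] by (simp add: mult.assoc[symmetric] mult.commute[of "ennreal (V (ker n) powr (1 / Q))"])
      also have "\<dots> \<le> ennreal (V (ker n) powr (1 / Q)) * N"
        unfolding N_def norm_eq by (intro mult_left_mono SUP_upper) simp_all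
      finally show ?thesis .
    qed
    show "Lp_norm \<mu> p (\<lambda>x. ennreal (cmod (f x))) < top"
      using p1
    proof (cases rule: ennreal_exponent_cases)
      case infinite
      have "AE y in \<mu>. avg (ker n) (pw f Q) y / ennreal (V (ker n)) \<le> ennpowr N Q" for n
        using esssup_AE[of "mean (ker n) Q f" \<mu>]
      proof eventually_elim
        fix y assume "mean (ker n) Q f y \<le> esssup \<mu> (mean (ker n) Q f)"
        then have "mean (ker n) Q f y \<le> ennreal (V (ker n) powr (1 / Q)) * N"
          using bound[of n] infinite by (simp add: Lp_norm_top)
        then have "ennpowr (mean (ker n) Q f y) Q \<le> ennpowr (ennreal (V (ker n) powr (1 / Q)) * N) Q"
          by (rule ennpowr_mono[OF Q0(1)])
        then have "avg (ker n) (pw f Q) y \<le> ennpowr N Q * ennreal (V (ker n))"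
          using Q0 V_ker_pos[of n] by (simp add: mean_def ennpowr_mult ennpowr_ennreal powr_powr mult.commute)
        then have "avg (ker n) (pw f Q) y / ennreal (V (ker n)) \<le> ennpowr N Q * ennreal (V (ker n)) / ennreal (V (ker n))"
          by (rule divide_right_mono_ennreal)
        also have "\<dots> = ennpowr N Q"
          unfolding ennreal_times_divide[symmetric] V_ker_div by simp
        finally show "avg (ker n) (pw f Q) y / ennreal (V (ker n)) \<le> ennpowr N Q" .
      qed
      then have "AE y in \<mu>. pw f Q y \<le> 2 * ennpowr N Q"
        using N by (intro L_infinity_of_means f Q) auto
      then have "AE y in \<mu>. ennreal (cmod (f y)) \<le> ennpowr (2 * ennpowr N Q) (1 / Q)"
      proof eventually_elim
        fix y assume "pw f Q y \<le> 2 * ennpowr N Q"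
        then have "ennpowr (pw f Q y) (1 / Q) \<le> ennpowr (2 * ennpowr N Q) (1 / Q)"
          using Q0 by (intro ennpowr_mono) auto
        then show "ennreal (cmod (f y)) \<le> ennpowr (2 * ennpowr N Q) (1 / Q)"
          using Q0 by (simp add: pw_eq)
      qed
      then have "esssup \<mu> (\<lambda>x. ennreal (cmod (f x))) \<le> ennpowr (2 * ennpowr N Q) (1 / Q)"
        by (intro esssup_I) auto
      also have "\<dots> < top" using N by (simp add: ennreal_mult_less_top)
      finally show ?thesis using infinite by (simp add: Lp_norm_top)
    next
      case (finite P)
      have QP: "Q \<le> P" using p finite Q by (simp add: ennreal_le_iff)
      define s where "s = P / Q"
      have s: "1 \<le> s" "0 < s" "Q * s = P" using QP Q by (auto simp: s_def)
      have P0: "0 < P" "P \<noteq> 0" using finite by auto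
      have "(\<integral>\<^sup>+y. ennpowr (avg (ker n) (pw f Q) y / ennreal (V (ker n))) s \<partial>\<mu>) \<le> ennpowr N P" for n
      proof -
        let ?w = "V (ker n) powr s"
        have "V (ker n) \<noteq> 0" using V_ker_pos[of n] by linarith
        then have w: "0 < ?w" by simp
        have "ennpowr (\<integral>\<^sup>+y. ennpowr (mean (ker n) Q f y) P \<partial>\<mu>) (1 / P) \<le> ennreal (V (ker n) powr (1 / Q)) * N"
          using bound[of n] unfolding finite(1) Lp_norm_real[OF finite(2)] .
        then have "ennpowr (ennpowr (\<integral>\<^sup>+y. ennpowr (mean (ker n) Q f y) P \<partial>\<mu>) (1 / P)) P \<le> ennpowr (ennreal (V (ker n) powr (1 / Q)) * N) P"
          by (rule ennpowr_mono[OF P0(1)])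
        then have "(\<integral>\<^sup>+y. ennpowr (avg (ker n) (pw f Q) y) s \<partial>\<mu>) \<le> ennpowr N P * ennreal ?w"
          using P0 by (simp add: mean_def ennpowr_mult ennpowr_ennreal powr_powr mult.commute s_def)
        then have "(\<integral>\<^sup>+y. ennpowr (avg (ker n) (pw f Q) y) s \<partial>\<mu>) / ennreal ?w \<le> ennpowr N P * ennreal ?w / ennreal ?w"
          by (rule divide_right_mono_ennreal)
        also have "\<dots> = ennpowr N P"
          using w by (simp add: mult_divide_eq_ennreal)
        finally show ?thesis
          using s V_ker_pos[of n] by (simp add: ennpowr_divide_ennreal nn_integral_divide)
      qed
      then have "(\<integral>\<^sup>+y. pw f (Q * s) y \<partial>\<mu>) < top"
        using N by (intro L_power_of_means[of f Q s "ennpowr N P"] f Q s) auto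
      then show ?thesis
        unfolding finite(1) Lp_norm_f[OF finite(2)] s(3) by simp
    qed
  qed
  then show ?thesis
    by (auto simp: amalgam_space_def Lp_space_def)
qed

text \<open>A direct argument on essential suprema. Its technical point is the measurability of
  \<open>S r f\<close>, which \<open>esssup_I\<close> asks for.\<close>

theorem amalgam_space_infinity: "amalgam_space \<kappa> \<infinity> \<infinity> \<infinity> = Lp_space \<mu> \<infinity>"
proof -
  define S where "S r f y = esssup \<mu> (\<lambda>x. ennreal (cmod (f x * indicator (dunkl_ball y r) x)))" for r and f :: "real \<Rightarrow> complex" and y
  have V1: "V r powr 0 = 1" if "0 < r" for r using V_pos[OF that] by simp
  have norm_eq: "amalgam_norm \<kappa> \<infinity> \<infinity> \<infinity> f = (SUP r\<in>{0<..}. esssup \<mu> (S r f))" for f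
    unfolding amalgam_norm_def amalgam_norm_r_def S_def
    by (intro SUP_cong refl) (use V1 in \<open>simp add: Lp_norm_def V_def\<close>)
  have "amalgam_norm \<kappa> \<infinity> \<infinity> \<infinity> f < top \<longleftrightarrow> esssup \<mu> (\<lambda>x. ennreal (cmod (f x))) < top"
    if f[measurable]: "f \<in> borel_measurable borel" for f
  proof
    have ball: "(\<lambda>z. indicator (dunkl_ball (fst z) r) (snd z) :: complex) \<in> borel_measurable (borel \<Otimes>\<^sub>M borel)" for r
    proof -
      have "(\<lambda>z. indicator (dunkl_ball (fst z) r) (snd z) :: complex) = (\<lambda>z :: real \<times> real.
          if (if fst z = 0 then - r < snd z \<and> snd z < r else max 0 (\<bar>fst z\<bar> - r) < \<bar>snd z\<bar> \<and> \<bar>snd z\<bar> < \<bar>fst z\<bar> + r) then 1 else 0)"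
        by (auto simp: dunkl_ball_def indicator_def fun_eq_iff)
      then show ?thesis by simp
    qed
    have S[measurable]: "S r f \<in> borel_measurable borel" for r
    proof (rule borel_measurableI_le)
      fix c
      let ?A = "\<lambda>y. {x. c < ennreal (cmod (f x * indicator (dunkl_ball y r) x))}"
      have sect[measurable]: "(\<lambda>x. indicator (dunkl_ball y r) x :: complex) \<in> borel_measurable borel" for y
        using measurable_compose[OF measurable_Pair1'[of y borel borel] ball[of r]] by simp
      \<comment> \<open>A sublevel set of \<open>S r f\<close> consists of the \<open>y\<close>
        whose section \<open>?A y\<close> is null, and the measure of a section depends measurably
        on \<open>y\<close>.\<close>
      have "S r f y \<le> c \<longleftrightarrow> emeasure \<mu> (?A y) = 0" for y
      proof -
        have "S r f y \<le> c \<longleftrightarrow> (AE x in \<mu>. ennreal (cmod (f x * indicator (dunkl_ball y r) x)) \<le> c)"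
        proof
          assume "S r f y \<le> c"
          then show "AE x in \<mu>. ennreal (cmod (f x * indicator (dunkl_ball y r) x)) \<le> c"
            using esssup_AE[of "\<lambda>x. ennreal (cmod (f x * indicator (dunkl_ball y r) x))" \<mu>]
            unfolding S_def by (auto elim!: eventually_mono)
        qed (auto simp: S_def intro!: esssup_I)
        also have "\<dots> \<longleftrightarrow> emeasure \<mu> (?A y) = 0"
          by (subst AE_iff_measurable[of "?A y"]) (auto simp: not_le)
        finally show ?thesis .
      qed
      moreover have "(\<lambda>y. emeasure \<mu> (?A y)) \<in> borel_measurable borel"
      proof (rule mu.measurable_emeasure)
        define h where "h z = f (snd z) * indicator (dunkl_ball (fst z) r) (snd z)" for z
        have h: "h \<in> borel_measurable (borel \<Otimes>\<^sub>M borel)"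
          unfolding h_def by (intro borel_measurable_times ball measurable_compose[OF measurable_snd f])
        have eq: "sets (borel \<Otimes>\<^sub>M \<mu>) = sets (borel \<Otimes>\<^sub>M (borel :: real measure))"
          by (intro sets_pair_measure_cong) simp_all
        have "{z \<in> space (borel \<Otimes>\<^sub>M borel). c < ennreal (cmod (h z))} \<in> sets (borel \<Otimes>\<^sub>M borel)"
          by (intro borel_measurable_less borel_measurable_const measurable_compose[OF _ measurable_ennreal]
              measurable_compose[OF h borel_measurable_norm])
        then show "{x \<in> space (borel \<Otimes>\<^sub>M \<mu>). snd x \<in> ?A (fst x)} \<in> sets (borel \<Otimes>\<^sub>M \<mu>)"
          unfolding eq h_def by (simp add: space_pair_measure)
      qed simp
      ultimately show "{x \<in> space borel. S r f x \<le> c} \<in> sets borel" by simp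
    qed
    {
      assume fin: "esssup \<mu> (\<lambda>x. ennreal (cmod (f x))) < top"
      have "S r f y \<le> esssup \<mu> (\<lambda>x. ennreal (cmod (f x)))" for r y
      proof (cases "(\<lambda>x. ennreal (cmod (f x * indicator (dunkl_ball y r) x))) \<in> borel_measurable \<mu>")
        case True
        then show ?thesis unfolding S_def by (rule esssup_mono) (simp add: indicator_def)
      next
        case False
        then show ?thesis
          using measurable_compose[OF measurable_Pair1'[of y borel borel] ball[of r]] f by simp
      qed
      then have "amalgam_norm \<kappa> \<infinity> \<infinity> \<infinity> f \<le> esssup \<mu> (\<lambda>x. ennreal (cmod (f x)))"
        unfolding norm_eq by (intro SUP_least esssup_I) auto
      then show "amalgam_norm \<kappa> \<infinity> \<infinity> \<infinity> f < top" using fin by (rule le_less_trans)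
    }
    define N where "N = amalgam_norm \<kappa> \<infinity> \<infinity> \<infinity> f"
    assume "amalgam_norm \<kappa> \<infinity> \<infinity> \<infinity> f < top"
    then have N: "N < top" by (simp add: N_def)
    have "AE x in \<mu>. 0 < \<bar>x\<bar> \<and> \<bar>x\<bar> < real n \<longrightarrow> ennreal (cmod (f x)) \<le> N" for n :: nat
    proof -
      \<comment> \<open>With this radius and a centre in (0, 1) the ball contains every nonzero x
        with |x| < n. The origin lies in no ball with nonzero centre and is handled by
        \<open>AE_mu_nonzero\<close>.\<close>
      define r where "r = real n + 1"
      have r: "0 < r" by (simp add: r_def)
      have SN: "esssup \<mu> (S r f) \<le> N"
        unfolding N_def norm_eq using r by (intro SUP_upper) simp
      \<comment> \<open>An almost everywhere bound in the centre holds at some point of (0, 1),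
        because this interval has positive measure.\<close>
      have "\<exists>y\<in>{0<..<1}. S r f y \<le> N"
      proof (rule ccontr)
        assume no: "\<not> ?thesis"
        have "AE y in \<mu>. y \<notin> {0<..<1}"
          using esssup_AE[of "S r f" \<mu>]
        proof eventually_elim
          fix y assume "S r f y \<le> esssup \<mu> (S r f)"
          then have "S r f y \<le> N" using SN by (rule order_trans)
          then show "y \<notin> {0<..<1}" using no by blast
        qed
        then have "emeasure \<mu> {0<..<1} = 0"
          by (subst (asm) AE_iff_measurable[of "{0<..<1}"]) auto
        then show False using emeasure_mu_pos[of 0 1] by simp
      qed
      then obtain y where y: "0 < y" "y < 1" "S r f y \<le> N" by auto
      show ?thesis
        using esssup_AE[of "\<lambda>x. ennreal (cmod (f x * indicator (dunkl_ball y r) x))" \<mu>]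
      proof eventually_elim
        fix x assume "ennreal (cmod (f x * indicator (dunkl_ball y r) x)) \<le> esssup \<mu> (\<lambda>x. ennreal (cmod (f x * indicator (dunkl_ball y r) x)))"
        then have *: "ennreal (cmod (f x * indicator (dunkl_ball y r) x)) \<le> N"
          using y(3) unfolding S_def by (rule order_trans)
        show "0 < \<bar>x\<bar> \<and> \<bar>x\<bar> < real n \<longrightarrow> ennreal (cmod (f x)) \<le> N"
        proof
          assume "0 < \<bar>x\<bar> \<and> \<bar>x\<bar> < real n"
          then have "x \<in> dunkl_ball y r" using y by (auto simp: dunkl_ball_def r_def)
          then show "ennreal (cmod (f x)) \<le> N" using * by simp
        qed
      qed
    qed
    then have "AE x in \<mu>. \<forall>n::nat. 0 < \<bar>x\<bar> \<and> \<bar>x\<bar> < real n \<longrightarrow> ennreal (cmod (f x)) \<le> N"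
      by (rule AE_all_countable[THEN iffD2, rule_format])
    then have "AE x in \<mu>. ennreal (cmod (f x)) \<le> N"
      using AE_mu_nonzero
    proof eventually_elim
      fix x :: real assume *: "\<forall>n::nat. 0 < \<bar>x\<bar> \<and> \<bar>x\<bar> < real n \<longrightarrow> ennreal (cmod (f x)) \<le> N" "x \<noteq> 0"
      obtain n :: nat where "\<bar>x\<bar> < real n" using reals_Archimedean2 by blast
      then show "ennreal (cmod (f x)) \<le> N" using * by auto
    qed
    then have "esssup \<mu> (\<lambda>x. ennreal (cmod (f x))) \<le> N" by (intro esssup_I) auto
    then show "esssup \<mu> (\<lambda>x. ennreal (cmod (f x))) < top" using N by (rule le_less_trans)
  qed
  then show ?thesis
    by (auto simp: amalgam_space_def Lp_space_def Lp_norm_def)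
qed

end

theorem proposition5p5:
  fixes \<kappa> :: real and q \<alpha> p :: ennreal
  assumes "\<kappa> > - 1 / 2"
    and "1 \<le> q" and "q \<le> \<alpha>" and "\<alpha> \<le> p"
    and "\<alpha> \<in> {q, p}"
  shows "amalgam_space \<kappa> q p \<alpha> = Lp_space (dunkl_measure \<kappa>) \<alpha>"
proof -
  interpret dunkl \<kappa> by unfold_locales (rule assms(1))
  show ?thesis
    using assms(2)
  proof (cases rule: ennreal_exponent_cases)
    case infinite
    then have "\<alpha> = \<infinity>" "p = \<infinity>" using assms(3,4) by (auto simp: top_unique)
    then show ?thesis using infinite amalgam_space_infinity by simp
  next
    case (finite Q)
    have "ennreal Q \<le> p" using finite assms by (metis order_trans)
    then show ?thesis
      using assms(5) finite amalgam_space_lower_exponent[of Q p] amalgam_space_upper_exponent[of Q p] by auto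
  qed
qed

end
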